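(* Let $(V,\omega)$ be a $2n$-dimensional real symplectic space, $L_1,L_2,L_3\in\Lambda(V,\omega)$, $\psi:[0,T]\to\mathrm{Sp}(V,\omega)$ of class $\mathscr C^1$ with $\psi(0)=\mathrm{Id}$, and $\ell_i(t)=\psi(t)L_i$ for $i=1,2$. Assume: (1) $\ell_2$ is an $L_3$-plus curve; (2) $\iota(L_1,L_2,L_3)=n-\dim(L_1\cap L_2)$; (3) $\iota^{\mathrm{CLM}}(L_3,\ell_1(t);t\in[0,T])=0$. Then $\iota^{\mathrm{CLM}}(L_3,\ell_2(t);t\in[0,T])=0$.
   Context: $\Lambda(V,\omega)$ is the Lagrangian Grassmannian of $(V,\omega)$. For $L_0\in\Lambda(V,\omega)$ and a continuous path $\ell:[a,b]\to\Lambda(V,\omega)$, $\iota^{\mathrm{CLM}}(L_0,\ell(t);t\in[a,b])\in\mathbb Z$ denotes the Cappell–Lee–Miller Maslov index: the intersection index of $\ell$ with the Maslov cycle $\Sigma(L_0)=\{L: L\cap L_0\neq\{0\}\}$; it is invariant under fixed-endpoint homotopies, additive under concatenation, and for $\mathscr C^1$ paths with only regular crossings equals $n_+(\Gamma(\ell,L_0,a))+\sum_{a<t<b}\operatorname{sgn}\Gamma(\ell,L_0,t)-n_-(\Gamma(\ell,L_0,b))$, where a crossing is $t_0$ with $\ell(t_0)\cap L_0\ne\{0\}$, the crossing form on $\ell(t_0)\cap L_0$ is $\Gamma(\ell,L_0,t_0)[v]=\frac{d}{dt}|_{t=t_0}\omega(v,w(t))$ with $w(t)$ the unique vector in a fixed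 Lagrangian $W$ transversal to $\ell(t_0)$ such that $v+w(t)\in\ell(t)$, and regular means nondegenerate. A $\mathscr C^1$ curve $\ell$ is an $L_0$-plus curve if at each crossing the crossing form is positive definite. Triple index: for $\alpha,\beta,\gamma\in\Lambda(V,\omega)$ let $Q(\alpha,\beta;\gamma)$ be the quadratic form on $\alpha\cap(\beta+\gamma)$ given by $Q(\alpha,\beta;\gamma)(x)=\omega(y,z)$ where $x=y+z$ with $y\in\beta$, $z\in\gamma$ (independent of the decomposition); then $\iota(\alpha,\beta,\gamma)=n_+\big(Q(\alpha,\beta;\gamma)\big)+\dim(\alpha\cap\gamma)-\dim(\alpha\cap\beta\cap\gamma)$, where $n_+$ is the positive inertia index. *)

theory Defs
  imports "HOL-Analysis.Analysis"
begin

definition symplectic_form :: "('a::euclidean_space \<Rightarrow> 'a \<Rightarrow> real) \<Rightarrow> bool" where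
  "symplectic_form \<omega> \<longleftrightarrow>
     (\<forall>x. linear (\<omega> x)) \<and> (\<forall>y. linear (\<lambda>x. \<omega> x y)) \<and>
     (\<forall>x y. \<omega> x y = - \<omega> y x) \<and>
     (\<forall>x. (\<forall>y. \<omega> x y = 0) \<longrightarrow> x = 0)"

definition symp_compl :: "('a::euclidean_space \<Rightarrow> 'a \<Rightarrow> real) \<Rightarrow> 'a set \<Rightarrow> 'a set" where
  "symp_compl \<omega> L = {y. \<forall>x\<in>L. \<omega> x y = 0}"

definition lagrangian :: "('a::euclidean_space \<Rightarrow> 'a \<Rightarrow> real) \<Rightarrow> 'a set \<Rightarrow> bool" where
  "lagrangian \<omega> L \<longleftrightarrow> subspace L \<and> symp_compl \<omega> L = L"

definition symplectic_map :: "('a::euclidean_space \<Rightarrow> 'a \<Rightarrow> real) \<Rightarrow> ('a \<Rightarrow>\<^sub>L 'a) \<Rightarrow> bool" where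
  "symplectic_map \<omega> A \<longleftrightarrow> bij (blinfun_apply A) \<and>
     (\<forall>x y. \<omega> (blinfun_apply A x) (blinfun_apply A y) = \<omega> x y)"

definition subspace_gap :: "'a::euclidean_space set \<Rightarrow> 'a set \<Rightarrow> real" where
  "subspace_gap L M = max (SUP x\<in>{x\<in>L. norm x \<le> 1}. infdist x M)
                           (SUP y\<in>{y\<in>M. norm y \<le> 1}. infdist y L)"

definition subspaces_continuous_on :: "'b::metric_space set \<Rightarrow> ('b \<Rightarrow> 'a::euclidean_space set) \<Rightarrow> bool" where
  "subspaces_continuous_on S F \<longleftrightarrow>
     (\<forall>p\<in>S. \<forall>e>0. \<exists>d>0. \<forall>q\<in>S. dist q p < d \<longrightarrow> subspace_gap (F q) (F p) < e)"

definition lag_path :: "('a::euclidean_space \<Rightarrow> 'a \<Rightarrow> real) \<Rightarrow> (real \<Rightarrow> 'a set) \<Rightarrow> real \<Rightarrow> real \<Rightarrow> bool" where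
  "lag_path \<omega> l a b \<longleftrightarrow> (\<forall>t\<in>{a..b}. lagrangian \<omega> (l t)) \<and> subspaces_continuous_on {a..b} l"

definition C1_on :: "real set \<Rightarrow> (real \<Rightarrow> 'b::real_normed_vector) \<Rightarrow> bool" where
  "C1_on S f \<longleftrightarrow> (\<exists>f'. (\<forall>t\<in>S. (f has_vector_derivative f' t) (at t within S)) \<and> continuous_on S f')"

definition lag_C1 :: "('a::euclidean_space \<Rightarrow> 'a \<Rightarrow> real) \<Rightarrow> (real \<Rightarrow> 'a set) \<Rightarrow> real \<Rightarrow> real \<Rightarrow> bool" where
  "lag_C1 \<omega> l a b \<longleftrightarrow> (\<forall>t\<in>{a..b}. lagrangian \<omega> (l t)) \<and>
     (\<exists>Z::real \<Rightarrow> ('a \<Rightarrow>\<^sub>L 'a). C1_on {a..b} Z \<and> (\<forall>t\<in>{a..b}. l t = range (blinfun_apply (Z t))))"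

definition lag_homotopic :: "('a::euclidean_space \<Rightarrow> 'a \<Rightarrow> real) \<Rightarrow> (real \<Rightarrow> 'a set) \<Rightarrow> (real \<Rightarrow> 'a set) \<Rightarrow> real \<Rightarrow> real \<Rightarrow> bool" where
  "lag_homotopic \<omega> l m a b \<longleftrightarrow>
     (\<exists>H::real \<times> real \<Rightarrow> 'a set.
        (\<forall>s\<in>{0..1}. \<forall>t\<in>{a..b}. lagrangian \<omega> (H (s,t))) \<and>
        subspaces_continuous_on ({0..1} \<times> {a..b}) H \<and>
        (\<forall>t\<in>{a..b}. H (0,t) = l t \<and> H (1,t) = m t) \<and>
        (\<forall>s\<in>{0..1}. H (s,a) = l a \<and> H (s,b) = l b))"

definition polar :: "('a::real_vector \<Rightarrow> real) \<Rightarrow> 'a \<Rightarrow> 'a \<Rightarrow> real" where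
  "polar Q x y = (Q (x + y) - Q x - Q y) / 2"

definition n_plus :: "('a::euclidean_space \<Rightarrow> real) \<Rightarrow> 'a set \<Rightarrow> nat" where
  "n_plus Q S = Max {dim U | U. subspace U \<and> U \<subseteq> S \<and> (\<forall>u\<in>U. u \<noteq> 0 \<longrightarrow> Q u > 0)}"

definition n_minus :: "('a::euclidean_space \<Rightarrow> real) \<Rightarrow> 'a set \<Rightarrow> nat" where
  "n_minus Q S = Max {dim U | U. subspace U \<and> U \<subseteq> S \<and> (\<forall>u\<in>U. u \<noteq> 0 \<longrightarrow> Q u < 0)}"

definition qf_signature :: "('a::euclidean_space \<Rightarrow> real) \<Rightarrow> 'a set \<Rightarrow> int" where
  "qf_signature Q S = int (n_plus Q S) - int (n_minus Q S)"

definition qf_nondegenerate :: "('a::euclidean_space \<Rightarrow> real) \<Rightarrow> 'a set \<Rightarrow> bool" where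
  "qf_nondegenerate Q S \<longleftrightarrow> (\<forall>x\<in>S. (\<forall>y\<in>S. polar Q x y = 0) \<longrightarrow> x = 0)"

definition is_crossing :: "'a::euclidean_space set \<Rightarrow> (real \<Rightarrow> 'a set) \<Rightarrow> real \<Rightarrow> bool" where
  "is_crossing L0 l t \<longleftrightarrow> l t \<inter> L0 \<noteq> {0}"

text \<open>Crossing form Gamma(l, L0, t0) on l(t0) \<inter> L0, computed with a fixed Lagrangian W
  transversal to l(t0); derivatives are taken within [a,b].\<close>
definition crossing_form :: "('a::euclidean_space \<Rightarrow> 'a \<Rightarrow> real) \<Rightarrow> (real \<Rightarrow> 'a set) \<Rightarrow> real \<Rightarrow> real \<Rightarrow> real \<Rightarrow> 'a \<Rightarrow> real" where
  "crossing_form \<omega> l a b t0 v =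
     (let W = (SOME W. lagrangian \<omega> W \<and> W \<inter> l t0 = {0})
      in vector_derivative (\<lambda>t. \<omega> v (THE w. w \<in> W \<and> v + w \<in> l t)) (at t0 within {a..b}))"

definition regular_crossings :: "('a::euclidean_space \<Rightarrow> 'a \<Rightarrow> real) \<Rightarrow> 'a set \<Rightarrow> (real \<Rightarrow> 'a set) \<Rightarrow> real \<Rightarrow> real \<Rightarrow> bool" where
  "regular_crossings \<omega> L0 l a b \<longleftrightarrow>
     (\<forall>t\<in>{a..b}. is_crossing L0 l t \<longrightarrow> qf_nondegenerate (crossing_form \<omega> l a b t) (l t \<inter> L0))"

definition plus_curve :: "('a::euclidean_space \<Rightarrow> 'a \<Rightarrow> real) \<Rightarrow> 'a set \<Rightarrow> (real \<Rightarrow> 'a set) \<Rightarrow> real \<Rightarrow> real \<Rightarrow> bool" where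
  "plus_curve \<omega> L0 l a b \<longleftrightarrow> lag_C1 \<omega> l a b \<and>
     (\<forall>t\<in>{a..b}. is_crossing L0 l t \<longrightarrow>
        (\<forall>v\<in>l t \<inter> L0. v \<noteq> 0 \<longrightarrow> crossing_form \<omega> l a b t v > 0))"

definition crossing_sum :: "('a::euclidean_space \<Rightarrow> 'a \<Rightarrow> real) \<Rightarrow> 'a set \<Rightarrow> (real \<Rightarrow> 'a set) \<Rightarrow> real \<Rightarrow> real \<Rightarrow> int" where
  "crossing_sum \<omega> L0 l a b =
     int (n_plus (crossing_form \<omega> l a b a) (l a \<inter> L0))
     + (\<Sum>t\<in>{t\<in>{a<..<b}. is_crossing L0 l t}. qf_signature (crossing_form \<omega> l a b t) (l t \<inter> L0))
     - int (n_minus (crossing_form \<omega> l a b b) (l b \<inter> L0))"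

text \<open>The CLM index of a continuous Lagrangian path is the crossing-form count of any
  C^1 path with only regular crossings that is homotopic to it with fixed endpoints
  (well defined by homotopy invariance, existence of regular perturbations and the
  crossing-form formula).\<close>
definition iota_CLM :: "('a::euclidean_space \<Rightarrow> 'a \<Rightarrow> real) \<Rightarrow> 'a set \<Rightarrow> (real \<Rightarrow> 'a set) \<Rightarrow> real \<Rightarrow> real \<Rightarrow> int" where
  "iota_CLM \<omega> L0 l a b =
     (THE k. \<exists>m. lag_C1 \<omega> m a b \<and> regular_crossings \<omega> L0 m a b \<and>
                  lag_homotopic \<omega> l m a b \<and> k = crossing_sum \<omega> L0 m a b)"

definition triple_Q :: "('a::euclidean_space \<Rightarrow> 'a \<Rightarrow> real) \<Rightarrow> 'a set \<Rightarrow> 'a set \<Rightarrow> 'a set \<Rightarrow> 'a \<Rightarrow> real" where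
  "triple_Q \<omega> \<alpha> \<beta> \<gamma> x = (SOME r. \<exists>y z. y \<in> \<beta> \<and> z \<in> \<gamma> \<and> x = y + z \<and> r = \<omega> y z)"

definition triple_index :: "('a::euclidean_space \<Rightarrow> 'a \<Rightarrow> real) \<Rightarrow> 'a set \<Rightarrow> 'a set \<Rightarrow> 'a set \<Rightarrow> nat" where
  "triple_index \<omega> \<alpha> \<beta> \<gamma> =
     n_plus (triple_Q \<omega> \<alpha> \<beta> \<gamma>) (\<alpha> \<inter> {y + z | y z. y \<in> \<beta> \<and> z \<in> \<gamma>})
     + dim (\<alpha> \<inter> \<gamma>) - dim (\<alpha> \<inter> \<beta> \<inter> \<gamma>)"

end

theory Submission
  imports Defs
begin

text \<open>
  For transversal Lagrangians \<open>W\<close> and \<open>l\<close> let \<open>q(v) = \<omega>(\<pi> v, v)\<close>, where \<open>\<pi>\<close> projects onto \<open>W\<close> along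
  \<open>l\<close>. On a Lagrangian \<open>L\<close> its kernel is \<open>L \<inter> l + L \<inter> W\<close>. Along a path \<open>l(t)\<close> that stays
  transversal to \<open>W\<close> the increment of \<open>n\<^sub>+(q|L)\<close> does not depend on \<open>W\<close>: a cocycle identity between
  four Lagrangians shows that a change of chart alters \<open>n\<^sub>+\<close> by the indices of forms of constant
  nullity. The local increments glue over a convex parameter space, which gives a homotopy invariant
  integer. At a regular crossing \<open>n\<^sub>+\<close> jumps by the inertia indices of the crossing form, so this
  integer is the Cappell-Lee-Miller index. A regular representative of a path \<open>\<psi>(t) M\<close> is obtained
  by composing it with a fast positive rotation.

  Fix \<open>W\<close> transversal to \<open>L1\<close> and \<open>L2\<close>, with forms \<open>q1\<close>, \<open>q2\<close>, and use the chart \<open>\<psi>(t) W\<close>, which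
  moves with both paths. The difference of the two indices is then the increment over \<open>[0, T]\<close> of
  \<open>n\<^sub>+(q2|\<psi>(t)\<^sup>-\<^sup>1 L3) - n\<^sub>+(q1|\<psi>(t)\<^sup>-\<^sup>1 L3)\<close>. By subadditivity this quantity never exceeds
  \<open>n\<^sub>+(q2|L1)\<close>, and by the cocycle identity the bound is attained at \<open>t = 0\<close> when the triple index
  is maximal. Hence the index of the second path is at most that of the first, and it is nonnegative
  because the second path is a plus curve.
\<close>

section \<open>Inertia of quadratic forms\<close>

definition quadform :: "('a::real_vector \<Rightarrow> real) \<Rightarrow> bool" where
  "quadform q \<longleftrightarrow> bilinear (polar q) \<and> (\<forall>x. polar q x x = q x)"

definition form_radical :: "('a::real_vector \<Rightarrow> real) \<Rightarrow> 'a set \<Rightarrow> 'a set" where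
  "form_radical q S = {x\<in>S. \<forall>y\<in>S. polar q x y = 0}"

definition posdef_on :: "('a::real_vector \<Rightarrow> real) \<Rightarrow> 'a set \<Rightarrow> bool" where
  "posdef_on q U \<longleftrightarrow> (\<forall>u\<in>U. u \<noteq> 0 \<longrightarrow> q u > 0)"

lemma bilinear_polar: "quadform q \<Longrightarrow> bilinear (polar q)"
  by (simp add: quadform_def)

lemma polar_self: "quadform q \<Longrightarrow> polar q x x = q x"
  by (simp add: quadform_def)

lemma polar_commute: "polar q x y = polar q y x"
  by (simp add: polar_def add.commute)

lemma form_add_polar: "q (x + y) = q x + 2 * polar q x y + q y"
  by (simp add: polar_def field_simps)

lemma polar_uminus: "polar (\<lambda>x. - q x) x y = - polar q x y"
  by (simp add: polar_def field_simps)

lemma polar_bilinear: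
  assumes "bilinear b"
  shows "polar (\<lambda>x. b x x) x y = (b x y + b y x) / 2"
  by (simp add: polar_def bilinear_ladd[OF assms] bilinear_radd[OF assms])

lemma quadform_bilinear:
  assumes "bilinear b"
  shows "quadform (\<lambda>x. b x x)"
proof -
  have "bilinear (\<lambda>x y. (b x y + b y x) / 2)"
    unfolding bilinear_def linear_iff
    by (simp add: bilinear_ladd[OF assms] bilinear_radd[OF assms]
        bilinear_lmul[OF assms] bilinear_rmul[OF assms] field_simps)
  moreover have "polar (\<lambda>x. b x x) = (\<lambda>x y. (b x y + b y x) / 2)"
    by (intro ext polar_bilinear assms)
  ultimately show ?thesis by (simp add: quadform_def)
qed

lemma quadform_scale: "quadform q \<Longrightarrow> q (c *\<^sub>R x) = c\<^sup>2 * q x"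
  using polar_self[of q "c *\<^sub>R x"] polar_self[of q x]
  by (simp add: bilinear_lmul[OF bilinear_polar] bilinear_rmul[OF bilinear_polar] power2_eq_square)

lemma quadform_zero: "quadform q \<Longrightarrow> q 0 = 0"
  using quadform_scale[of q 0 0] by simp

lemma quadform_comp_linear:
  assumes "quadform q" "linear f"
  shows "quadform (\<lambda>x. q (f x))"
proof -
  have "bilinear (\<lambda>x y. polar q (f x) (f y))"
    using bilinear_polar[OF assms(1)] assms(2) unfolding bilinear_def linear_iff by simp
  from quadform_bilinear[OF this] show ?thesis by (simp add: polar_self[OF assms(1)])
qed

lemma quadform_add:
  assumes "quadform q" "quadform r"
  shows "quadform (\<lambda>x. q x + r x)"
proof -
  have "bilinear (\<lambda>x y. polar q x y + polar r x y)"
    using assms[THEN bilinear_polar] unfolding bilinear_def linear_iff by (simp add: algebra_simps)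
  from quadform_bilinear[OF this] show ?thesis by (simp add: assms[THEN polar_self])
qed

lemma quadform_cmult:
  assumes "quadform q"
  shows "quadform (\<lambda>x. c * q x)"
proof -
  have "bilinear (\<lambda>x y. c * polar q x y)"
    using bilinear_polar[OF assms] unfolding bilinear_def linear_iff by (simp add: algebra_simps)
  from quadform_bilinear[OF this] show ?thesis by (simp add: polar_self[OF assms])
qed

lemma quadform_uminus: "quadform q \<Longrightarrow> quadform (\<lambda>x. - q x)"
  using quadform_cmult[of q "-1"] by simp

lemma quadform_diff: "quadform q \<Longrightarrow> quadform r \<Longrightarrow> quadform (\<lambda>x. q x - r x)"
  using quadform_add[OF _ quadform_uminus, of q r] by simp

lemma anisotropic_imp_nondegenerate:
  "quadform q \<Longrightarrow> (\<And>x. x \<in> S \<Longrightarrow> x \<noteq> 0 \<Longrightarrow> q x \<noteq> 0) \<Longrightarrow> qf_nondegenerate q S"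
  unfolding qf_nondegenerate_def by (metis polar_self)

lemma qf_nondegenerate_uminus: "qf_nondegenerate (\<lambda>x. - q x) S \<longleftrightarrow> qf_nondegenerate q S"
  by (simp add: qf_nondegenerate_def polar_uminus)

lemma posdef_on_Int_nonpos: "posdef_on q U \<Longrightarrow> (\<And>x. x \<in> N \<Longrightarrow> q x \<le> 0) \<Longrightarrow> U \<inter> N \<subseteq> {0}"
  by (force simp: posdef_on_def)

lemma posdef_on_orthogonal_sum:
  assumes q: "quadform q" and "posdef_on q U" "posdef_on q V"
    and orth: "\<And>u v. u \<in> U \<Longrightarrow> v \<in> V \<Longrightarrow> polar q u v = 0"
  shows "posdef_on q {u + v |u v. u \<in> U \<and> v \<in> V}"
proof -
  have nonneg: "q u \<ge> 0" if "u \<in> U \<union> V" for u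
    using that assms(2,3) quadform_zero[OF q]
    by (cases "u = 0") (auto simp: posdef_on_def less_imp_le)
  have "q (u + v) > 0" if "u \<in> U" "v \<in> V" "u + v \<noteq> 0" for u v
  proof -
    have "q u > 0 \<or> q v > 0" using that assms(2,3) by (cases "u = 0") (auto simp: posdef_on_def)
    moreover have "q (u + v) = q u + q v" using orth that by (simp add: form_add_polar)
    ultimately show ?thesis
      using nonneg[of u] nonneg[of v] that by (auto simp: add_pos_nonneg add_nonneg_pos)
  qed
  then show ?thesis by (auto simp: posdef_on_def)
qed

lemma subspace_form_radical:
  assumes "quadform q" "subspace S"
  shows "subspace (form_radical q S)"
  using assms(2) bilinear_polar[OF assms(1)]
  by (auto simp: form_radical_def subspace_def bilinear_ladd bilinear_lmul bilinear_lzero)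

lemma form_zero_on_radical: "quadform q \<Longrightarrow> x \<in> form_radical q S \<Longrightarrow> q x = 0"
  using polar_self[of q x] by (auto simp: form_radical_def)

lemma form_radical_comp_blinfun:
  "x \<in> form_radical (\<lambda>x. q (blinfun_apply A x)) S \<Longrightarrow> A x \<in> form_radical q (A ` S)"
  by (auto simp: form_radical_def polar_def blinfun.add_right)

lemma dim_sums_trivial_Int:
  fixes U V :: "'a::euclidean_space set"
  assumes "subspace U" "subspace V" "U \<inter> V \<subseteq> {0}"
  shows "dim {u + v |u v. u \<in> U \<and> v \<in> V} = dim U + dim V"
  using dim_sums_Int[OF assms(1,2)] assms(3) dim_eq_0[of "U \<inter> V"] by linarith

lemma sums_subset: "subspace S \<Longrightarrow> U \<subseteq> S \<Longrightarrow> V \<subseteq> S \<Longrightarrow> {u + v |u v. u \<in> U \<and> v \<in> V} \<subseteq> S"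
  by (auto intro: subspace_add)

lemma linear_sum_decomposition:
  fixes A B :: "'b::euclidean_space set"
  assumes sub: "subspace A" "subspace B" and S: "S \<subseteq> {y + z |y z. y \<in> A \<and> z \<in> B}"
  obtains \<zeta> where "linear \<zeta>" "range \<zeta> \<subseteq> B" "\<And>x. x \<in> S \<Longrightarrow> x - \<zeta> x \<in> A"
proof -
  let ?s = "\<lambda>(y, z). y + z :: 'b"
  have lin: "linear ?s" by (rule linearI) (auto simp: algebra_simps)
  obtain g where g: "range g \<subseteq> A \<times> B" "linear g" "\<And>v. v \<in> ?s ` (A \<times> B) \<Longrightarrow> ?s (g v) = v"
    using linear_exists_right_inverse_on[OF lin subspace_Times[OF sub]] by metis
  have gin: "fst (g x) \<in> A" "snd (g x) \<in> B" for x
    using g(1) by (auto simp: mem_Times_iff image_subset_iff)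
  show ?thesis
  proof (rule that[of "\<lambda>x. snd (g x)"])
    show "linear (\<lambda>x. snd (g x))" using linear_compose[OF g(2) linear_snd] by (simp add: o_def)
    show "range (\<lambda>x. snd (g x)) \<subseteq> B" using gin(2) by blast
    fix x assume "x \<in> S"
    then have "x \<in> ?s ` (A \<times> B)" using S by force
    then have "fst (g x) + snd (g x) = x" using g(3)[of x] by (simp add: case_prod_unfold)
    then show "x - snd (g x) \<in> A" using gin(1)[of x] by (metis add_diff_cancel_right')
  qed
qed

lemma n_minus_eq_n_plus: "n_minus q S = n_plus (\<lambda>x. - q x) S"
  by (simp add: n_minus_def n_plus_def)

lemma finite_positive_dims:
  fixes S :: "'a::euclidean_space set" and q :: "'a \<Rightarrow> real"
  shows "finite {dim U | U. subspace U \<and> U \<subseteq> S \<and> (\<forall>u\<in>U. u \<noteq> 0 \<longrightarrow> q u > 0)}"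
  by (rule finite_subset[of _ "{..DIM('a)}"]) (auto simp: dim_subset_UNIV)

lemma dim_le_n_plus:
  assumes "subspace U" "U \<subseteq> S" "posdef_on q U"
  shows "dim U \<le> n_plus q S"
  unfolding n_plus_def
  by (rule Max_ge[OF finite_positive_dims]) (use assms in \<open>auto simp: posdef_on_def\<close>)

lemma n_plus_attained:
  assumes "subspace S"
  obtains U where "subspace U" "U \<subseteq> S" "posdef_on q U" "dim U = n_plus q S"
proof -
  let ?A = "{dim U | U. subspace U \<and> U \<subseteq> S \<and> (\<forall>u\<in>U. u \<noteq> 0 \<longrightarrow> q u > 0)}"
  have "dim {0::'a} \<in> ?A" using assms subspace_0 by (intro CollectI exI[of _ "{0}"]) auto
  then have "n_plus q S \<in> ?A" unfolding n_plus_def by (intro Max_in finite_positive_dims) blast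
  then show ?thesis using that by (auto simp: posdef_on_def)
qed

lemma n_plus_cong: "(\<And>x. x \<in> S \<Longrightarrow> q x = r x) \<Longrightarrow> n_plus q S = n_plus r S"
  unfolding n_plus_def by (intro arg_cong[of _ _ Max]) (metis (no_types, lifting) subset_iff)

lemma n_plus_eq_0:
  assumes "subspace S" "\<And>x. x \<in> S \<Longrightarrow> q x \<le> 0"
  shows "n_plus q S = 0"
proof -
  obtain U where U: "subspace U" "U \<subseteq> S" "posdef_on q U" "dim U = n_plus q S"
    using n_plus_attained[OF assms(1)] by blast
  have "U \<inter> S \<subseteq> {0}" by (rule posdef_on_Int_nonpos[OF U(3) assms(2)])
  then show ?thesis using U(2,4) by (metis dim_eq_0 inf.absorb1)
qed

lemma n_plus_le_linear_image:
  fixes q :: "'a::euclidean_space \<Rightarrow> real" and r :: "'b::euclidean_space \<Rightarrow> real"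
  assumes S: "subspace S" and f: "linear f" "f ` S \<subseteq> T" and r0: "r 0 \<le> 0"
    and pos: "\<And>x. x \<in> S \<Longrightarrow> q x > 0 \<Longrightarrow> r (f x) > 0"
  shows "n_plus q S \<le> n_plus r T"
proof -
  obtain U where U: "subspace U" "U \<subseteq> S" "posdef_on q U" "dim U = n_plus q S"
    using n_plus_attained[OF S] by blast
  have posU: "r (f u) > 0" if "u \<in> U" "u \<noteq> 0" for u
    using that U pos by (auto simp: posdef_on_def)
  have "inj_on f U"
    using posU r0 by (subst linear_inj_on_iff_eq_0[OF f(1) U(1)]) force
  then have "dim (f ` U) = dim U"
    using U(1) by (intro dim_image_eq[OF f(1)]) (simp add: span_eq_iff[THEN iffD2])
  moreover have "dim (f ` U) \<le> n_plus r T"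
  proof (rule dim_le_n_plus)
    show "subspace (f ` U)" using f(1) U(1) by (rule linear_subspace_image)
    show "f ` U \<subseteq> T" using U f by blast
    show "posdef_on r (f ` U)" using posU linear_0[OF f(1)] by (auto simp: posdef_on_def)
  qed
  ultimately show ?thesis using U(4) by simp
qed

lemma n_plus_eq_linear_bij:
  fixes q :: "'a::euclidean_space \<Rightarrow> real" and r :: "'b::euclidean_space \<Rightarrow> real"
  assumes sub: "subspace S" "subspace T" and lin: "linear f" "linear g"
    and im: "f ` S \<subseteq> T" "g ` T \<subseteq> S" and inv: "\<And>y. y \<in> T \<Longrightarrow> f (g y) = y"
    and qr: "\<And>x. x \<in> S \<Longrightarrow> r (f x) = q x" and zero: "q 0 \<le> 0"
  shows "n_plus q S = n_plus r T"
proof (rule antisym)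
  have "r 0 \<le> 0" using qr[of 0] zero linear_0[OF lin(1)] subspace_0[OF sub(1)] by simp
  then show "n_plus q S \<le> n_plus r T"
    by (rule n_plus_le_linear_image[OF sub(1) lin(1) im(1)]) (simp add: qr)
  show "n_plus r T \<le> n_plus q S"
    using qr im(2) inv
    by (intro n_plus_le_linear_image[where f = g] sub lin im zero) (metis image_subset_iff)
qed

lemma n_plus_image:
  fixes q :: "'b::euclidean_space \<Rightarrow> real" and f :: "'a::euclidean_space \<Rightarrow> 'b"
  assumes S: "subspace S" and f: "linear f" "inj_on f S" and q: "q 0 \<le> 0"
  shows "n_plus q (f ` S) = n_plus (\<lambda>x. q (f x)) S"
proof -
  obtain g where g: "linear g" "\<forall>v\<in>S. g (f v) = v"
    using linear_exists_left_inverse_on[OF f(1) S f(2)] by blast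
  have "n_plus (\<lambda>x. q (f x)) S = n_plus q (f ` S)"
    by (rule n_plus_eq_linear_bij[OF S linear_subspace_image[OF f(1) S] f(1) g(1)])
      (use g(2) q f(1) in \<open>auto simp: linear_0\<close>)
  then show ?thesis by simp
qed

lemma dim_posdef_plus_dim_nonpos:
  fixes q :: "'a::euclidean_space \<Rightarrow> real"
  assumes "subspace U" "subspace N" "subspace S" "U \<subseteq> S" "N \<subseteq> S"
    and "posdef_on q U" "\<And>x. x \<in> N \<Longrightarrow> q x \<le> 0"
  shows "dim U + dim N \<le> dim S"
  using dim_sums_trivial_Int[OF assms(1,2) posdef_on_Int_nonpos[OF assms(6,7)]]
    dim_subset[OF sums_subset[OF assms(3-5)]] by simp

definition gram :: "('a::real_vector \<Rightarrow> 'b::euclidean_space \<Rightarrow> real) \<Rightarrow> 'a \<Rightarrow> 'b" where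
  "gram b x = adjoint (b x) 1"

lemma inner_gram: "bilinear b \<Longrightarrow> gram b x \<bullet> y = b x y"
  using adjoint_works[of "b x" y 1] by (simp add: gram_def bilinear_def inner_commute)

lemma linear_gram: "bilinear b \<Longrightarrow> linear (gram b)"
  by (rule linearI; rule vector_eq_rdot[THEN iffD1, rule_format])
    (simp_all add: inner_gram inner_add_left bilinear_ladd bilinear_lmul)

lemma dim_annihilator:
  fixes b :: "'a::euclidean_space \<Rightarrow> 'a \<Rightarrow> real"
  assumes b: "bilinear b" and U: "subspace U" and S: "subspace S"
  shows "subspace {x\<in>S. \<forall>u\<in>U. b u x = 0}" "dim S \<le> dim {x\<in>S. \<forall>u\<in>U. b u x = 0} + dim U"
proof -
  note G = linear_gram[OF b]
  let ?M = "{y\<in>UNIV. \<forall>x\<in>gram b ` U. orthogonal x y}"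
  have eq: "{x\<in>S. \<forall>u\<in>U. b u x = 0} = S \<inter> ?M" by (auto simp: inner_gram[OF b] orthogonal_def)
  have M: "subspace ?M"
    by (auto simp: subspace_def orthogonal_def inner_add_right)
  show "subspace {x\<in>S. \<forall>u\<in>U. b u x = 0}" unfolding eq by (rule subspace_inter[OF S M])
  have "dim ?M + dim (gram b ` U) = DIM('a)"
    using dim_subspace_orthogonal_to_vectors[OF linear_subspace_image[OF G U] subspace_UNIV]
    by simp
  moreover have "dim (gram b ` U) \<le> dim U" by (rule dim_image_le[OF G])
  moreover have "dim {x + y |x y. x \<in> S \<and> y \<in> ?M} + dim (S \<inter> ?M) = dim S + dim ?M"
    by (rule dim_sums_Int[OF S M])
  moreover have "dim {x + y |x y. x \<in> S \<and> y \<in> ?M} \<le> DIM('a)" by (rule dim_subset_UNIV)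
  ultimately show "dim S \<le> dim {x\<in>S. \<forall>u\<in>U. b u x = 0} + dim U" unfolding eq by simp
qed

lemma nonpos_on_polar_complement:
  fixes q :: "'a::euclidean_space \<Rightarrow> real"
  assumes q: "quadform q" and S: "subspace S"
    and U: "subspace U" "U \<subseteq> S" "posdef_on q U" "dim U = n_plus q S"
    and x: "x \<in> S" "\<And>u. u \<in> U \<Longrightarrow> polar q u x = 0"
  shows "q x \<le> 0"
proof (rule ccontr)
  assume "\<not> q x \<le> 0"
  then have qx: "q x > 0" by simp
  let ?V = "{u + v |u v. u \<in> U \<and> v \<in> span {x}}"
  have orth: "polar q u v = 0" if "u \<in> U" "v \<in> span {x}" for u v
    using that x by (auto simp: span_singleton bilinear_rmul[OF bilinear_polar[OF q]])
  have "posdef_on q (span {x})"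
    using qx by (auto simp: posdef_on_def span_singleton quadform_scale[OF q])
  then have "posdef_on q ?V" by (rule posdef_on_orthogonal_sum[OF q U(3) _ orth])
  moreover have "?V \<subseteq> S"
    by (rule sums_subset[OF S U(2)]) (use S x(1) in \<open>auto simp: span_minimal\<close>)
  ultimately have "dim ?V \<le> dim U"
    unfolding U(4) by (intro dim_le_n_plus subspace_sums U(1) subspace_span)
  moreover have "U \<inter> span {x} \<subseteq> {0}"
  proof
    fix v assume v: "v \<in> U \<inter> span {x}"
    then have "q v = 0" using orth[of v v] polar_self[OF q, of v] by simp
    then show "v \<in> {0}" using v U(3) by (auto simp: posdef_on_def)
  qed
  then have "dim ?V = dim U + dim {x}" using dim_sums_trivial_Int[OF U(1) subspace_span] by simp
  moreover have "x \<noteq> 0" using qx quadform_zero[OF q] by auto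
  ultimately show False by simp
qed

lemma positive_complement:
  fixes q :: "'a::euclidean_space \<Rightarrow> real"
  assumes q: "quadform q" and S: "subspace S"
  obtains U N where "subspace U" "subspace N" "U \<subseteq> S" "N \<subseteq> S" "posdef_on q U"
    "dim U = n_plus q S" "n_plus q S + dim N = dim S"
    "N = {x\<in>S. \<forall>u\<in>U. polar q u x = 0}" "\<And>x. x \<in> N \<Longrightarrow> q x \<le> 0"
proof -
  obtain U where U: "subspace U" "U \<subseteq> S" "posdef_on q U" "dim U = n_plus q S"
    using n_plus_attained[OF S] by blast
  define N where "N = {x\<in>S. \<forall>u\<in>U. polar q u x = 0}"
  have N: "subspace N" "dim S \<le> dim N + dim U"
    using dim_annihilator[OF bilinear_polar[OF q] U(1) S] by (simp_all add: N_def)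
  have nonpos: "q x \<le> 0" if "x \<in> N" for x
    using that by (intro nonpos_on_polar_complement[OF q S U]) (auto simp: N_def)
  have "dim U + dim N \<le> dim S"
    by (rule dim_posdef_plus_dim_nonpos[OF U(1) N(1) S U(2) _ U(3) nonpos]) (auto simp: N_def)
  then show ?thesis
    using U N nonpos by (intro that[OF U(1) N(1) U(2) _ U(3,4) _ N_def]) (auto simp: N_def)
qed

lemma inertia_decomposition:
  fixes q :: "'a::euclidean_space \<Rightarrow> real"
  assumes q: "quadform q" and S: "subspace S"
  obtains U V where "subspace U" "U \<subseteq> S" "posdef_on q U" "dim U = n_plus q S"
    "subspace V" "V \<subseteq> S" "posdef_on (\<lambda>x. - q x) V"
    "dim U + dim V + dim (form_radical q S) = dim S"
proof -
  obtain U N where U: "subspace U" "U \<subseteq> S" "posdef_on q U" "dim U = n_plus q S"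
    and N: "subspace N" "N \<subseteq> S" "N = {x\<in>S. \<forall>u\<in>U. polar q u x = 0}" "\<And>x. x \<in> N \<Longrightarrow> q x \<le> 0"
    and UN: "n_plus q S + dim N = dim S"
    by (rule positive_complement[OF q S]) blast
  obtain V M where V: "subspace V" "V \<subseteq> N" "posdef_on (\<lambda>x. - q x) V" "dim V = n_minus q N"
    and M: "subspace M" "M \<subseteq> N" "M = {x\<in>N. \<forall>v\<in>V. polar (\<lambda>x. - q x) v x = 0}"
      "\<And>x. x \<in> M \<Longrightarrow> - q x \<le> 0"
    and VM: "n_minus q N + dim M = dim N"
    unfolding n_minus_eq_n_plus by (rule positive_complement[OF quadform_uminus[OF q] N(1)]) blast
  have "{u + n |u n. u \<in> U \<and> n \<in> N} = S"
    using sums_subset[OF S U(2) N(2)] UN U(4)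
      dim_sums_trivial_Int[OF U(1) N(1) posdef_on_Int_nonpos[OF U(3) N(4)]]
    by (intro subspace_dim_equal[OF subspace_sums[OF U(1) N(1)] S]) auto
  moreover have "{v + m |v m. v \<in> V \<and> m \<in> M} = N"
    using sums_subset[OF N(1) V(2) M(2)] VM V(4)
      dim_sums_trivial_Int[OF V(1) M(1) posdef_on_Int_nonpos[OF V(3) M(4)]]
    by (intro subspace_dim_equal[OF subspace_sums[OF V(1) M(1)] N(1)]) auto
  ultimately have decomp: "\<exists>u\<in>U. \<exists>v\<in>V. \<exists>m\<in>M. y = u + (v + m)" if "y \<in> S" for y
    using that by blast
  have q0: "q x = 0" if "x \<in> M" for x using that M(2,4) N(4) by force
  have "polar q x y = 0" if x: "x \<in> M" and y: "y \<in> S" for x y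
  proof -
    obtain u v m where uvm: "y = u + (v + m)" "u \<in> U" "v \<in> V" "m \<in> M" using decomp[OF y] by blast
    then have "polar q u x = 0" "polar q v x = 0" using x M(2,3) N(3) by (auto simp: polar_uminus)
    moreover have "polar q m x = 0" using x uvm(4) subspace_add[OF M(1)] by (simp add: polar_def q0)
    ultimately have "polar q y x = 0" by (simp add: uvm(1) bilinear_ladd[OF bilinear_polar[OF q]])
    then show ?thesis by (simp add: polar_commute)
  qed
  then have "M \<subseteq> form_radical q S" using M(2) N(2) by (auto simp: form_radical_def)
  moreover have "form_radical q S \<subseteq> M"
    using U(2) V(2) N(2)
    by (auto simp: M(3) N(3) form_radical_def polar_uminus polar_commute[of q _ "x" for x])
  ultimately have "M = form_radical q S" by blast
  then show ?thesis using U V N(2) UN VM by (intro that[of U V]) auto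
qed

theorem inertia_sum:
  fixes q :: "'a::euclidean_space \<Rightarrow> real"
  assumes q: "quadform q" and S: "subspace S"
  shows "n_plus q S + n_minus q S + dim (form_radical q S) = dim S"
proof -
  let ?R = "form_radical q S"
  obtain U V where U: "subspace U" "U \<subseteq> S" "posdef_on q U" "dim U = n_plus q S"
    and V: "subspace V" "V \<subseteq> S" "posdef_on (\<lambda>x. - q x) V"
    and dims: "dim U + dim V + dim ?R = dim S"
    by (rule inertia_decomposition[OF q S])
  obtain W where W: "subspace W" "W \<subseteq> S" "posdef_on (\<lambda>x. - q x) W" "dim W = n_minus q S"
    unfolding n_minus_eq_n_plus using n_plus_attained[OF S] by blast
  have R: "subspace ?R" "?R \<subseteq> S"
    using subspace_form_radical[OF q S] by (auto simp: form_radical_def)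
  have nonneg: "- q x \<le> 0" if xUR: "x \<in> {u + r |u r. u \<in> U \<and> r \<in> ?R}" for x
  proof -
    obtain u r where x: "x = u + r" "u \<in> U" "r \<in> ?R" using xUR by blast
    then have "polar q u r = 0" using U(2) by (auto simp: form_radical_def polar_commute[of q u])
    then have "q x = q u" using x(1) form_zero_on_radical[OF q x(3)] by (simp add: form_add_polar)
    then show ?thesis
      using x(2) U(3) quadform_zero[OF q] by (cases "u = 0") (auto simp: posdef_on_def less_imp_le)
  qed
  have "dim W + dim {u + r |u r. u \<in> U \<and> r \<in> ?R} \<le> dim S"
    by (rule dim_posdef_plus_dim_nonpos[OF W(1) subspace_sums[OF U(1) R(1)] S W(2)
          sums_subset[OF S U(2) R(2)] W(3) nonneg])
  moreover have "U \<inter> ?R \<subseteq> {0}"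
    using form_zero_on_radical[OF q] by (intro posdef_on_Int_nonpos[OF U(3)]) simp
  then have "dim {u + r |u r. u \<in> U \<and> r \<in> ?R} = dim U + dim ?R"
    by (rule dim_sums_trivial_Int[OF U(1) R(1)])
  moreover have "dim V \<le> n_minus q S"
    unfolding n_minus_eq_n_plus by (rule dim_le_n_plus[OF V])
  ultimately show ?thesis using dims U(4) W(4) by linarith
qed

lemma n_plus_Times:
  fixes q :: "'a::euclidean_space \<Rightarrow> real" and r :: "'b::euclidean_space \<Rightarrow> real"
  assumes q: "quadform q" and r: "quadform r" and S: "subspace S" and T: "subspace T"
  shows "n_plus (\<lambda>(x, y). q x + r y) (S \<times> T) = n_plus q S + n_plus r T"
proof -
  let ?f = "\<lambda>(x, y). q x + r y"
  obtain U N where U: "subspace U" "U \<subseteq> S" "posdef_on q U" "dim U = n_plus q S"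
    and N: "subspace N" "N \<subseteq> S" "\<And>x. x \<in> N \<Longrightarrow> q x \<le> 0" "n_plus q S + dim N = dim S"
    by (rule positive_complement[OF q S]) blast
  obtain V M where V: "subspace V" "V \<subseteq> T" "posdef_on r V" "dim V = n_plus r T"
    and M: "subspace M" "M \<subseteq> T" "\<And>x. x \<in> M \<Longrightarrow> r x \<le> 0" "n_plus r T + dim M = dim T"
    by (rule positive_complement[OF r T]) blast
  have "q u \<ge> 0" "r v \<ge> 0" if "u \<in> U" "v \<in> V" for u v
    using that U(3) V(3) quadform_zero[OF q] quadform_zero[OF r]
    by (cases "u = 0"; cases "v = 0"; auto simp: posdef_on_def less_imp_le)+
  then have "posdef_on ?f (U \<times> V)"
    using U(3) V(3)
    by (fastforce simp: posdef_on_def zero_prod_def intro: add_pos_nonneg add_nonneg_pos)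
  then have "dim (U \<times> V) \<le> n_plus ?f (S \<times> T)"
    using U(2) V(2) by (intro dim_le_n_plus subspace_Times U(1) V(1)) auto
  moreover obtain P where P: "subspace P" "P \<subseteq> S \<times> T" "posdef_on ?f P" "dim P = n_plus ?f (S \<times> T)"
    using n_plus_attained[OF subspace_Times[OF S T]] by blast
  have "dim P + dim (N \<times> M) \<le> dim (S \<times> T)"
    using N M by (intro dim_posdef_plus_dim_nonpos[OF P(1) _ _ P(2) _ P(3)] subspace_Times S T)
      (auto simp: add_nonpos_nonpos)
  ultimately show ?thesis
    using P(4) U(4) N(4) V(4) M(4) dim_Times[OF U(1) V(1)] dim_Times[OF N(1) M(1)] dim_Times[OF S T]
    by linarith
qed

lemma n_plus_add_le:
  fixes q r :: "'a::euclidean_space \<Rightarrow> real"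
  assumes q: "quadform q" and r: "quadform r" and S: "subspace S"
  shows "n_plus (\<lambda>x. q x + r x) S \<le> n_plus q S + n_plus r S"
proof -
  have "n_plus (\<lambda>x. q x + r x) S \<le> n_plus (\<lambda>(x, y). q x + r y) (S \<times> S)"
    by (rule n_plus_le_linear_image[OF S, where f = "\<lambda>x. (x, x)"])
       (auto simp: zero_prod_def quadform_zero[OF q] quadform_zero[OF r] intro!: linearI)
  then show ?thesis using n_plus_Times[OF q r S S] by simp
qed

section \<open>Inertia along converging families of quadratic forms\<close>

lemma posdef_on_coercive:
  fixes q :: "'a::euclidean_space \<Rightarrow> real"
  assumes q: "quadform q" and U: "subspace U" and pos: "posdef_on q U"
  obtains c where "c > 0" "\<And>u. u \<in> U \<Longrightarrow> c * (norm u)\<^sup>2 \<le> q u"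
proof (cases "U \<inter> sphere 0 1 = {}")
  case True
  have "u = 0" if "u \<in> U" for u
  proof (rule ccontr)
    assume "u \<noteq> 0"
    then have "(1 / norm u) *\<^sub>R u \<in> U \<inter> sphere 0 1" using U that by (auto intro: subspace_scale)
    then show False using True by blast
  qed
  then show ?thesis using that[of 1] quadform_zero[OF q] by force
next
  case False
  let ?K = "U \<inter> sphere 0 1"
  have "compact ?K" by (intro closed_Int_compact closed_subspace U compact_sphere)
  moreover have "bounded_bilinear (polar q)"
    using bilinear_polar[OF q] by (simp add: bilinear_conv_bounded_bilinear)
  then have "continuous_on ?K (\<lambda>x. polar q x x)"
    by (rule bounded_bilinear.continuous_on[OF _ continuous_on_id continuous_on_id])
  then have "continuous_on ?K q" by (simp add: polar_self[OF q])
  ultimately obtain x where x: "x \<in> ?K" "\<forall>y\<in>?K. q x \<le> q y"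
    using continuous_attains_inf[of ?K q] False by blast
  show ?thesis
  proof (rule that[of "q x"])
    show "q x > 0" using x pos by (auto simp: posdef_on_def)
    fix u assume u: "u \<in> U"
    show "q x * (norm u)\<^sup>2 \<le> q u"
    proof (cases "u = 0")
      case False
      have "(1 / norm u) *\<^sub>R u \<in> ?K" using U u False by (auto intro: subspace_scale)
      then have "q x \<le> (1 / norm u)\<^sup>2 * q u" using x quadform_scale[OF q] by metis
      then show ?thesis using False by (simp add: field_simps power2_eq_square)
    qed (simp add: quadform_zero[OF q])
  qed
qed

lemma quadform_le_sum_polar:
  fixes q :: "'a::euclidean_space \<Rightarrow> real"
  assumes q: "quadform q"
  shows "\<bar>q x\<bar> \<le> (\<Sum>i\<in>Basis. \<Sum>j\<in>Basis. \<bar>polar q i j\<bar>) * (norm x)\<^sup>2"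
proof -
  have "q x = polar q (\<Sum>i\<in>Basis. (x \<bullet> i) *\<^sub>R i) (\<Sum>j\<in>Basis. (x \<bullet> j) *\<^sub>R j)"
    by (simp add: euclidean_representation polar_self[OF q])
  also have "\<dots> = (\<Sum>i\<in>Basis. \<Sum>j\<in>Basis. (x \<bullet> i) * (x \<bullet> j) * polar q i j)"
    by (simp add: bilinear_sum[OF bilinear_polar[OF q]] sum.cartesian_product
      bilinear_lmul[OF bilinear_polar[OF q]]
        bilinear_rmul[OF bilinear_polar[OF q]] mult_ac)
  also have "\<bar>\<dots>\<bar> \<le> (\<Sum>i\<in>Basis. \<Sum>j\<in>Basis. (norm x)\<^sup>2 * \<bar>polar q i j\<bar>)"
  proof (intro order_trans[OF sum_abs] sum_mono)
    fix i j :: 'a assume "i \<in> Basis" "j \<in> Basis"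
    then have "\<bar>x \<bullet> i\<bar> * \<bar>x \<bullet> j\<bar> \<le> norm x * norm x" by (intro mult_mono Basis_le_norm) auto
    then show "\<bar>(x \<bullet> i) * (x \<bullet> j) * polar q i j\<bar> \<le> (norm x)\<^sup>2 * \<bar>polar q i j\<bar>"
      by (simp add: abs_mult power2_eq_square mult_right_mono)
  qed
  finally show ?thesis by (simp add: sum_distrib_left mult.commute)
qed

lemma quadform_tendsto_uniform:
  fixes q :: "'a::euclidean_space \<Rightarrow> real"
  assumes q: "quadform q" and r: "\<forall>\<^sub>F t in F. quadform (r t)"
    and lim: "\<And>x. ((\<lambda>t. r t x) \<longlongrightarrow> q x) F" and e: "e > 0"
  shows "\<forall>\<^sub>F t in F. \<forall>x. \<bar>r t x - q x\<bar> \<le> e * (norm x)\<^sup>2"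
proof -
  let ?C = "\<lambda>t. \<Sum>i\<in>Basis. \<Sum>j\<in>Basis. \<bar>polar (\<lambda>x. r t x - q x) i j\<bar>"
  have "((\<lambda>t. polar (\<lambda>x. r t x - q x) i j) \<longlongrightarrow> 0) F" for i j
    unfolding polar_def by (rule tendsto_eq_intros lim refl | simp)+
  then have "(?C \<longlongrightarrow> 0) F" by (intro tendsto_null_sum tendsto_rabs_zero)
  then have "\<forall>\<^sub>F t in F. ?C t < e" using e by (rule order_tendstoD)
  with r show ?thesis
  proof eventually_elim
    case (elim t)
    show ?case
    proof
      fix x
      have "\<bar>r t x - q x\<bar> \<le> ?C t * (norm x)\<^sup>2"
        by (rule quadform_le_sum_polar[OF quadform_diff[OF elim(1) q]])
      also have "\<dots> \<le> e * (norm x)\<^sup>2" using elim(2) by (intro mult_right_mono) auto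
      finally show "\<bar>r t x - q x\<bar> \<le> e * (norm x)\<^sup>2" .
    qed
  qed
qed

lemma n_plus_lower_semicontinuous:
  fixes q :: "'a::euclidean_space \<Rightarrow> real"
  assumes q: "quadform q" and r: "\<forall>\<^sub>F t in F. quadform (r t)" and S: "subspace S"
    and lim: "\<And>x. x \<in> S \<Longrightarrow> ((\<lambda>t. r t x) \<longlongrightarrow> q x) F"
  shows "\<forall>\<^sub>F t in F. n_plus q S \<le> n_plus (r t) S"
proof -
  obtain U where U: "subspace U" "U \<subseteq> S" "posdef_on q U" "dim U = n_plus q S"
    using n_plus_attained[OF S] by blast
  obtain c where c: "c > 0" "\<And>u. u \<in> U \<Longrightarrow> c * (norm u)\<^sup>2 \<le> q u"
    using posdef_on_coercive[OF q U(1,3)] by blast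
  obtain g where g: "range g \<subseteq> U" "linear g" "\<And>u. u \<in> U \<Longrightarrow> g u = u"
    using linear_exists_left_inverse_on[OF linear_id U(1)] by auto
  have "\<forall>\<^sub>F t in F. \<forall>x. \<bar>r t (g x) - q (g x)\<bar> \<le> c / 2 * (norm x)\<^sup>2"
  proof (rule quadform_tendsto_uniform[OF quadform_comp_linear[OF q g(2)]])
    show "\<forall>\<^sub>F t in F. quadform (\<lambda>x. r t (g x))"
      using r by eventually_elim (rule quadform_comp_linear[OF _ g(2)])
    show "((\<lambda>t. r t (g x)) \<longlongrightarrow> q (g x)) F" for x using g(1) U(2) by (intro lim) blast
  qed (use c in simp)
  then show ?thesis
  proof eventually_elim
    case (elim t)
    have "r t u > 0" if u: "u \<in> U" "u \<noteq> 0" for u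
    proof -
      have "\<bar>r t u - q u\<bar> \<le> c / 2 * (norm u)\<^sup>2" using elim[rule_format, of u] g(3)[OF u(1)] by simp
      moreover have "c * (norm u)\<^sup>2 > 0" using c(1) u(2) by simp
      ultimately show ?thesis using c(2)[OF u(1)] by linarith
    qed
    then show ?case unfolding U(4)[symmetric] by (intro dim_le_n_plus U) (simp add: posdef_on_def)
  qed
qed

lemma n_plus_locally_constant:
  fixes q :: "'a::euclidean_space \<Rightarrow> real"
  assumes q: "quadform q" and r: "\<forall>\<^sub>F t in F. quadform (r t)" and S: "subspace S"
    and lim: "\<And>x. x \<in> S \<Longrightarrow> ((\<lambda>t. r t x) \<longlongrightarrow> q x) F"
    and rad: "\<forall>\<^sub>F t in F. dim (form_radical q S) \<le> dim (form_radical (r t) S)"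
  shows "\<forall>\<^sub>F t in F. n_plus (r t) S = n_plus q S"
proof -
  have "\<forall>\<^sub>F t in F. n_minus q S \<le> n_minus (r t) S" unfolding n_minus_eq_n_plus
    using r lim by (intro n_plus_lower_semicontinuous quadform_uminus q S tendsto_minus)
      (auto elim: eventually_mono intro: quadform_uminus)
  moreover have "\<forall>\<^sub>F t in F. n_plus q S \<le> n_plus (r t) S"
    by (rule n_plus_lower_semicontinuous[OF q r S lim])
  ultimately show ?thesis
    using rad r
  proof eventually_elim
    case (elim t)
    then show ?case using inertia_sum[OF q S] inertia_sum[OF elim(4) S] by linarith
  qed
qed

lemma rescaled_form_tendsto:
  assumes r: "\<forall>\<^sub>F t in F. quadform (r t)" and \<tau>: "filterlim \<tau> (at_right 0) F"
    and lim: "\<And>x. x \<in> {u, p, u + p} \<Longrightarrow> ((\<lambda>t. (r t x - q x) / \<tau> t) \<longlongrightarrow> d x) F"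
    and p: "polar q u p = 0" "q p = 0"
  shows "((\<lambda>t. r t (sqrt (\<tau> t) *\<^sub>R u + p) / \<tau> t) \<longlongrightarrow> q u + d p) F"
proof (rule Lim_transform_eventually)
  let ?d = "\<lambda>x t. (r t x - q x) / \<tau> t"
  let ?s = "\<lambda>t. q u + \<tau> t * ?d u t + sqrt (\<tau> t) * (?d (u + p) t - ?d u t - ?d p t) + ?d p t"
  have \<tau>0: "(\<tau> \<longlongrightarrow> 0) F" and \<tau>pos: "\<forall>\<^sub>F t in F. \<tau> t > 0"
    using \<tau> by (auto simp: filterlim_at elim: eventually_mono)
  have "(?s \<longlongrightarrow> q u + 0 * d u + sqrt 0 * (d (u + p) - d u - d p) + d p) F"
    by (intro tendsto_intros lim \<tau>0) auto
  then show "(?s \<longlongrightarrow> q u + d p) F" by simp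
  show "\<forall>\<^sub>F t in F. ?s t = r t (sqrt (\<tau> t) *\<^sub>R u + p) / \<tau> t"
    using r \<tau>pos
  proof eventually_elim
    case (elim t)
    have "q (u + p) = q u" by (simp add: form_add_polar p)
    then have "r t (u + p) - q (u + p) - (r t u - q u) - (r t p - q p) = 2 * polar (r t) u p"
      by (simp add: form_add_polar p)
    then have "?d (u + p) t - ?d u t - ?d p t = 2 * polar (r t) u p / \<tau> t"
      by (simp add: diff_divide_distrib[symmetric])
    then have "?s t = q u + \<tau> t * ?d u t + sqrt (\<tau> t) * (2 * polar (r t) u p / \<tau> t) + ?d p t"
      by (simp only:)
    also have "\<dots> = (\<tau> t * r t u + 2 * (sqrt (\<tau> t) * polar (r t) u p) + r t p) / \<tau> t"
      using elim(2) by (simp add: p field_simps)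
    also have "\<tau> t * r t u + 2 * (sqrt (\<tau> t) * polar (r t) u p) + r t p =
        r t (sqrt (\<tau> t) *\<^sub>R u + p)"
      using elim by (simp add: form_add_polar quadform_scale bilinear_lmul[OF bilinear_polar])
    finally show ?case .
  qed
qed

text \<open>On \<open>S \<times> K\<close> the rescaled forms \<open>(u, p) \<mapsto> r\<^sub>t (\<surd>\<tau> u + p) / \<tau>\<close> converge to \<open>q u + d p\<close>, so the
  estimate is again lower semicontinuity.\<close>

lemma n_plus_perturbation_ge:
  fixes q :: "'a::euclidean_space \<Rightarrow> real"
  assumes q: "quadform q" and d: "quadform d" and r: "\<forall>\<^sub>F t in F. quadform (r t)"
    and S: "subspace S" and K: "subspace K" "K \<subseteq> form_radical q S"
    and \<tau>: "filterlim \<tau> (at_right 0) F"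
    and lim: "\<And>x. x \<in> S \<Longrightarrow> ((\<lambda>t. (r t x - q x) / \<tau> t) \<longlongrightarrow> d x) F"
  shows "\<forall>\<^sub>F t in F. n_plus q S + n_plus d K \<le> n_plus (r t) S"
proof -
  let ?f = "\<lambda>t (u, p). sqrt (\<tau> t) *\<^sub>R u + p :: 'a"
  let ?r = "\<lambda>t x. 1 / \<tau> t * r t (?f t x)" and ?q = "\<lambda>(u, p). q u + d p"
  have lin: "linear (?f t)" for t by (auto intro!: linearI simp: algebra_simps)
  have "quadform (\<lambda>x. q (fst x) + d (snd x))"
    by (intro quadform_add quadform_comp_linear[OF q linear_fst]
      quadform_comp_linear[OF d linear_snd])
  then have "quadform ?q" by (simp add: case_prod_unfold)
  moreover have "\<forall>\<^sub>F t in F. quadform (?r t)"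
    using r by eventually_elim (intro quadform_cmult quadform_comp_linear[OF _ lin])
  moreover have "((\<lambda>t. ?r t x) \<longlongrightarrow> ?q x) F" if xSK: "x \<in> S \<times> K" for x
  proof -
    obtain u p where x: "x = (u, p)" "u \<in> S" "p \<in> form_radical q S" using xSK K(2) by blast
    then have "polar q u p = 0" "q p = 0" "{u, p, u + p} \<subseteq> S"
      using form_zero_on_radical[OF q] subspace_add[OF S]
      by (auto simp: form_radical_def polar_commute[of q u])
    then have "((\<lambda>t. r t (sqrt (\<tau> t) *\<^sub>R u + p) / \<tau> t) \<longlongrightarrow> q u + d p) F"
      by (intro rescaled_form_tendsto r \<tau> lim) auto
    then show ?thesis by (simp add: x(1))
  qed
  ultimately have "\<forall>\<^sub>F t in F. n_plus ?q (S \<times> K) \<le> n_plus (?r t) (S \<times> K)"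
    by (intro n_plus_lower_semicontinuous subspace_Times S K(1))
  moreover have "\<forall>\<^sub>F t in F. \<tau> t > 0" using \<tau> by (auto simp: filterlim_at elim: eventually_mono)
  ultimately show ?thesis using r
  proof eventually_elim
    case (elim t)
    have "?f t ` (S \<times> K) \<subseteq> S"
      using K(2) S by (auto simp: form_radical_def intro: subspace_add subspace_scale)
    then have "n_plus (?r t) (S \<times> K) \<le> n_plus (r t) S"
      by (rule n_plus_le_linear_image[OF subspace_Times[OF S K(1)] lin])
        (use elim in \<open>auto simp: quadform_zero zero_less_divide_iff\<close>)
    then show ?case using elim(1) n_plus_Times[OF q d S K(1)] by simp
  qed
qed

lemma n_plus_regular_perturbation:
  fixes q :: "'a::euclidean_space \<Rightarrow> real"
  assumes q: "quadform q" and d: "quadform d" and r: "\<forall>\<^sub>F t in F. quadform (r t)"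
    and S: "subspace S" and K: "subspace K" "K \<subseteq> form_radical q S" "qf_nondegenerate d K"
    and \<tau>: "filterlim \<tau> (at_right 0) F"
    and lim: "\<And>x. x \<in> S \<Longrightarrow> ((\<lambda>t. (r t x - q x) / \<tau> t) \<longlongrightarrow> d x) F"
    and k: "dim (form_radical q S) = dim K + k" "\<forall>\<^sub>F t in F. k \<le> dim (form_radical (r t) S)"
  shows "\<forall>\<^sub>F t in F. n_plus (r t) S = n_plus q S + n_plus d K \<and> dim (form_radical (r t) S) = k"
proof -
  have "form_radical d K \<subseteq> {0}" using K(3) by (auto simp: form_radical_def qf_nondegenerate_def)
  then have dK: "n_plus d K + n_minus d K = dim K"
    using inertia_sum[OF d K(1)] by (simp flip: dim_eq_0)
  have "K \<subseteq> form_radical (\<lambda>x. - q x) S" using K(2) by (auto simp: form_radical_def polar_uminus)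
  moreover have "((\<lambda>t. (- r t x - - q x) / \<tau> t) \<longlongrightarrow> - d x) F" if "x \<in> S" for x
    using tendsto_minus[OF lim[OF that]] by (simp add: minus_divide_left)
  ultimately have "\<forall>\<^sub>F t in F. n_minus q S + n_minus d K \<le> n_minus (r t) S"
    unfolding n_minus_eq_n_plus using r
    by (intro n_plus_perturbation_ge[OF quadform_uminus[OF q] quadform_uminus[OF d] _ S K(1) _ \<tau>])
      (auto elim: eventually_mono intro: quadform_uminus)
  moreover have "\<forall>\<^sub>F t in F. n_plus q S + n_plus d K \<le> n_plus (r t) S"
    by (rule n_plus_perturbation_ge[OF q d r S K(1,2) \<tau> lim])
  ultimately show ?thesis
    using k(2) r
  proof eventually_elim
    case (elim t)
    then show ?case using inertia_sum[OF q S] inertia_sum[OF elim(4) S] k(1) dK by linarith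
  qed
qed

section \<open>Inverses of bounded linear maps\<close>

lemma linear_blinfun_apply: "linear (blinfun_apply A)"
  by (rule bounded_linear.linear[OF blinfun.bounded_linear_right])

lemma blinfun_apply_Blinfun_linear:
  fixes f :: "'a::euclidean_space \<Rightarrow> 'b::real_normed_vector"
  shows "linear f \<Longrightarrow> blinfun_apply (Blinfun f) = f"
  by (intro bounded_linear_Blinfun_apply) (simp add: linear_conv_bounded_linear)

lemma blinfun_compose_id [simp]: "A o\<^sub>L id_blinfun = A" "id_blinfun o\<^sub>L A = A"
  by (auto intro: blinfun_eqI)

lemma blinfun_compose_assoc: "(A o\<^sub>L B) o\<^sub>L C = A o\<^sub>L (B o\<^sub>L C)"
  by (rule blinfun_eqI) simp

lemma bij_blinfun_iff:
  fixes A :: "'a::euclidean_space \<Rightarrow>\<^sub>L 'a"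
  shows "bij (blinfun_apply A) \<longleftrightarrow> (\<forall>x. A x = 0 \<longrightarrow> x = 0)"
  using linear_injective_0[OF linear_blinfun_apply[of A]]
    linear_injective_imp_surjective[OF linear_blinfun_apply[of A]] by (auto simp: bij_def)

definition blinfun_inv :: "('a::euclidean_space \<Rightarrow>\<^sub>L 'a) \<Rightarrow> ('a \<Rightarrow>\<^sub>L 'a)" where
  "blinfun_inv A = Blinfun (inv (blinfun_apply A))"

lemma blinfun_inv_left:
  fixes A :: "'a::euclidean_space \<Rightarrow>\<^sub>L 'a"
  assumes "bij (blinfun_apply A)"
  shows "blinfun_inv A (A x) = x"
proof -
  obtain g where g: "linear g" "g \<circ> A = id"
    using linear_injective_left_inverse[OF linear_blinfun_apply] assms bij_is_inj by blast
  have "inv (blinfun_apply A) = g"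
    using assms g(2) by (metis bij_is_surj comp_assoc comp_id id_comp surj_iff)
  then show ?thesis
    using g by (simp add: blinfun_inv_def blinfun_apply_Blinfun_linear pointfree_idE)
qed

lemma blinfun_inv_right:
  fixes A :: "'a::euclidean_space \<Rightarrow>\<^sub>L 'a"
  assumes "bij (blinfun_apply A)"
  shows "A (blinfun_inv A x) = x"
  using assms blinfun_inv_left[OF assms] by (metis bij_pointE)

lemma blinfun_inv_id: "blinfun_inv (id_blinfun :: 'a::euclidean_space \<Rightarrow>\<^sub>L 'a) = id_blinfun"
  using blinfun_inv_left[of "id_blinfun :: 'a \<Rightarrow>\<^sub>L 'a"]
  by (intro blinfun_eqI) (simp add: bij_betw_def)

lemma blinfun_inv_diff:
  fixes A B :: "'a::euclidean_space \<Rightarrow>\<^sub>L 'a"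
  assumes "bij (blinfun_apply A)" "bij (blinfun_apply B)"
  shows "blinfun_inv A - blinfun_inv B = - (blinfun_inv A o\<^sub>L (A - B) o\<^sub>L blinfun_inv B)"
  by (intro blinfun_eqI)
    (simp add: blinfun.diff_left blinfun.diff_right blinfun.minus_left blinfun_inv_left[OF assms(1)]
      blinfun_inv_right[OF assms(2)])

lemma eventually_bounded_below_blinfun:
  fixes A :: "'b \<Rightarrow> 'a::euclidean_space \<Rightarrow>\<^sub>L 'a"
  assumes A: "(A \<longlongrightarrow> A0) F" and bij: "bij (blinfun_apply A0)"
  obtains c where "c > 0" "\<And>x. c * norm x \<le> norm (A0 x)"
    "\<forall>\<^sub>F t in F. \<forall>x. c * norm x \<le> norm (A t x)"
proof -
  obtain b where b: "b > 0" "\<And>x. b * norm x \<le> norm (A0 x)"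
    using linear_inj_bounded_below_pos[OF linear_blinfun_apply bij_is_inj[OF bij]] by blast
  have "\<forall>\<^sub>F t in F. dist (A t) A0 < b / 2" using A b(1) by (intro tendstoD) auto
  then have "\<forall>\<^sub>F t in F. \<forall>x. b / 2 * norm x \<le> norm (A t x)"
  proof eventually_elim
    case (elim t)
    show ?case
    proof
      fix x
      have "norm (A0 x - A t x) \<le> b / 2 * norm x"
        using norm_blinfun[of "A0 - A t" x] elim
          mult_right_mono[of "norm (A0 - A t)" "b / 2" "norm x"]
        by (simp add: blinfun.diff_left dist_norm norm_minus_commute)
      then show "b / 2 * norm x \<le> norm (A t x)"
        using b(2)[of x] norm_triangle_ineq2[of "A0 x" "A t x"] by (simp add: field_simps)
    qed
  qed
  moreover have "b / 2 * norm x \<le> norm (A0 x)" for x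
    using b(1) by (intro order_trans[OF mult_right_mono b(2)]) auto
  ultimately show ?thesis using b(1) by (intro that[of "b / 2"]) auto
qed

lemma eventually_bij_blinfun:
  fixes A :: "'b \<Rightarrow> 'a::euclidean_space \<Rightarrow>\<^sub>L 'a"
  assumes A: "(A \<longlongrightarrow> A0) F" and bij: "bij (blinfun_apply A0)"
  shows "\<forall>\<^sub>F t in F. bij (blinfun_apply (A t))"
proof -
  obtain c where c: "c > 0" and lower: "\<forall>\<^sub>F t in F. \<forall>x. c * norm x \<le> norm (A t x)"
    by (rule eventually_bounded_below_blinfun[OF A bij])
  from lower show ?thesis
  proof eventually_elim
    case (elim t)
    have "x = 0" if "A t x = 0" for x
      using elim[rule_format, of x] that c by (simp add: mult_le_0_iff)
    then show ?case by (simp add: bij_blinfun_iff)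
  qed
qed

lemma tendsto_blinfun_inv:
  fixes A :: "'b \<Rightarrow> 'a::euclidean_space \<Rightarrow>\<^sub>L 'a"
  assumes A: "(A \<longlongrightarrow> A0) F" and bij: "bij (blinfun_apply A0)"
  shows "((\<lambda>t. blinfun_inv (A t)) \<longlongrightarrow> blinfun_inv A0) F"
proof -
  obtain c where c: "c > 0" and lower: "\<forall>\<^sub>F t in F. \<forall>x. c * norm x \<le> norm (A t x)"
    by (rule eventually_bounded_below_blinfun[OF A bij])
  let ?bound = "\<lambda>t. 1 / c * norm (A t - A0) * norm (blinfun_inv A0)"
  have "\<forall>\<^sub>F t in F. norm (blinfun_inv (A t) - blinfun_inv A0) \<le> ?bound t"
    using lower eventually_bij_blinfun[OF A bij]
  proof eventually_elim
    case (elim t)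
    have "norm (blinfun_inv (A t)) \<le> 1 / c"
    proof (rule norm_blinfun_bound)
      fix y
      show "norm (blinfun_inv (A t) y) \<le> 1 / c * norm y"
        using elim(1)[rule_format, of "blinfun_inv (A t) y"] c
        by (simp add: blinfun_inv_right[OF elim(2)] field_simps)
    qed (use c in simp)
    have "norm (blinfun_inv (A t) - blinfun_inv A0)
        \<le> norm (blinfun_inv (A t)) * norm (A t - A0) * norm (blinfun_inv A0)"
      unfolding blinfun_inv_diff[OF elim(2) bij] norm_minus_cancel
      by (intro order_trans[OF norm_blinfun_compose] mult_right_mono norm_blinfun_compose
        norm_ge_zero)
    also have "\<dots> \<le> ?bound t"
      using \<open>norm (blinfun_inv (A t)) \<le> 1 / c\<close> by (intro mult_right_mono) auto
    finally show ?case .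
  qed
  moreover have "(?bound \<longlongrightarrow> 1 / c * norm (A0 - A0) * norm (blinfun_inv A0)) F"
    by (intro tendsto_intros A)
  then have "(?bound \<longlongrightarrow> 0) F" by simp
  ultimately have "((\<lambda>t. blinfun_inv (A t) - blinfun_inv A0) \<longlongrightarrow> 0) F"
    by (rule Lim_null_comparison)
  then show ?thesis by (simp add: LIM_zero_iff)
qed

lemma has_vector_derivative_iff_tendsto:
  "(f has_vector_derivative D) (at x within S) \<longleftrightarrow>
     ((\<lambda>y. (f y - f x) /\<^sub>R (y - x)) \<longlongrightarrow> D) (at x within S)"
proof -
  have "norm (f y - f x - (y - x) *\<^sub>R D) / norm (y - x) = norm ((f y - f x) /\<^sub>R (y - x) - D)"
    if "y \<noteq> x" for y
  proof -
    have "(f y - f x) /\<^sub>R (y - x) - D = (f y - f x - (y - x) *\<^sub>R D) /\<^sub>R (y - x)"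
      using that by (simp add: scaleR_diff_right)
    then show ?thesis by (simp add: divide_inverse_commute)
  qed
  then have "((\<lambda>y. norm (f y - f x - (y - x) *\<^sub>R D) / norm (y - x)) \<longlongrightarrow> 0) (at x within S) \<longleftrightarrow>
      ((\<lambda>y. norm ((f y - f x) /\<^sub>R (y - x) - D)) \<longlongrightarrow> 0) (at x within S)"
    by (intro tendsto_cong) (auto simp: eventually_at_filter)
  then show ?thesis
    unfolding has_vector_derivative_def has_derivative_iff_norm
    by (simp add: bounded_linear_scaleR_left tendsto_norm_zero_iff LIM_zero_iff)
qed

lemma has_vector_derivative_blinfun_compose:
  assumes "(A has_vector_derivative A') (at t within S)"
    "(B has_vector_derivative B') (at t within S)"
  shows "((\<lambda>t. A t o\<^sub>L B t) has_vector_derivative (A t o\<^sub>L B') + (A' o\<^sub>L B t)) (at t within S)"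
  by (rule bounded_bilinear.has_vector_derivative[OF bounded_bilinear_blinfun_compose assms])

lemma has_vector_derivative_blinfun_compose_left:
  assumes "(A has_vector_derivative A') (at t within S)"
  shows "((\<lambda>t. A t o\<^sub>L B) has_vector_derivative (A' o\<^sub>L B)) (at t within S)"
  using has_vector_derivative_blinfun_compose[OF assms has_vector_derivative_const] by simp

lemma has_vector_derivative_blinfun_compose_right:
  assumes "(B has_vector_derivative B') (at t within S)"
  shows "((\<lambda>t. A o\<^sub>L B t) has_vector_derivative (A o\<^sub>L B')) (at t within S)"
  using has_vector_derivative_blinfun_compose[OF has_vector_derivative_const assms] by simp

lemma C1_onI:
  "(\<And>t. t \<in> S \<Longrightarrow> (f has_vector_derivative f' t) (at t within S)) \<Longrightarrow> continuous_on S f' \<Longrightarrow> C1_on S f"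
  unfolding C1_on_def by blast

lemma C1_on_imp_continuous_on: "C1_on S f \<Longrightarrow> continuous_on S f"
  unfolding C1_on_def by (blast intro: continuous_on_vector_derivative)

lemma has_vector_derivative_blinfun_inv:
  fixes A :: "real \<Rightarrow> 'a::euclidean_space \<Rightarrow>\<^sub>L 'a"
  assumes A: "(A has_vector_derivative A') (at x within S)" and bij: "bij (blinfun_apply (A x))"
  shows "((\<lambda>t. blinfun_inv (A t)) has_vector_derivative
    - (blinfun_inv (A x) o\<^sub>L A' o\<^sub>L blinfun_inv (A x))) (at x within S)"
  unfolding has_vector_derivative_iff_tendsto
proof (rule Lim_transform_eventually)
  have cont: "(A \<longlongrightarrow> A x) (at x within S)"
    using has_vector_derivative_continuous[OF A] by (simp add: continuous_within)
  let ?Q = "\<lambda>t. (A t - A x) /\<^sub>R (t - x)"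
  show "((\<lambda>t. - (blinfun_inv (A t) o\<^sub>L ?Q t o\<^sub>L blinfun_inv (A x)))
      \<longlongrightarrow> - (blinfun_inv (A x) o\<^sub>L A' o\<^sub>L blinfun_inv (A x))) (at x within S)"
    using A unfolding has_vector_derivative_iff_tendsto
    by (intro tendsto_intros tendsto_blinfun_inv cont bij)
  show "\<forall>\<^sub>F t in at x within S. - (blinfun_inv (A t) o\<^sub>L ?Q t o\<^sub>L blinfun_inv (A x))
      = (blinfun_inv (A t) - blinfun_inv (A x)) /\<^sub>R (t - x)"
    using eventually_bij_blinfun[OF cont bij]
    by eventually_elim
      (simp add: blinfun_inv_diff[OF _ bij]
        bounded_bilinear.scaleR_left[OF bounded_bilinear_blinfun_compose]
        bounded_bilinear.scaleR_right[OF bounded_bilinear_blinfun_compose])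
qed

section \<open>Projections along a complement\<close>

definition complementary :: "'a::real_vector set \<Rightarrow> 'a set \<Rightarrow> bool" where
  "complementary W l \<longleftrightarrow> subspace W \<and> subspace l \<and> W \<inter> l = {0} \<and> (\<forall>v. \<exists>w\<in>W. v - w \<in> l)"

definition projection :: "'a::euclidean_space set \<Rightarrow> 'a set \<Rightarrow> 'a \<Rightarrow>\<^sub>L 'a" where
  "projection W l = Blinfun (\<lambda>v. THE w. w \<in> W \<and> v - w \<in> l)"

lemma complementary_unique:
  assumes "complementary W l" "w \<in> W" "v - w \<in> l" "w' \<in> W" "v - w' \<in> l"
  shows "w = w'"
proof -
  have sub: "subspace W" "subspace l" using assms(1) by (auto simp: complementary_def)
  have "w - w' = (v - w') - (v - w)" by simp
  then have "w - w' \<in> W \<inter> l" using assms sub by (metis IntI subspace_diff)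
  then have "w - w' \<in> {0}" using assms(1) by (metis complementary_def)
  then show ?thesis by simp
qed

lemma blinfun_apply_projection:
  fixes W l :: "'a::euclidean_space set"
  assumes c: "complementary W l"
  shows "blinfun_apply (projection W l) = (\<lambda>v. THE w. w \<in> W \<and> v - w \<in> l)"
    and "projection W l v \<in> W" "v - projection W l v \<in> l"
proof -
  let ?P = "\<lambda>v. THE w. w \<in> W \<and> v - w \<in> l"
  have sub: "subspace W" "subspace l" using c by (auto simp: complementary_def)
  have P: "?P v \<in> W \<and> v - ?P v \<in> l" for v
  proof (rule theI')
    have "\<exists>w\<in>W. v - w \<in> l" using c by (simp add: complementary_def)
    then show "\<exists>!w. w \<in> W \<and> v - w \<in> l" using complementary_unique[OF c] by blast
  qed
  have "linear ?P"
  proof (rule linearI)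
    show "?P (x + y) = ?P x + ?P y" for x y
      using P[of x] P[of y] P[of "x + y"] sub subspace_add[OF sub(2), of "x - ?P x" "y - ?P y"]
      by (intro complementary_unique[OF c, of _ "x + y"])
        (auto intro: subspace_add simp: algebra_simps)
    show "?P (a *\<^sub>R x) = a *\<^sub>R ?P x" for a x
      using P[of x] P[of "a *\<^sub>R x"] sub subspace_scale[OF sub(2), of "x - ?P x" a]
      by (intro complementary_unique[OF c, of _ "a *\<^sub>R x"])
        (auto intro: subspace_scale simp: algebra_simps)
  qed
  then show P_apply: "blinfun_apply (projection W l) = ?P"
    unfolding projection_def by (rule blinfun_apply_Blinfun_linear)
  show "projection W l v \<in> W" "v - projection W l v \<in> l" unfolding P_apply using P by auto
qed

lemmas projection_in = blinfun_apply_projection(2,3)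

lemma projection_eqI:
  "complementary W l \<Longrightarrow> w \<in> W \<Longrightarrow> v - w \<in> l \<Longrightarrow> projection W l v = w"
  by (rule complementary_unique[OF _ projection_in])

lemma projection_left: "complementary W l \<Longrightarrow> w \<in> W \<Longrightarrow> projection W l w = w"
  by (rule projection_eqI) (auto simp: complementary_def subspace_0)

lemma projection_right: "complementary W l \<Longrightarrow> x \<in> l \<Longrightarrow> projection W l x = 0"
  by (rule projection_eqI) (auto simp: complementary_def subspace_0)

lemma range_projection:
  assumes "complementary W l"
  shows "range (blinfun_apply (projection W l)) = W"
  using projection_in(1)[OF assms] projection_left[OF assms]
  by (metis image_subset_iff rangeI subsetI subset_antisym)

lemma complementary_if_dim:
  fixes W l :: "'a::euclidean_space set"
  assumes "subspace W" "subspace l" "W \<inter> l = {0}" "DIM('a) \<le> dim W + dim l"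
  shows "complementary W l"
proof -
  let ?S = "{w + x |w x. w \<in> W \<and> x \<in> l}"
  have "dim ?S = dim W + dim l" by (rule dim_sums_trivial_Int) (use assms in auto)
  then have "?S = UNIV"
    using dim_subset_UNIV[of ?S] assms(4)
    by (intro subspace_dim_equal subspace_sums assms(1,2) subspace_UNIV) auto
  then have "\<exists>w\<in>W. v - w \<in> l" for v
  proof -
    obtain w x where "v = w + x" "w \<in> W" "x \<in> l" using \<open>?S = UNIV\<close> UNIV_I[of v] by blast
    then show ?thesis by (intro bexI[of _ w]) simp_all
  qed
  then show ?thesis using assms by (auto simp: complementary_def)
qed

lemma dim_complementary:
  fixes W l :: "'a::euclidean_space set"
  assumes "complementary W l"
  shows "dim W + dim l = DIM('a)"
proof -
  have "\<exists>w x. v = w + x \<and> w \<in> W \<and> x \<in> l" for v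
    using projection_in[OF assms, of v]
    by (intro exI[of _ "projection W l v"] exI[of _ "v - projection W l v"]) simp
  then have "{w + x |w x. w \<in> W \<and> x \<in> l} = UNIV" by blast
  then show ?thesis using dim_sums_trivial_Int[of W l] assms by (simp add: complementary_def)
qed

lemma complementary_orthogonal_comp:
  fixes l :: "'a::euclidean_space set"
  assumes "subspace l"
  shows "complementary l (orthogonal_comp l)"
proof -
  have "\<exists>w\<in>l. v - w \<in> orthogonal_comp l" for v
    using subspace_sum_orthogonal_comp[OF assms] set_plus_elim[of v l "orthogonal_comp l"]
    by (metis UNIV_I add_diff_cancel_left')
  then show ?thesis
    by (simp add: complementary_def assms subspace_orthogonal_comp orthogonal_Int_0)
qed

lemma projection_perturbation:
  fixes B :: "'b \<Rightarrow> 'a::euclidean_space \<Rightarrow>\<^sub>L 'a"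
  assumes c: "complementary W l"
    and H: "\<forall>\<^sub>F q in F. subspace (H q) \<and> dim (H q) = dim l \<and> range (B q) \<subseteq> H q"
    and B: "(B \<longlongrightarrow> id_blinfun - projection W l) F" and BW: "\<And>q w. w \<in> W \<Longrightarrow> B q w = 0"
  shows "\<forall>\<^sub>F q in F. complementary W (H q) \<and>
    projection W (H q) = projection W l o\<^sub>L blinfun_inv (B q + projection W l)"
proof -
  let ?P = "projection W l"
  let ?T = "\<lambda>q. B q + ?P"
  have sub: "subspace W" "subspace l" using c by (auto simp: complementary_def)
  have "(?T \<longlongrightarrow> id_blinfun) F" using tendsto_add[OF B tendsto_const[of ?P]] by simp
  then have "\<forall>\<^sub>F q in F. bij (blinfun_apply (?T q))"
    by (rule eventually_bij_blinfun) (simp add: bij_betw_def)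
  with H show ?thesis
  proof eventually_elim
    case (elim q)
    have TW: "?T q w = w" if "w \<in> W" for w
      using that by (simp add: blinfun.add_left BW projection_left[OF c])
    have "dim (?T q ` l) = dim l"
      using bij_is_inj[OF elim(2)]
      by (intro dim_image_eq[OF linear_blinfun_apply]) (auto intro: inj_on_subset)
    moreover have "?T q ` l \<subseteq> H q"
      using elim(1) projection_right[OF c] by (auto simp: blinfun.add_left)
    ultimately have Tl: "?T q ` l = H q"
      using elim(1)
      by (intro subspace_dim_equal linear_subspace_image[OF linear_blinfun_apply] sub) auto
    have "W \<inter> H q \<subseteq> {0}"
    proof
      fix x assume x: "x \<in> W \<inter> H q"
      then obtain y where y: "y \<in> l" "x = ?T q y" using Tl by blast
      then have "?T q x = ?T q y" using TW x by simp
      then have "x = y" using bij_is_inj[OF elim(2)] by (simp add: inj_eq)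
      then show "x \<in> {0}" using x y c by (auto simp: complementary_def)
    qed
    then have c': "complementary W (H q)"
      using elim(1) sub dim_complementary[OF c] subspace_0[of W] subspace_0[of "H q"]
      by (intro complementary_if_dim) auto
    have "projection W (H q) v = ?P (blinfun_inv (?T q) v)" for v
    proof (rule projection_eqI[OF c' projection_in(1)[OF c]])
      let ?u = "blinfun_inv (?T q) v"
      have "v - ?P ?u = ?T q (?u - ?P ?u)"
        by (simp only: blinfun.diff_right blinfun_inv_right[OF elim(2)]
          TW[OF projection_in(1)[OF c]])
      then show "v - ?P ?u \<in> H q" using Tl projection_in(2)[OF c] by auto
    qed
    then show ?case using c' by (auto intro: blinfun_eqI)
  qed
qed

lemma tendsto_projection:
  fixes B :: "'b \<Rightarrow> 'a::euclidean_space \<Rightarrow>\<^sub>L 'a"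
  assumes c: "complementary W l"
    and H: "\<forall>\<^sub>F q in F. subspace (H q) \<and> dim (H q) = dim l \<and> range (B q) \<subseteq> H q"
    and B: "(B \<longlongrightarrow> id_blinfun - projection W l) F" and BW: "\<And>q w. w \<in> W \<Longrightarrow> B q w = 0"
  shows "((\<lambda>q. projection W (H q)) \<longlongrightarrow> projection W l) F"
proof (rule Lim_transform_eventually)
  let ?P = "projection W l"
  have "((\<lambda>q. B q + ?P) \<longlongrightarrow> id_blinfun) F" using tendsto_add[OF B tendsto_const[of ?P]] by simp
  then have "((\<lambda>q. ?P o\<^sub>L blinfun_inv (B q + ?P)) \<longlongrightarrow> ?P o\<^sub>L blinfun_inv id_blinfun) F"
    by (intro tendsto_intros tendsto_blinfun_inv) (auto simp: bij_betw_def)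
  then show "((\<lambda>q. ?P o\<^sub>L blinfun_inv (B q + ?P)) \<longlongrightarrow> ?P) F"
    by (simp add: blinfun_inv_id)
  show "\<forall>\<^sub>F q in F. ?P o\<^sub>L blinfun_inv (B q + ?P) = projection W (H q)"
    using projection_perturbation[OF c H B, OF BW] by (auto elim: eventually_mono)
qed

lemma exists_right_inverse_off_projection:
  fixes Z :: "'a::euclidean_space \<Rightarrow>\<^sub>L 'a"
  assumes c: "complementary W (range Z)"
  obtains h where "Z o\<^sub>L h = id_blinfun - projection W (range Z)" "\<And>w. w \<in> W \<Longrightarrow> h w = 0"
proof -
  let ?P = "projection W (range Z)"
  obtain g where g: "linear g" "\<And>v. v \<in> range Z \<Longrightarrow> Z (g v) = v"
    using linear_exists_right_inverse_on[OF linear_blinfun_apply subspace_UNIV, of Z] by auto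
  define h where "h = Blinfun g o\<^sub>L (id_blinfun - ?P)"
  have h: "h x = g (x - ?P x)" for x
    by (simp add: h_def blinfun_apply_Blinfun_linear[OF g(1)] blinfun.diff_left)
  show ?thesis
  proof (rule that)
    show "Z o\<^sub>L h = id_blinfun - ?P"
      using g(2) projection_in(2)[OF c] by (intro blinfun_eqI) (simp add: h blinfun.diff_left)
    show "h w = 0" if "w \<in> W" for w
      using projection_left[OF c that] linear_0[OF g(1)] by (simp add: h)
  qed
qed

lemma has_vector_derivative_projection:
  fixes Z :: "real \<Rightarrow> 'a::euclidean_space \<Rightarrow>\<^sub>L 'a"
  assumes c: "complementary W (l t0)" and t0: "t0 \<in> S"
    and l: "\<And>t. t \<in> S \<Longrightarrow> l t = range (Z t)" "\<And>t. t \<in> S \<Longrightarrow> dim (l t) = dim (l t0)"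
    and Z: "(Z has_vector_derivative Z') (at t0 within S)"
  obtains h where "Z t0 o\<^sub>L h = id_blinfun - projection W (l t0)"
    "\<forall>\<^sub>F t in at t0 within S. complementary W (l t)"
    "((\<lambda>t. projection W (l t)) has_vector_derivative - (projection W (l t0) o\<^sub>L Z' o\<^sub>L h))
        (at t0 within S)"
proof -
  let ?P = "projection W (l t0)"
  obtain h where Zh: "Z t0 o\<^sub>L h = id_blinfun - ?P" and hW: "\<And>w. w \<in> W \<Longrightarrow> h w = 0"
    using exists_right_inverse_off_projection[of W "Z t0"] c by (metis l(1)[OF t0])
  let ?B = "\<lambda>t. Z t o\<^sub>L h"
  have B': "(?B has_vector_derivative (Z' o\<^sub>L h)) (at t0 within S)"
    by (rule has_vector_derivative_blinfun_compose_left[OF Z])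
  then have B: "(?B \<longlongrightarrow> id_blinfun - ?P) (at t0 within S)"
    using has_vector_derivative_continuous[OF B'] by (simp add: continuous_within Zh)
  have "\<forall>\<^sub>F t in at t0 within S. t \<in> S" by (simp add: eventually_at_filter)
  then have H: "\<forall>\<^sub>F t in at t0 within S. subspace (l t) \<and> dim (l t) = dim (l t0) \<and>
      range (?B t) \<subseteq> l t"
  proof eventually_elim
    case (elim t)
    then show ?case
      using l(2)[OF elim]
      by (auto simp: l(1)[OF elim] linear_subspace_image[OF linear_blinfun_apply])
  qed
  have BW: "?B t w = 0" if "w \<in> W" for t w
    by (simp add: hW[OF that] blinfun.zero_right)
  note near = projection_perturbation[OF c H B BW]
  let ?T = "\<lambda>t. ?B t + ?P"
  have T0: "?T t0 = id_blinfun" by (simp add: Zh)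
  have "(?T has_vector_derivative (Z' o\<^sub>L h)) (at t0 within S)"
    using has_vector_derivative_add[OF B' has_vector_derivative_const] by simp
  from has_vector_derivative_blinfun_inv[OF this]
  have "((\<lambda>t. blinfun_inv (?T t)) has_vector_derivative - (Z' o\<^sub>L h)) (at t0 within S)"
    unfolding T0 blinfun_inv_id by (simp add: bij_betw_def)
  from has_vector_derivative_blinfun_compose_right[OF this, of ?P]
  have "((\<lambda>t. ?P o\<^sub>L blinfun_inv (?T t)) has_vector_derivative - (?P o\<^sub>L Z' o\<^sub>L h))
      (at t0 within S)"
    by (simp add: blinfun_compose_assoc
      bounded_bilinear.minus_right[OF bounded_bilinear_blinfun_compose])
  then have "((\<lambda>t. projection W (l t)) has_vector_derivative - (?P o\<^sub>L Z' o\<^sub>L h)) (at t0 within S)"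
    unfolding has_vector_derivative_iff_tendsto
    by (rule Lim_transform_eventually)
      (use near in \<open>auto elim!: eventually_mono simp: T0 blinfun_inv_id\<close>)
  moreover have "\<forall>\<^sub>F t in at t0 within S. complementary W (l t)"
    using near by (auto elim: eventually_mono)
  ultimately show ?thesis using that[OF Zh] by blast
qed

lemma image_eq_range_blinfun:
  fixes A :: "'a::euclidean_space \<Rightarrow>\<^sub>L 'b::real_normed_vector"
  assumes "subspace M"
  shows "A ` M = range (A o\<^sub>L projection M (orthogonal_comp M))"
proof -
  have "M = range (projection M (orthogonal_comp M))"
    by (rule range_projection[OF complementary_orthogonal_comp[OF assms], symmetric])
  then have "A ` M = A ` range (projection M (orthogonal_comp M))" by (rule arg_cong)
  then show ?thesis by (simp add: image_image)
qed

section \<open>The gap topology\<close>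

lemma norm_orthogonal_projection:
  fixes l :: "'a::euclidean_space set"
  assumes l: "subspace l"
  shows "norm (x - projection l (orthogonal_comp l) x) \<le> infdist x l"
proof -
  let ?p = "projection l (orthogonal_comp l) x"
  note p = projection_in[OF complementary_orthogonal_comp[OF l], of x]
  have "norm (x - ?p) \<le> dist x y" if y: "y \<in> l" for y
  proof -
    have "?p - y \<in> l" using p(1) y subspace_diff[OF l] by blast
    with p(2) have "orthogonal (x - ?p) (?p - y)"
      by (simp only: orthogonal_comp_def mem_Collect_eq orthogonal_commute)
    from norm_add_Pythagorean[OF this] have "(norm (x - ?p))\<^sup>2 \<le> (norm (x - y))\<^sup>2" by simp
    then show ?thesis by (simp add: dist_norm power2_le_iff_abs_le)
  qed
  moreover have "l \<noteq> {}" using p by blast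
  ultimately show ?thesis by (auto simp: infdist_notempty intro: cINF_greatest)
qed

lemma norm_orthogonal_projection_le_gap:
  fixes L M :: "'a::euclidean_space set"
  assumes L: "subspace L" and M: "subspace M" and x: "x \<in> M"
  shows "norm (x - projection L (orthogonal_comp L) x) \<le> subspace_gap L M * norm x"
proof (cases "x = 0")
  case False
  let ?P = "projection L (orthogonal_comp L)"
  define y where "y = x /\<^sub>R norm x"
  have y: "y \<in> M" "norm y \<le> 1" "x = norm x *\<^sub>R y"
    using M x False by (auto simp: y_def intro: subspace_scale)
  have "infdist z L \<le> 1" if "norm z \<le> 1" for z
    using infdist_le[OF subspace_0[OF L], of z] that by simp
  then have "bdd_above ((\<lambda>z. infdist z L) ` {z\<in>M. norm z \<le> 1})"
    by (auto intro!: bdd_aboveI2[where M = 1])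
  then have "infdist y L \<le> (SUP z\<in>{z\<in>M. norm z \<le> 1}. infdist z L)"
    using y by (intro cSUP_upper) auto
  then have "norm (y - ?P y) \<le> subspace_gap L M"
    using norm_orthogonal_projection[OF L, of y] by (simp add: subspace_gap_def)
  moreover have "norm (x - ?P x) = norm x * norm (y - ?P y)"
    by (subst (1 2) y(3)) (simp add: blinfun.scaleR_right flip: scaleR_diff_right)
  ultimately show ?thesis by (simp add: mult.commute[of _ "norm x"] mult_left_mono)
qed (simp add: blinfun.zero_right)

lemma norm_orthogonal_projection_compose_diff:
  fixes L M :: "'a::euclidean_space set" and Q :: "'a \<Rightarrow>\<^sub>L 'a"
  assumes L: "subspace L" and M: "subspace M" and Q: "range (blinfun_apply Q) \<subseteq> M"
    and gap: "subspace_gap L M \<le> e" and e: "0 \<le> e"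
  shows "norm ((projection L (orthogonal_comp L) o\<^sub>L Q) - Q) \<le> e * norm Q"
proof (rule norm_blinfun_bound)
  let ?P = "projection L (orthogonal_comp L)"
  show "0 \<le> e * norm Q" using e by simp
  fix x
  have "Q x \<in> M" using Q by blast
  then have "norm (Q x - ?P (Q x)) \<le> subspace_gap L M * norm (Q x)"
    by (rule norm_orthogonal_projection_le_gap[OF L M])
  also have "\<dots> \<le> e * (norm Q * norm x)"
    using gap e by (intro mult_mono norm_blinfun) auto
  finally show "norm (((?P o\<^sub>L Q) - Q) x) \<le> e * norm Q * norm x"
    by (simp add: blinfun.diff_left norm_minus_commute mult.assoc)
qed

lemma tendsto_projection_gap:
  fixes H :: "'b::metric_space \<Rightarrow> 'a::euclidean_space set"
  assumes H: "subspaces_continuous_on X H" and p: "p \<in> X" and c: "complementary W (H p)"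
    and sub: "\<And>q. q \<in> X \<Longrightarrow> subspace (H q)" "\<And>q. q \<in> X \<Longrightarrow> dim (H q) = dim (H p)"
  shows "\<forall>\<^sub>F q in at p within X. complementary W (H q)"
    and "((\<lambda>q. projection W (H q)) \<longlongrightarrow> projection W (H p)) (at p within X)"
proof -
  let ?Q = "id_blinfun - projection W (H p)"
  let ?B = "\<lambda>q. projection (H q) (orthogonal_comp (H q)) o\<^sub>L ?Q"
  have inX: "\<forall>\<^sub>F q in at p within X. q \<in> X" by (simp add: eventually_at_filter)
  have range: "range (blinfun_apply ?Q) \<subseteq> H p"
    using projection_in(2)[OF c] by (auto simp: blinfun.diff_left)
  have B: "(?B \<longlongrightarrow> ?Q) (at p within X)"
  proof (rule tendstoI)
    fix e :: real assume e: "e > 0"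
    define e' where "e' = e / (norm ?Q + 1)"
    have "norm ?Q + 1 > 0" by (simp add: add_nonneg_pos)
    then have e': "e' > 0" "e' * norm ?Q < e" using e by (simp_all add: e'_def field_simps)
    then have "\<forall>\<^sub>F q in at p within X. subspace_gap (H q) (H p) < e'"
      using H p unfolding subspaces_continuous_on_def eventually_at by blast
    with inX show "\<forall>\<^sub>F q in at p within X. dist (?B q) ?Q < e"
    proof eventually_elim
      case (elim q)
      then have "norm (?B q - ?Q) \<le> e' * norm ?Q"
        using norm_orthogonal_projection_compose_diff[OF sub(1) sub(1)[OF p] range] e'(1) by simp
      then show ?case using e'(2) by (simp add: dist_norm)
    qed
  qed
  have H': "\<forall>\<^sub>F q in at p within X. subspace (H q) \<and> dim (H q) = dim (H p) \<and> range (?B q) \<subseteq> H q"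
    using inX by eventually_elim (auto simp: sub projection_in[OF complementary_orthogonal_comp])
  have BW: "?B q w = 0" if "w \<in> W" for q w
    by (simp add: blinfun.diff_left projection_left[OF c that] blinfun.zero_right)
  show "\<forall>\<^sub>F q in at p within X. complementary W (H q)"
    using projection_perturbation[OF c H' B BW] by (auto elim: eventually_mono)
  show "((\<lambda>q. projection W (H q)) \<longlongrightarrow> projection W (H p)) (at p within X)"
    by (rule tendsto_projection[OF c H' B BW])
qed

lemma subspace_gap_image_le:
  fixes A B :: "'a::euclidean_space \<Rightarrow>\<^sub>L 'a"
  assumes L: "subspace L" and c: "c > 0" "\<And>x. c * norm x \<le> norm (A x)" "\<And>x. c * norm x \<le> norm (B x)"
  shows "subspace_gap (A ` L) (B ` L) \<le> norm (A - B) / c"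
proof -
  have half: "(SUP x\<in>{x\<in>C ` L. norm x \<le> 1}. infdist x (D ` L)) \<le> norm (C - D) / c"
    if C: "\<And>x. c * norm x \<le> norm (C x)" for C D :: "'a \<Rightarrow>\<^sub>L 'a"
  proof (rule cSUP_least)
    have "0 \<in> C ` L" using subspace_0[OF L]
      by (auto simp: blinfun.zero_right intro!: image_eqI[of _ _ 0])
    then show "{x\<in>C ` L. norm x \<le> 1} \<noteq> {}" by force
    fix x assume "x \<in> {x\<in>C ` L. norm x \<le> 1}"
    then obtain u where u: "u \<in> L" "x = C u" "norm (C u) \<le> 1" by auto
    have "c * norm u \<le> 1" using C[of u] u(3) by simp
    have "infdist x (D ` L) \<le> norm ((C - D) u)"
      using infdist_le[of "D u" "D ` L" x] u by (simp add: dist_norm blinfun.diff_left)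
    also have "\<dots> \<le> norm (C - D) * (1 / c)"
      using \<open>c * norm u \<le> 1\<close> c(1)
      by (intro order_trans[OF norm_blinfun] mult_left_mono) (auto simp: field_simps)
    finally show "infdist x (D ` L) \<le> norm (C - D) / c" by simp
  qed
  show ?thesis
    using half[OF c(2), of B] half[OF c(3), of A] by (simp add: subspace_gap_def norm_minus_commute)
qed

lemma subspaces_continuous_on_image:
  fixes A :: "'b::metric_space \<Rightarrow> 'a::euclidean_space \<Rightarrow>\<^sub>L 'a"
  assumes A: "continuous_on S A" and bij: "\<And>p. p \<in> S \<Longrightarrow> bij (blinfun_apply (A p))"
    and L: "subspace L"
  shows "subspaces_continuous_on S (\<lambda>p. A p ` L)"
  unfolding subspaces_continuous_on_def
proof (intro ballI allI impI)
  fix p and e :: real assume p: "p \<in> S" and e: "e > 0"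
  have lim: "(A \<longlongrightarrow> A p) (at p within S)" using A p by (auto simp: continuous_on_def)
  obtain c where c: "c > 0" "\<And>x. c * norm x \<le> norm (A p x)"
    and lower: "\<forall>\<^sub>F q in at p within S. \<forall>x. c * norm x \<le> norm (A q x)"
    by (rule eventually_bounded_below_blinfun[OF lim bij[OF p]]) blast
  have "\<forall>\<^sub>F q in at p within S. dist (A q) (A p) < c * e" using lim c(1) e by (intro tendstoD) auto
  with lower have "\<forall>\<^sub>F q in at p within S. subspace_gap (A q ` L) (A p ` L) < e"
  proof eventually_elim
    case (elim q)
    have "subspace_gap (A q ` L) (A p ` L) \<le> norm (A q - A p) / c"
      using elim(1) c by (intro subspace_gap_image_le L) auto
    also have "\<dots> < e" using elim(2) c(1) by (simp add: dist_norm field_simps)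
    finally show ?case .
  qed
  moreover have "subspace_gap (A p ` L) (A p ` L) < e"
    using subspace_gap_image_le[OF L c c(2)] e by simp
  ultimately show "\<exists>d>0. \<forall>q\<in>S. dist q p < d \<longrightarrow> subspace_gap (A q ` L) (A p ` L) < e"
    unfolding eventually_at by metis
qed

section \<open>Symplectic linear algebra\<close>

locale symplectic_space =
  fixes \<omega> :: "'a::euclidean_space \<Rightarrow> 'a \<Rightarrow> real"
  assumes symplectic: "symplectic_form \<omega>"
begin

lemma bilinear_omega: "bilinear \<omega>"
  using symplectic unfolding symplectic_form_def bilinear_def by blast

lemmas omega_simps = bilinear_ladd[OF bilinear_omega] bilinear_radd[OF bilinear_omega]
  bilinear_lsub[OF bilinear_omega] bilinear_rsub[OF bilinear_omega]
  bilinear_lmul[OF bilinear_omega] bilinear_rmul[OF bilinear_omega]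
  bilinear_lneg[OF bilinear_omega] bilinear_rneg[OF bilinear_omega]
  bilinear_lzero[OF bilinear_omega] bilinear_rzero[OF bilinear_omega]

lemma bounded_bilinear_omega: "bounded_bilinear \<omega>"
  using bilinear_omega by (simp add: bilinear_conv_bounded_bilinear)

lemma omega_skew: "\<omega> x y = - \<omega> y x"
  using symplectic unfolding symplectic_form_def by blast

lemma omega_self: "\<omega> x x = 0"
  using omega_skew[of x x] by simp

lemma omega_nondegenerate: "(\<And>y. \<omega> x y = 0) \<Longrightarrow> x = 0"
  using symplectic unfolding symplectic_form_def by blast

lemma bilinear_omega_blinfun: "bilinear (\<lambda>x y. \<omega> (blinfun_apply A x) y)"
  unfolding bilinear_def by (auto intro!: linearI simp: omega_simps blinfun.bilinear_simps)

definition omega_op :: "'a \<Rightarrow>\<^sub>L 'a" where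
  "omega_op = Blinfun (gram \<omega>)"

lemma inner_omega_op: "omega_op x \<bullet> y = \<omega> x y"
  by (simp add: omega_op_def blinfun_apply_Blinfun_linear linear_gram inner_gram bilinear_omega)

lemma bij_omega_op: "bij (blinfun_apply omega_op)"
  unfolding bij_blinfun_iff by (metis inner_omega_op inner_zero_left omega_nondegenerate)

lemma symplectic_mapI:
  fixes A :: "'a \<Rightarrow>\<^sub>L 'a"
  assumes "\<And>u v. \<omega> (A u) (A v) = \<omega> u v"
  shows "symplectic_map \<omega> A"
proof -
  have "u = 0" if "A u = 0" for u
    using assms[of u] that by (intro omega_nondegenerate) (simp add: omega_simps)
  then show ?thesis using assms by (simp add: symplectic_map_def bij_blinfun_iff)
qed

lemma symplectic_map_omega: "symplectic_map \<omega> A \<Longrightarrow> \<omega> (A u) (A v) = \<omega> u v"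
  by (simp add: symplectic_map_def)

lemma symplectic_map_bij: "symplectic_map \<omega> A \<Longrightarrow> bij (blinfun_apply A)"
  by (simp add: symplectic_map_def)

lemma symplectic_map_inj_on: "symplectic_map \<omega> A \<Longrightarrow> inj_on (blinfun_apply A) S"
  by (meson bij_is_inj inj_on_subset subset_UNIV symplectic_map_bij)

lemma symplectic_map_compose:
  "symplectic_map \<omega> A \<Longrightarrow> symplectic_map \<omega> B \<Longrightarrow> symplectic_map \<omega> (A o\<^sub>L B)"
  by (rule symplectic_mapI) (simp add: symplectic_map_omega)

lemma lagrangian_subspace: "lagrangian \<omega> L \<Longrightarrow> subspace L"
  by (simp add: lagrangian_def)

lemma lagrangian_isotropic: "lagrangian \<omega> L \<Longrightarrow> x \<in> L \<Longrightarrow> y \<in> L \<Longrightarrow> \<omega> x y = 0"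
  by (auto simp: lagrangian_def symp_compl_def)

lemma lagrangian_maximal: "lagrangian \<omega> L \<Longrightarrow> (\<And>x. x \<in> L \<Longrightarrow> \<omega> x y = 0) \<Longrightarrow> y \<in> L"
  by (auto simp: lagrangian_def symp_compl_def)

lemma symp_compl_properties:
  assumes "subspace L"
  shows "dim (symp_compl \<omega> L) + dim L = DIM('a)" "subspace (symp_compl \<omega> L)"
proof -
  have "dim (omega_op ` L) = dim L"
    using bij_is_inj[OF bij_omega_op]
    by (intro dim_image_eq[OF linear_blinfun_apply]) (auto intro: inj_on_subset)
  moreover have "{y\<in>UNIV. \<forall>x\<in>omega_op ` L. orthogonal x y} = symp_compl \<omega> L"
    by (auto simp: symp_compl_def inner_omega_op orthogonal_def)
  ultimately show "dim (symp_compl \<omega> L) + dim L = DIM('a)"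
    using dim_subspace_orthogonal_to_vectors[OF
        linear_subspace_image[OF linear_blinfun_apply assms] subspace_UNIV, of omega_op] by simp
  show "subspace (symp_compl \<omega> L)" by (auto simp: subspace_def symp_compl_def omega_simps)
qed

lemma dim_lagrangian: "lagrangian \<omega> L \<Longrightarrow> 2 * dim L = DIM('a)"
  using symp_compl_properties(1)[of L] by (simp add: lagrangian_def)

lemma lagrangianI:
  assumes "subspace L" "\<And>x y. x \<in> L \<Longrightarrow> y \<in> L \<Longrightarrow> \<omega> x y = 0" "DIM('a) \<le> 2 * dim L"
  shows "lagrangian \<omega> L"
proof -
  have "L \<subseteq> symp_compl \<omega> L" using assms(2) by (auto simp: symp_compl_def)
  then have "L = symp_compl \<omega> L"
    using symp_compl_properties[OF assms(1)] assms(1,3) by (intro subspace_dim_equal) auto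
  then show ?thesis using assms(1) by (simp add: lagrangian_def)
qed

lemma lagrangian_image:
  assumes A: "symplectic_map \<omega> A" and L: "lagrangian \<omega> L"
  shows "lagrangian \<omega> (A ` L)"
proof (rule lagrangianI)
  show "subspace (A ` L)"
    by (rule linear_subspace_image[OF linear_blinfun_apply lagrangian_subspace[OF L]])
  have "dim (A ` L) = dim L"
    by (intro dim_image_eq[OF linear_blinfun_apply] symplectic_map_inj_on[OF A])
  then show "DIM('a) \<le> 2 * dim (A ` L)" using dim_lagrangian[OF L] by simp
qed (use L A lagrangian_isotropic in \<open>auto simp: symplectic_map_omega\<close>)

definition transversal :: "'a set \<Rightarrow> 'a set \<Rightarrow> bool" where
  "transversal W l \<longleftrightarrow> lagrangian \<omega> W \<and> lagrangian \<omega> l \<and> W \<inter> l = {0}"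

lemma transversal_lagrangian:
  "transversal W l \<Longrightarrow> lagrangian \<omega> W" "transversal W l \<Longrightarrow> lagrangian \<omega> l"
  by (auto simp: transversal_def)

lemma transversal_commute: "transversal W l \<longleftrightarrow> transversal l W"
  by (auto simp: transversal_def)

lemma transversal_iff_complementary:
  "transversal W l \<longleftrightarrow> lagrangian \<omega> W \<and> lagrangian \<omega> l \<and> complementary W l"
proof
  show "transversal W l" if "lagrangian \<omega> W \<and> lagrangian \<omega> l \<and> complementary W l"
    using that by (simp add: transversal_def complementary_def)
  assume t: "transversal W l"
  then have "complementary W l"
    using dim_lagrangian[of W] dim_lagrangian[of l]
    by (intro complementary_if_dim lagrangian_subspace) (auto simp: transversal_def)
  with t show "lagrangian \<omega> W \<and> lagrangian \<omega> l \<and> complementary W l" by (simp add: transversal_def)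
qed

lemma transversal_complementary: "transversal W l \<Longrightarrow> complementary W l"
  by (simp add: transversal_iff_complementary)

lemma transversal_image:
  assumes A: "symplectic_map \<omega> A" and t: "transversal W l"
  shows "transversal (A ` W) (A ` l)"
proof -
  have "A ` W \<inter> A ` l = A ` (W \<inter> l)"
    using symplectic_map_inj_on[OF A, of UNIV] by (simp add: image_Int)
  then show ?thesis using t A by (simp add: transversal_def lagrangian_image blinfun.zero_right)
qed

section \<open>Chart forms\<close>

definition chart_form :: "'a set \<Rightarrow> 'a set \<Rightarrow> 'a \<Rightarrow> real" where
  "chart_form W l v = \<omega> (projection W l v) v"

lemma quadform_chart_form: "quadform (chart_form W l)"
  unfolding chart_form_def[abs_def] by (rule quadform_bilinear[OF bilinear_omega_blinfun])

lemma chart_form_swap: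
  assumes "complementary W l"
  shows "chart_form l W v = - chart_form W l v"
proof -
  have "\<exists>x\<in>l. v - x \<in> W" for v
    using projection_in[OF assms, of v] by (intro bexI[of _ "v - projection W l v"]) simp_all
  then have "complementary l W" using assms by (simp add: complementary_def Int_commute)
  then have "projection l W v = v - projection W l v"
    using projection_in[OF assms] by (intro projection_eqI) auto
  then show ?thesis by (simp add: chart_form_def omega_simps omega_self)
qed

lemma polar_chart_form:
  assumes t: "transversal W l" and uv: "\<omega> u v = 0"
  shows "polar (chart_form W l) u v = \<omega> (projection W l u) v"
proof -
  let ?P = "projection W l"
  note P = projection_in[OF transversal_complementary[OF t]]
  note lag = transversal_lagrangian[OF t]
  have "\<omega> (?P u) (?P v) = 0" "\<omega> (u - ?P u) (v - ?P v) = 0"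
    using lagrangian_isotropic[OF lag(1)] lagrangian_isotropic[OF lag(2)] P by auto
  then have "\<omega> (?P u) v = - \<omega> u (?P v)" using uv by (simp add: omega_simps)
  then have "\<omega> (?P u) v = \<omega> (?P v) u" using omega_skew[of u "?P v"] by simp
  then show ?thesis
    using polar_bilinear[OF bilinear_omega_blinfun, of ?P u v]
    by (simp add: chart_form_def[abs_def])
qed

lemma form_radical_chart_form:
  assumes t: "transversal W l" and L: "lagrangian \<omega> L"
  shows "form_radical (chart_form W l) L = {x + y |x y. x \<in> L \<inter> l \<and> y \<in> L \<inter> W}"
proof (intro set_eqI iffI)
  note c = transversal_complementary[OF t]
  note sL = lagrangian_subspace[OF L]
  have pol: "polar (chart_form W l) u v = \<omega> (projection W l u) v" if "u \<in> L" "v \<in> L" for u v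
    by (rule polar_chart_form[OF t lagrangian_isotropic[OF L that]])
  fix u
  show "u \<in> {x + y |x y. x \<in> L \<inter> l \<and> y \<in> L \<inter> W}" if u: "u \<in> form_radical (chart_form W l) L"
  proof -
    let ?w = "projection W l u"
    have "\<omega> ?w v = 0" if "v \<in> L" for v
      using u pol that by (auto simp: form_radical_def)
    then have "?w \<in> L"
      using u omega_skew by (intro lagrangian_maximal[OF L]) (metis neg_equal_0_iff_equal)
    moreover have "u \<in> L" using u by (simp add: form_radical_def)
    ultimately have "u - ?w \<in> L \<inter> l" "?w \<in> L \<inter> W"
      using projection_in[OF c] subspace_diff[OF sL] by auto
    then show ?thesis by (intro CollectI exI[of _ "u - ?w"] exI[of _ ?w]) simp
  qed
  show "u \<in> form_radical (chart_form W l) L" if u: "u \<in> {x + y |x y. x \<in> L \<inter> l \<and> y \<in> L \<inter> W}"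
  proof -
    obtain x y where u: "u = x + y" "x \<in> L" "x \<in> l" "y \<in> L" "y \<in> W" using u by auto
    then have "u \<in> L" "projection W l u = y"
      using subspace_add[OF sL] by (auto intro: projection_eqI[OF c])
    then show ?thesis using u pol by (auto simp: form_radical_def lagrangian_isotropic[OF L])
  qed
qed

lemma dim_form_radical_chart_form:
  assumes t: "transversal W l" and L: "lagrangian \<omega> L"
  shows "dim (form_radical (chart_form W l) L) = dim (L \<inter> l) + dim (L \<inter> W)"
  unfolding form_radical_chart_form[OF assms]
  using t transversal_lagrangian[OF t, THEN lagrangian_subspace] lagrangian_subspace[OF L]
  by (intro dim_sums_trivial_Int subspace_inter) (auto simp: transversal_def)

lemma inertia_chart_form:
  assumes "transversal W l" and L: "lagrangian \<omega> L"
  shows "n_plus (chart_form W l) L + n_minus (chart_form W l) L + dim (L \<inter> l) + dim (L \<inter> W) = dim L"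
  using inertia_sum[OF quadform_chart_form[of W l] lagrangian_subspace[OF L]]
    dim_form_radical_chart_form[OF assms]
  by simp

lemma chart_form_image:
  assumes A: "symplectic_map \<omega> A" and t: "transversal W l"
  shows "chart_form (A ` W) (A ` l) (A v) = chart_form W l v"
proof -
  have "projection (A ` W) (A ` l) (A v) = A (projection W l v)"
    using projection_in[OF transversal_complementary[OF t]]
    by (intro projection_eqI[OF transversal_complementary[OF transversal_image[OF A t]]])
      (auto simp flip: blinfun.diff_right)
  then show ?thesis by (simp add: chart_form_def symplectic_map_omega[OF A])
qed

lemma n_plus_chart_form_image:
  assumes A: "symplectic_map \<omega> A" and t: "transversal W l" and S: "subspace S"
  shows "n_plus (chart_form (A ` W) (A ` l)) (A ` S) = n_plus (chart_form W l) S"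
  using n_plus_image[OF S linear_blinfun_apply symplectic_map_inj_on[OF A],
    of "chart_form (A ` W) (A ` l)"]
  by (simp add: quadform_zero[OF quadform_chart_form] chart_form_image[OF A t])

lemma chart_form_diff:
  assumes t1: "transversal W l1" and t2: "transversal W l2"
  shows "chart_form W l2 v = chart_form W l1 v + chart_form W l2 (v - projection W l1 v)"
proof -
  note c1 = transversal_complementary[OF t1] and c2 = transversal_complementary[OF t2]
  have "projection W l2 (v - projection W l1 v) = projection W l2 v - projection W l1 v"
    by (simp add: blinfun.diff_right projection_left[OF c2 projection_in(1)[OF c1]])
  moreover have "\<omega> (projection W l2 v) (projection W l1 v) = 0"
    using lagrangian_isotropic[OF transversal_lagrangian(1)[OF t1]] projection_in(1)[OF c1]
      projection_in(1)[OF c2] by auto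
  ultimately show ?thesis by (simp add: chart_form_def omega_simps omega_self)
qed

lemma n_plus_chart_form_le:
  assumes t1: "transversal W l1" and t2: "transversal W l2" and S: "subspace S"
  shows "n_plus (chart_form W l2) S \<le> n_plus (chart_form W l1) S + n_plus (chart_form W l2) l1"
proof -
  let ?f = "\<lambda>v. v - projection W l1 v"
  have lin: "linear ?f"
    by (intro linear_compose_sub linear_ident linear_blinfun_apply)
  have "n_plus (chart_form W l2) S = n_plus (\<lambda>v. chart_form W l1 v + chart_form W l2 (?f v)) S"
    by (subst chart_form_diff[OF t1 t2, abs_def]) (rule refl)
  also have "\<dots> \<le> n_plus (chart_form W l1) S + n_plus (\<lambda>v. chart_form W l2 (?f v)) S"
    by (intro n_plus_add_le quadform_chart_form quadform_comp_linear[OF quadform_chart_form lin] S)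
  also have "n_plus (\<lambda>v. chart_form W l2 (?f v)) S \<le> n_plus (chart_form W l2) l1"
    using projection_in(2)[OF transversal_complementary[OF t1]]
    by (intro n_plus_le_linear_image[OF S lin]) (auto simp: quadform_zero[OF quadform_chart_form])
  finally show ?thesis by simp
qed

section \<open>The cocycle identity and the triple index\<close>

lemma chart_form_cocycle:
  assumes tW: "transversal W l" and tW': "transversal W' l" and L: "lagrangian \<omega> L"
    and v: "v \<in> L" and u: "u \<in> W" and y: "y \<in> W'" and z: "z \<in> L"
    and decomp: "u - projection W l v = y + z"
  shows "chart_form W l v + chart_form W' l u = chart_form W' l (v + z) + \<omega> y z"
proof -
  note c = transversal_complementary[OF tW] and c' = transversal_complementary[OF tW']
  note iso = lagrangian_isotropic[OF L] transversal_lagrangian[OF tW, THEN lagrangian_isotropic]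
    lagrangian_isotropic[OF transversal_lagrangian(1)[OF tW']]
  let ?P = "projection W l" and ?P' = "projection W' l"
  define a u' where "a = ?P v" and "u' = ?P' u"
  have a: "a \<in> W" "v - a \<in> l" and u': "u' \<in> W'" "u - u' \<in> l"
    using projection_in[OF c, of v] projection_in[OF c', of u] by (auto simp: a_def u'_def)
  have z_eq: "z = u - a - y" using decomp by (simp add: a_def algebra_simps)
  have "?P' v = ?P' a" using projection_right[OF c' a(2)] by (simp add: blinfun.diff_right)
  then have P'vz: "?P' (v + z) = u' - y"
    using projection_left[OF c' y]
    by (simp add: z_eq blinfun.add_right blinfun.diff_right u'_def)
  have zero: "\<omega> z v = 0" "\<omega> (u - u') (v - a) = 0" "\<omega> u a = 0" "\<omega> u' y = 0"
    using v u y z a u' iso by auto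
  have "\<omega> u' z = \<omega> u' u - \<omega> u' a" using zero(4) by (simp add: z_eq omega_simps)
  moreover have "\<omega> u' v - \<omega> u' a = \<omega> u v" using zero(2,3) by (simp add: omega_simps)
  moreover have "\<omega> y v = \<omega> u v - \<omega> a v" using zero(1) by (simp add: z_eq omega_simps)
  ultimately show ?thesis
    using zero by (simp add: chart_form_def P'vz omega_simps flip: a_def u'_def)
qed

lemma triple_Q_eq:
  assumes \<beta>: "lagrangian \<omega> \<beta>" and \<gamma>: "lagrangian \<omega> \<gamma>" and yz: "y \<in> \<beta>" "z \<in> \<gamma>"
  shows "triple_Q \<omega> \<alpha> \<beta> \<gamma> (y + z) = \<omega> y z"
  unfolding triple_Q_def
proof (rule some_equality)
  fix r assume "\<exists>y' z'. y' \<in> \<beta> \<and> z' \<in> \<gamma> \<and> y + z = y' + z' \<and> r = \<omega> y' z'"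
  then obtain y' z' where r: "y' \<in> \<beta>" "z' \<in> \<gamma>" "y + z = y' + z'" "r = \<omega> y' z'" by blast
  define e where "e = y - y'"
  have e: "y' = y - e" "z' = z + e" using r(3) by (auto simp: e_def algebra_simps)
  then have "e \<in> \<beta>" "e \<in> \<gamma>"
    using r(1,2) yz subspace_diff[OF lagrangian_subspace[OF \<beta>], of y y']
      subspace_diff[OF lagrangian_subspace[OF \<gamma>], of z' z] by auto
  then have "\<omega> y e = 0" "\<omega> e z = 0" "\<omega> e e = 0"
    using yz lagrangian_isotropic[OF \<beta>] lagrangian_isotropic[OF \<gamma>] by auto
  then show "r = \<omega> y z" by (simp add: r(4) e omega_simps)
qed (use yz in blast)

text \<open>Read as a change of variables on \<open>L \<times> W\<close>, the cocycle identity exhibits both sides as the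
  positive index of one quadratic form.\<close>

theorem n_plus_cocycle:
  assumes tW: "transversal W l" and tW': "transversal W' l" and L: "lagrangian \<omega> L"
    and split: "W \<subseteq> {y + z |y z. y \<in> W' \<and> z \<in> L}"
  shows "n_plus (chart_form W l) L + n_plus (chart_form W' l) W =
    n_plus (chart_form W' l) L + n_plus (triple_Q \<omega> W W' L) W"
proof -
  note c = transversal_complementary[OF tW]
  have lag: "lagrangian \<omega> W" "lagrangian \<omega> W'" using tW tW' by (auto simp: transversal_def)
  note sub = lag[THEN lagrangian_subspace] lagrangian_subspace[OF L]
  obtain \<zeta> where \<zeta>: "linear \<zeta>" "range \<zeta> \<subseteq> L" "\<And>w. w \<in> W \<Longrightarrow> w - \<zeta> w \<in> W'"
    by (rule linear_sum_decomposition[OF sub(2,3) split]) (rule that)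
  let ?P = "projection W l" and ?Q = "\<lambda>w. \<omega> (w - \<zeta> w) (\<zeta> w)"
  have "bilinear (\<lambda>x y. \<omega> (x - \<zeta> x) (\<zeta> y))"
    using \<zeta>(1)
    by (auto intro!: linearI simp: bilinear_def omega_simps linear_add linear_cmul algebra_simps)
  then have qQ: "quadform ?Q" by (rule quadform_bilinear)
  have "triple_Q \<omega> W W' L w = ?Q w" if "w \<in> W" for w
    using triple_Q_eq[OF lag(2) L \<zeta>(3)[OF that], of "\<zeta> w" W] \<zeta>(2) by auto
  then have triple: "n_plus (triple_Q \<omega> W W' L) W = n_plus ?Q W" by (rule n_plus_cong)
  define f where "f = (\<lambda>(v, u). (v + \<zeta> (u - ?P v), u - ?P v))"
  define g where "g = (\<lambda>(v, w). (v - \<zeta> w, w + ?P (v - \<zeta> w)))"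
  have "n_plus (\<lambda>(v, u). chart_form W l v + chart_form W' l u) (L \<times> W)
      = n_plus (\<lambda>(v, w). chart_form W' l v + ?Q w) (L \<times> W)"
  proof (rule n_plus_eq_linear_bij[where f = f and g = g])
    show "linear f" "linear g" unfolding f_def g_def
      by (rule linearI; auto simp: linear_add[OF \<zeta>(1)] linear_diff[OF \<zeta>(1)] linear_cmul[OF \<zeta>(1)]
          blinfun.bilinear_simps algebra_simps)+
    show "f ` (L \<times> W) \<subseteq> L \<times> W" "g ` (L \<times> W) \<subseteq> L \<times> W"
      using \<zeta>(2) projection_in(1)[OF c] sub
      by (auto simp: f_def g_def intro!: subspace_add subspace_diff)
    show "f (g x) = x" for x by (cases x) (simp add: f_def g_def)
    fix x assume "x \<in> L \<times> W"
    then obtain v u where x: "x = (v, u)" "v \<in> L" "u \<in> W" by blast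
    have "u - ?P v \<in> W" using x projection_in(1)[OF c] subspace_diff[OF sub(1)] by blast
    from chart_form_cocycle[OF tW tW' L x(2,3) \<zeta>(3)[OF this], of "\<zeta> (u - ?P v)"]
    show "(case f x of (v, w) \<Rightarrow> chart_form W' l v + ?Q w)
        = (case x of (v, u) \<Rightarrow> chart_form W l v + chart_form W' l u)"
      using range_subsetD[OF \<zeta>(2)] by (simp add: x f_def)
  qed (use sub in \<open>auto intro: subspace_Times
      simp: zero_prod_def quadform_zero[OF quadform_chart_form]\<close>)
  then show ?thesis
    unfolding triple n_plus_Times[OF quadform_chart_form quadform_chart_form sub(3,1)]
      n_plus_Times[OF quadform_chart_form qQ sub(3,1)] .
qed

corollary chart_change:
  assumes tL: "transversal W' L" and tW': "transversal W' l" and tW: "transversal W l"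
  shows "n_plus (chart_form W l) L + n_plus (chart_form W' l) W =
         n_plus (chart_form W' l) L + n_plus (chart_form W' L) W"
proof -
  let ?P = "projection W' L"
  note P = projection_in[OF transversal_complementary[OF tL]]
  have "v \<in> {y + z |y z. y \<in> W' \<and> z \<in> L}" for v
    using P[of v] by (intro CollectI exI[of _ "?P v"] exI[of _ "v - ?P v"]) simp
  then have split: "W \<subseteq> {y + z |y z. y \<in> W' \<and> z \<in> L}" by blast
  have "triple_Q \<omega> W W' L v = chart_form W' L v" for v
    using triple_Q_eq[OF transversal_lagrangian[OF tL] P[of v], of W]
    by (simp add: chart_form_def omega_simps omega_self)
  then have "triple_Q \<omega> W W' L = chart_form W' L" by (rule ext)
  with n_plus_cocycle[OF tW tW' transversal_lagrangian(2)[OF tL] split] show ?thesis by simp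
qed

lemma triple_index_maximal:
  assumes \<alpha>: "lagrangian \<omega> \<alpha>" and \<beta>: "lagrangian \<omega> \<beta>" and \<gamma>: "lagrangian \<omega> \<gamma>"
    and max: "triple_index \<omega> \<alpha> \<beta> \<gamma> = dim \<alpha> - dim (\<alpha> \<inter> \<beta>)"
  shows "\<alpha> \<subseteq> {y + z |y z. y \<in> \<beta> \<and> z \<in> \<gamma>}"
    and "n_plus (triple_Q \<omega> \<alpha> \<beta> \<gamma>) \<alpha> + dim (\<alpha> \<inter> \<beta>) + dim (\<alpha> \<inter> \<gamma>) = dim \<alpha> + dim (\<beta> \<inter> \<gamma>)"
proof -
  note sub = \<alpha>[THEN lagrangian_subspace] \<beta>[THEN lagrangian_subspace] \<gamma>[THEN lagrangian_subspace]
  let ?Q = "triple_Q \<omega> \<alpha> \<beta> \<gamma>" and ?S = "\<alpha> \<inter> {y + z |y z. y \<in> \<beta> \<and> z \<in> \<gamma>}"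
  let ?R = "{y + z |y z. y \<in> \<alpha> \<inter> \<beta> \<and> z \<in> \<alpha> \<inter> \<gamma>}"
  have sS: "subspace ?S" and sR: "subspace ?R" by (intro subspace_inter sub subspace_sums)+
  have RS: "?R \<subseteq> ?S" using subspace_add[OF sub(1)] by auto
  obtain U where U: "subspace U" "U \<subseteq> ?S" "posdef_on ?Q U" "dim U = n_plus ?Q ?S"
    using n_plus_attained[OF sS] by blast
  have "?Q x \<le> 0" if "x \<in> ?R" for x
    using that triple_Q_eq[OF \<beta> \<gamma>] lagrangian_isotropic[OF \<alpha>] by auto
  then have "n_plus ?Q ?S + dim ?R \<le> dim ?S"
    unfolding U(4)[symmetric] by (rule dim_posdef_plus_dim_nonpos[OF U(1) sR sS U(2) RS U(3)])
  moreover have "dim ?R + dim (\<alpha> \<inter> \<beta> \<inter> \<gamma>) = dim (\<alpha> \<inter> \<beta>) + dim (\<alpha> \<inter> \<gamma>)"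
  proof -
    have "(\<alpha> \<inter> \<beta>) \<inter> (\<alpha> \<inter> \<gamma>) = \<alpha> \<inter> \<beta> \<inter> \<gamma>" by blast
    then show ?thesis using dim_sums_Int[of "\<alpha> \<inter> \<beta>" "\<alpha> \<inter> \<gamma>"] sub by (simp add: subspace_inter)
  qed
  moreover have "dim (\<alpha> \<inter> \<beta> \<inter> \<gamma>) \<le> dim (\<alpha> \<inter> \<gamma>)" "dim (\<alpha> \<inter> \<beta>) \<le> dim \<alpha>" by (auto intro: dim_subset)
  moreover have "dim ?S \<le> dim \<alpha>" by (intro dim_subset) auto
  ultimately have "dim ?S = dim \<alpha>"
    and count: "n_plus ?Q ?S + dim (\<alpha> \<inter> \<beta>) + dim (\<alpha> \<inter> \<gamma>) = dim \<alpha> + dim (\<alpha> \<inter> \<beta> \<inter> \<gamma>)"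
    using max unfolding triple_index_def by linarith+
  then have S: "?S = \<alpha>" by (intro subspace_dim_equal[OF sS sub(1)]) auto
  then show split: "\<alpha> \<subseteq> {y + z |y z. y \<in> \<beta> \<and> z \<in> \<gamma>}" by blast
  have "\<omega> a x = 0" if "x \<in> \<beta> \<inter> \<gamma>" "a \<in> \<alpha>" for a x
    using that split lagrangian_isotropic[OF \<beta>] lagrangian_isotropic[OF \<gamma>]
    by (auto simp: omega_simps)
  then have "\<beta> \<inter> \<gamma> \<subseteq> \<alpha>" using lagrangian_maximal[OF \<alpha>] by blast
  then have "\<alpha> \<inter> \<beta> \<inter> \<gamma> = \<beta> \<inter> \<gamma>" by blast
  then show "n_plus ?Q \<alpha> + dim (\<alpha> \<inter> \<beta>) + dim (\<alpha> \<inter> \<gamma>) = dim \<alpha> + dim (\<beta> \<inter> \<gamma>)"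
    using count unfolding S by simp
qed

theorem n_plus_chart_form_maximal:
  assumes t1: "transversal W L1" and t2: "transversal W L2" and L3: "lagrangian \<omega> L3"
    and max: "triple_index \<omega> L1 L2 L3 = dim L1 - dim (L1 \<inter> L2)"
  shows "n_plus (chart_form W L2) L3 = n_plus (chart_form W L1) L3 + n_plus (chart_form W L2) L1"
proof -
  note lag = transversal_lagrangian(2)[OF t1] transversal_lagrangian(2)[OF t2] L3
  note triple = triple_index_maximal[OF lag max]
  have swap: "n_plus (chart_form L W) S = n_minus (chart_form W L) S" if "transversal W L" for L S
    unfolding n_minus_eq_n_plus
    by (rule n_plus_cong) (rule chart_form_swap[OF transversal_complementary[OF that]])
  have "n_minus (chart_form W L1) L3 + n_minus (chart_form W L2) L1
      = n_minus (chart_form W L2) L3 + n_plus (triple_Q \<omega> L1 L2 L3) L1"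
    using n_plus_cocycle[of L1 W L2 L3] t1 t2 L3 triple(1)
    by (simp add: swap transversal_commute[of _ W])
  moreover have "dim (L1 \<inter> W) = 0" using t1 by (auto simp: transversal_def)
  ultimately show ?thesis
    using inertia_chart_form[OF t1 L3] inertia_chart_form[OF t2 L3]
      inertia_chart_form[OF t2 lag(1)] triple(2)
      dim_lagrangian[OF L3] dim_lagrangian[OF lag(1)] by (simp add: Int_commute del: dim_eq_0)
qed

section \<open>Positive symplectic rotations\<close>

definition dual_op :: "'a \<Rightarrow>\<^sub>L 'a" where
  "dual_op = - blinfun_inv omega_op"

lemma omega_dual_op: "\<omega> v (dual_op w) = v \<bullet> w"
proof -
  have "\<omega> v (dual_op w) = \<omega> (blinfun_inv omega_op w) v"
    using omega_skew[of v "dual_op w"] by (simp add: dual_op_def blinfun.minus_left omega_simps)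
  also have "\<dots> = w \<bullet> v"
    using inner_omega_op[of "blinfun_inv omega_op w" v]
    by (simp add: blinfun_inv_right[OF bij_omega_op])
  finally show ?thesis by (simp add: inner_commute)
qed

lemma omega_dual_op_skew: "\<omega> (dual_op v) w = - \<omega> v (dual_op w)"
  using omega_dual_op omega_skew by (metis inner_commute)

lemma norm_add_dual_op:
  "(norm (u + s *\<^sub>R dual_op u))\<^sup>2 = (norm u)\<^sup>2 + s\<^sup>2 * (norm (dual_op u))\<^sup>2"
proof -
  have "dual_op u \<bullet> u = 0" using omega_dual_op[of "dual_op u" u] by (simp add: omega_self)
  then have "orthogonal u (s *\<^sub>R dual_op u)" by (simp add: orthogonal_def inner_commute)
  from norm_add_Pythagorean[OF this] show ?thesis by (simp add: power_mult_distrib)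
qed

lemma bij_id_minus_dual_op: "bij (blinfun_apply (id_blinfun - s *\<^sub>R dual_op))"
  unfolding bij_blinfun_iff
proof (intro allI impI)
  fix v assume "(id_blinfun - s *\<^sub>R dual_op) v = 0"
  then show "v = 0"
    using norm_add_dual_op[of v "- s"]
    by (simp add: blinfun.diff_left blinfun.scaleR_left add_nonneg_eq_0_iff)
qed

definition resolvent :: "real \<Rightarrow> 'a \<Rightarrow>\<^sub>L 'a" where
  "resolvent s = blinfun_inv (id_blinfun - s *\<^sub>R dual_op)"

lemma resolvent_right: "resolvent s v - s *\<^sub>R dual_op (resolvent s v) = v"
  using blinfun_inv_right[OF bij_id_minus_dual_op, of s v]
  by (simp add: resolvent_def blinfun.diff_left blinfun.scaleR_left)

lemma resolvent_has_derivative: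
  "(resolvent has_vector_derivative (resolvent s o\<^sub>L dual_op o\<^sub>L resolvent s)) (at s within S)"
proof -
  have "((\<lambda>s. id_blinfun - s *\<^sub>R dual_op) has_vector_derivative - dual_op) (at s within S)"
    by (auto intro!: derivative_eq_intros)
  from has_vector_derivative_blinfun_inv[OF this bij_id_minus_dual_op] show ?thesis
    by (simp add: resolvent_def[abs_def]
      bounded_bilinear.minus_left[OF bounded_bilinear_blinfun_compose]
        bounded_bilinear.minus_right[OF bounded_bilinear_blinfun_compose])
qed

definition cayley :: "real \<Rightarrow> 'a \<Rightarrow>\<^sub>L 'a" where
  "cayley s = 2 *\<^sub>R resolvent s - id_blinfun"

definition cayley_deriv :: "real \<Rightarrow> 'a \<Rightarrow>\<^sub>L 'a" where
  "cayley_deriv s = 2 *\<^sub>R (resolvent s o\<^sub>L dual_op o\<^sub>L resolvent s)"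

lemma cayley_has_derivative: "(cayley has_vector_derivative cayley_deriv s) (at s within S)"
  unfolding cayley_def[abs_def] cayley_deriv_def
  using has_vector_derivative_diff[OF bounded_linear.has_vector_derivative
      [OF bounded_linear_scaleR_right resolvent_has_derivative] has_vector_derivative_const]
  by simp

lemma continuous_on_cayley_deriv: "continuous_on S cayley_deriv"
  unfolding cayley_deriv_def[abs_def]
  by (intro continuous_intros continuous_on_vector_derivative[OF resolvent_has_derivative])

lemma cayley_0: "cayley 0 = id_blinfun"
  by (simp add: cayley_def resolvent_def blinfun_inv_id scaleR_2)

text \<open>In terms of \<open>w = 2 (1 - s J)\<^sup>-\<^sup>1 u\<close>, where \<open>J\<close> is \<^const>\<open>dual_op\<close>, the Cayley transform takes the
  symmetric form \<open>(w - s J w) / 2 \<mapsto> (w + s J w) / 2\<close>.\<close>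

lemma cayley_param:
  assumes "w = 2 *\<^sub>R resolvent s u"
  shows "u = (1/2) *\<^sub>R (w - s *\<^sub>R dual_op w)" "cayley s u = (1/2) *\<^sub>R (w + s *\<^sub>R dual_op w)"
    "cayley_deriv s u = resolvent s (dual_op w)"
proof -
  show u: "u = (1/2) *\<^sub>R (w - s *\<^sub>R dual_op w)"
    using resolvent_right[of s u] by (simp add: assms blinfun.scaleR_right algebra_simps)
  have "cayley s u = w - u" by (simp add: cayley_def assms blinfun.diff_left blinfun.scaleR_left)
  also have "\<dots> = (1/2) *\<^sub>R (w + s *\<^sub>R dual_op w)"
    by (subst u) (simp add: algebra_simps flip: scaleR_add_left)
  finally show "cayley s u = (1/2) *\<^sub>R (w + s *\<^sub>R dual_op w)" .
  show "cayley_deriv s u = resolvent s (dual_op w)"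
    by (simp add: cayley_deriv_def assms blinfun.scaleR_left blinfun.scaleR_right)
qed

lemma norm_cayley: "norm (cayley s u) = norm u"
proof -
  define w where "w = 2 *\<^sub>R resolvent s u"
  have "(norm (w - s *\<^sub>R dual_op w))\<^sup>2 = (norm (w + s *\<^sub>R dual_op w))\<^sup>2"
    using norm_add_dual_op[of w s] norm_add_dual_op[of w "- s"] by simp
  then have "norm (w - s *\<^sub>R dual_op w) = norm (w + s *\<^sub>R dual_op w)"
    using power2_eq_imp_eq norm_ge_zero by blast
  then show ?thesis by (subst (2) cayley_param(1)[OF w_def]) (simp add: cayley_param(2)[OF w_def])
qed

lemma omega_cayley: "\<omega> (cayley s u) (cayley s v) = \<omega> u v"
proof -
  define w z where "w = 2 *\<^sub>R resolvent s u" and "z = 2 *\<^sub>R resolvent s v"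
  note u = cayley_param[OF w_def] and v = cayley_param[OF z_def]
  have "\<omega> (cayley s u) (cayley s v) = (\<omega> w z + s * s * \<omega> (dual_op w) (dual_op z)) / 4"
    unfolding u(2) v(2) by (simp add: omega_simps omega_dual_op_skew algebra_simps)
  moreover have "\<omega> u v = (\<omega> w z + s * s * \<omega> (dual_op w) (dual_op z)) / 4"
    by (subst u(1), subst v(1)) (simp add: omega_simps omega_dual_op_skew algebra_simps)
  ultimately show ?thesis by simp
qed

lemma symplectic_map_cayley: "symplectic_map \<omega> (cayley s)"
  by (rule symplectic_mapI) (rule omega_cayley)

definition rotation_rate :: real where
  "rotation_rate = 2 / (1 + norm dual_op)\<^sup>2"

lemma rotation_rate_pos: "rotation_rate > 0"
proof -
  have "1 + norm dual_op > 0" by (simp add: add_pos_nonneg)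
  then show ?thesis by (simp add: rotation_rate_def)
qed

lemma omega_cayley_deriv:
  assumes s: "0 \<le> s" "s \<le> 1"
  shows "rotation_rate * (norm u)\<^sup>2 \<le> \<omega> (cayley s u) (cayley_deriv s u)"
proof -
  define w where "w = 2 *\<^sub>R resolvent s u"
  define y where "y = resolvent s (dual_op w)"
  note u = cayley_param[OF w_def]
  have "\<omega> (cayley s u) (cayley_deriv s u) = 1 / 2 * \<omega> (w + s *\<^sub>R dual_op w) y"
    unfolding u(2,3) y_def[symmetric] by (simp add: omega_simps)
  also have "\<omega> (w + s *\<^sub>R dual_op w) y = \<omega> w (y - s *\<^sub>R dual_op y)"
    by (simp add: omega_simps omega_dual_op_skew)
  also have "\<dots> = (norm w)\<^sup>2"
    using resolvent_right[of s "dual_op w"] by (simp add: y_def omega_dual_op power2_norm_eq_inner)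
  finally have rate: "\<omega> (cayley s u) (cayley_deriv s u) = 1 / 2 * (norm w)\<^sup>2" .
  have "norm (s *\<^sub>R dual_op w) \<le> 1 * (norm dual_op * norm w)"
    unfolding norm_scaleR using s by (intro mult_mono norm_blinfun) auto
  moreover have "norm u = 1 / 2 * norm (w - s *\<^sub>R dual_op w)" 
    using arg_cong[OF u(1), of norm] unfolding norm_scaleR by simp
  ultimately have "norm u \<le> (1 + norm dual_op) / 2 * norm w"
    using norm_triangle_ineq4[of w "s *\<^sub>R dual_op w"] by (simp add: algebra_simps)
  then have "(norm u)\<^sup>2 \<le> ((1 + norm dual_op) / 2 * norm w)\<^sup>2" by (intro power_mono) auto
  then have "rotation_rate * (norm u)\<^sup>2 \<le> rotation_rate * ((1 + norm dual_op) / 2 * norm w)\<^sup>2"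
    using rotation_rate_pos by (intro mult_left_mono) auto
  also have "\<dots> = 1 / 2 * (norm w)\<^sup>2"
  proof -
    have "1 + norm dual_op \<noteq> 0" by (smt (verit) norm_ge_zero)
    then show ?thesis by (simp add: rotation_rate_def power_mult_distrib power_divide)
  qed
  finally show ?thesis using rate by simp
qed

primrec rotation :: "nat \<Rightarrow> real \<Rightarrow> 'a \<Rightarrow>\<^sub>L 'a" where
  "rotation 0 s = id_blinfun"
| "rotation (Suc N) s = cayley s o\<^sub>L rotation N s"

primrec rotation_deriv :: "nat \<Rightarrow> real \<Rightarrow> 'a \<Rightarrow>\<^sub>L 'a" where
  "rotation_deriv 0 s = 0"
| "rotation_deriv (Suc N) s = (cayley s o\<^sub>L rotation_deriv N s) + (cayley_deriv s o\<^sub>L rotation N s)"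

lemma rotation_at_0: "rotation N 0 = id_blinfun"
  by (induction N) (simp_all add: cayley_0)

lemma symplectic_map_rotation: "symplectic_map \<omega> (rotation N s)"
  by (induction N) (auto intro: symplectic_mapI symplectic_map_compose symplectic_map_cayley)

lemma norm_rotation: "norm (rotation N s u) = norm u"
  by (induction N) (simp_all add: norm_cayley)

lemma rotation_has_derivative:
  "(rotation N has_vector_derivative rotation_deriv N s) (at s within S)"
proof (induction N)
  case (Suc N)
  have "rotation (Suc N) = (\<lambda>s. cayley s o\<^sub>L rotation N s)" by (rule ext) simp
  then show ?case
    using has_vector_derivative_blinfun_compose[OF cayley_has_derivative Suc]
    by simp
next
  case 0
  have "rotation 0 = (\<lambda>_. id_blinfun)" by (rule ext) simp
  then show ?case by (simp add: has_vector_derivative_const)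
qed

lemma continuous_on_rotation: "continuous_on S (rotation N)"
  by (rule continuous_on_vector_derivative[OF rotation_has_derivative])

lemma continuous_on_rotation_deriv: "continuous_on S (rotation_deriv N)"
proof (induction N)
  case (Suc N)
  have "continuous_on S (\<lambda>s. (cayley s o\<^sub>L rotation_deriv N s) + (cayley_deriv s o\<^sub>L rotation N s))"
    by (intro continuous_intros continuous_on_vector_derivative[OF cayley_has_derivative] Suc
        continuous_on_cayley_deriv continuous_on_rotation)
  then show ?case by simp
qed simp

lemma omega_rotation_deriv:
  assumes s: "0 \<le> s" "s \<le> 1"
  shows "real N * rotation_rate * (norm u)\<^sup>2 \<le> \<omega> (rotation N s u) (rotation_deriv N s u)"
proof (induction N)
  case (Suc N)
  show ?case
    using Suc omega_cayley_deriv[OF s, of "rotation N s u"]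
    by (simp add: blinfun.add_left omega_simps omega_cayley norm_rotation algebra_simps)
qed (simp add: omega_simps)

lemma exists_transversal:
  assumes l: "lagrangian \<omega> l"
  obtains W where "transversal W l"
proof -
  have "v = 0" if v: "v \<in> cayley 1 ` l" "v \<in> l" for v
  proof -
    obtain u where u: "u \<in> l" "v = cayley 1 u" using v(1) by blast
    define w where "w = 2 *\<^sub>R resolvent 1 u"
    have half: "u = (1/2) *\<^sub>R w - (1/2) *\<^sub>R dual_op w" "v = (1/2) *\<^sub>R w + (1/2) *\<^sub>R dual_op w"
      using cayley_param(1,2)[OF w_def] by (simp_all add: u(2) scaleR_diff_right scaleR_add_right)
    have "v + u = w" "v - u = dual_op w"
      unfolding half by (simp_all flip: scaleR_add_left)
    moreover have "\<omega> (v + u) (v - u) = 0"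
      using v(2) u(1) lagrangian_subspace[OF l]
      by (intro lagrangian_isotropic[OF l]) (auto intro: subspace_add subspace_diff)
    ultimately have "w = 0" by (simp add: omega_dual_op)
    then show "v = 0" using u(2) by (simp add: cayley_param(2)[OF w_def] blinfun.zero_right)
  qed
  then have "transversal (cayley 1 ` l) l"
    using lagrangian_image[OF symplectic_map_cayley l] l subspace_0[OF lagrangian_subspace]
    by (auto simp: transversal_def)
  then show ?thesis by (rule that)
qed

section \<open>Chart forms and crossing forms along paths\<close>

lemma tendsto_chart_form:
  "((\<lambda>t. projection W (l t)) \<longlongrightarrow> projection W l0) F \<Longrightarrow> (x \<longlongrightarrow> x0) F \<Longrightarrow>
    ((\<lambda>t. chart_form W (l t) (x t)) \<longlongrightarrow> chart_form W l0 x0) F"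
  unfolding chart_form_def
  by (intro bounded_bilinear.tendsto[OF bounded_bilinear_omega] tendsto_intros)

lemma transversal_gap_continuous:
  fixes H :: "'b::metric_space \<Rightarrow> 'a set"
  assumes H: "subspaces_continuous_on X H" "\<And>q. q \<in> X \<Longrightarrow> lagrangian \<omega> (H q)"
    and p: "p \<in> X" and t: "transversal W (H p)"
  shows "\<forall>\<^sub>F q in at p within X. transversal W (H q)"
    and "((\<lambda>q. projection W (H q)) \<longlongrightarrow> projection W (H p)) (at p within X)"
proof -
  have dims: "dim (H q) = dim (H p)" if "q \<in> X" for q
    using dim_lagrangian[OF H(2)[OF that]] dim_lagrangian[OF H(2)[OF p]] by simp
  have near: "\<forall>\<^sub>F q in at p within X. complementary W (H q)"
    by (rule tendsto_projection_gap(1)[OF H(1) p transversal_complementary[OF t]])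
      (auto intro: lagrangian_subspace H(2) dims)
  have "\<forall>\<^sub>F q in at p within X. q \<in> X" by (simp add: eventually_at_filter)
  with near show "\<forall>\<^sub>F q in at p within X. transversal W (H q)"
    by eventually_elim
      (simp add: transversal_iff_complementary H(2) transversal_lagrangian(1)[OF t])
  show "((\<lambda>q. projection W (H q)) \<longlongrightarrow> projection W (H p)) (at p within X)"
    by (rule tendsto_projection_gap(2)[OF H(1) p transversal_complementary[OF t]])
      (auto intro: lagrangian_subspace H(2) dims)
qed

lemma chart_form_has_derivative:
  fixes Z :: "real \<Rightarrow> 'a \<Rightarrow>\<^sub>L 'a"
  assumes t: "transversal W (l t0)" and t0: "t0 \<in> S"
    and l: "\<And>t. t \<in> S \<Longrightarrow> lagrangian \<omega> (l t)" "\<And>t. t \<in> S \<Longrightarrow> l t = range (Z t)"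
    and Z: "(Z has_vector_derivative Z') (at t0 within S)"
  obtains d where "quadform d" "\<forall>\<^sub>F t in at t0 within S. transversal W (l t)"
    "\<And>v. ((\<lambda>t. chart_form W (l t) v) has_vector_derivative d v) (at t0 within S)"
    "\<And>v. v \<in> l t0 \<Longrightarrow> \<exists>u. Z t0 u = v \<and> d v = \<omega> v (Z' u)"
proof -
  note c = transversal_complementary[OF t]
  let ?P = "projection W (l t0)"
  have dims: "dim (l t) = dim (l t0)" if "t \<in> S" for t
    using dim_lagrangian[OF l(1)[OF that]] dim_lagrangian[OF l(1)[OF t0]] by simp
  obtain h where h: "Z t0 o\<^sub>L h = id_blinfun - ?P"
    and near: "\<forall>\<^sub>F t in at t0 within S. complementary W (l t)"
    and deriv: "((\<lambda>t. projection W (l t)) has_vector_derivative - (?P o\<^sub>L Z' o\<^sub>L h))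
        (at t0 within S)"
    by (rule has_vector_derivative_projection[OF c t0 l(2) dims Z]) (use t0 in auto)
  define d where "d v = \<omega> (blinfun_apply (- (?P o\<^sub>L Z' o\<^sub>L h)) v) v" for v
  show ?thesis
  proof (rule that)
    show "quadform d" unfolding d_def[abs_def]
      by (rule quadform_bilinear[OF bilinear_omega_blinfun])
    have "\<forall>\<^sub>F t in at t0 within S. t \<in> S" by (simp add: eventually_at_filter)
    with near show "\<forall>\<^sub>F t in at t0 within S. transversal W (l t)"
      by eventually_elim
        (simp add: transversal_iff_complementary l(1) transversal_lagrangian(1)[OF t])
    fix v
    have "bounded_linear (\<lambda>A. \<omega> (blinfun_apply A v) v)"
      by (intro
        bounded_linear_compose[OF bounded_bilinear.bounded_linear_left[OF bounded_bilinear_omega]]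
          blinfun.bounded_linear_left)
    from bounded_linear.has_vector_derivative[OF this deriv]
    show "((\<lambda>t. chart_form W (l t) v) has_vector_derivative d v) (at t0 within S)"
      by (simp add: chart_form_def d_def)
    assume v: "v \<in> l t0"
    let ?z = "Z' (h v)"
    have "\<omega> v (?z - ?P ?z) = 0"
      using v projection_in(2)[OF c] by (blast intro: lagrangian_isotropic[OF l(1)[OF t0]])
    then have "d v = \<omega> v ?z"
      using omega_skew[of "?P ?z" v] by (simp add: d_def blinfun.minus_left omega_simps)
    moreover have "Z t0 (h v) = v"
      using arg_cong[OF h, of "\<lambda>A. blinfun_apply A v"] projection_right[OF c v]
      by (simp add: blinfun.diff_left)
    ultimately show "\<exists>u. Z t0 u = v \<and> d v = \<omega> v (Z' u)" by blast
  qed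
qed

lemma omega_chart_position:
  assumes t: "transversal W l"
  shows "\<omega> v (THE w. w \<in> W \<and> v + w \<in> l) = chart_form W l v"
proof -
  note c = transversal_complementary[OF t]
  have neg: "- w \<in> W" if "w \<in> W" for w
    by (rule subspace_neg[OF lagrangian_subspace[OF transversal_lagrangian(1)[OF t]] that])
  have "(THE w. w \<in> W \<and> v + w \<in> l) = - projection W l v"
  proof (rule the_equality)
    show "- projection W l v \<in> W \<and> v + - projection W l v \<in> l"
      using projection_in[OF c] neg by simp
    show "w = - projection W l v" if "w \<in> W \<and> v + w \<in> l" for w
      using projection_eqI[OF c neg, of w v] that by simp
  qed
  then show ?thesis
    using omega_skew[of v "projection W l v"] by (simp add: chart_form_def omega_simps)
qed

lemma crossing_form_chart:
  fixes Z :: "real \<Rightarrow> 'a \<Rightarrow>\<^sub>L 'a"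
  assumes ab: "a < b" and t0: "t0 \<in> {a..b}"
    and l: "\<And>t. t \<in> {a..b} \<Longrightarrow> lagrangian \<omega> (l t)" "\<And>t. t \<in> {a..b} \<Longrightarrow> l t = range (Z t)"
    and Z: "(Z has_vector_derivative Z') (at t0 within {a..b})"
  obtains W where "transversal W (l t0)" "\<forall>\<^sub>F t in at t0 within {a..b}. transversal W (l t)"
    "quadform (crossing_form \<omega> l a b t0)"
    "\<And>v. ((\<lambda>t. chart_form W (l t) v) has_vector_derivative crossing_form \<omega> l a b t0 v)
        (at t0 within {a..b})"
    "\<And>v. v \<in> l t0 \<Longrightarrow> \<exists>u. Z t0 u = v \<and> crossing_form \<omega> l a b t0 v = \<omega> v (Z' u)"
proof -
  define W where "W = (SOME W. lagrangian \<omega> W \<and> W \<inter> l t0 = {0})"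
  have "\<exists>W. lagrangian \<omega> W \<and> W \<inter> l t0 = {0}"
    using exists_transversal[OF l(1)[OF t0]] unfolding transversal_def by blast
  from someI_ex[OF this, folded W_def] have W: "transversal W (l t0)"
    using l(1)[OF t0] by (simp add: transversal_def)
  obtain d where d: "quadform d" and near: "\<forall>\<^sub>F t in at t0 within {a..b}. transversal W (l t)"
    and deriv: "\<And>v. ((\<lambda>t. chart_form W (l t) v) has_vector_derivative d v) (at t0 within {a..b})"
    and val: "\<And>v. v \<in> l t0 \<Longrightarrow> \<exists>u. Z t0 u = v \<and> d v = \<omega> v (Z' u)"
    by (rule chart_form_has_derivative[OF W t0 l Z]) auto
  have "crossing_form \<omega> l a b t0 v = d v" for v
  proof -
    let ?f = "\<lambda>t. \<omega> v (THE w. w \<in> W \<and> v + w \<in> l t)"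
    have "\<forall>\<^sub>F t in at t0 within {a..b}.
        (chart_form W (l t) v - chart_form W (l t0) v) /\<^sub>R (t - t0) = (?f t - ?f t0) /\<^sub>R (t - t0)"
      using near by eventually_elim (simp add: omega_chart_position W)
    then have "(?f has_vector_derivative d v) (at t0 within {a..b})"
      using deriv[of v] unfolding has_vector_derivative_iff_tendsto
      by (rule Lim_transform_eventually[rotated])
    then show ?thesis
      using vector_derivative_within_closed_interval[OF ab t0]
      by (simp add: crossing_form_def Let_def flip: W_def)
  qed
  then have "crossing_form \<omega> l a b t0 = d" by (rule ext)
  then show ?thesis using that[OF W near] d deriv val by simp
qed

lemma lag_C1_crossing_form:
  assumes "lag_C1 \<omega> l a b" "a < b" "t0 \<in> {a..b}"
  obtains W where "transversal W (l t0)" "\<forall>\<^sub>F t in at t0 within {a..b}. transversal W (l t)"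
    "quadform (crossing_form \<omega> l a b t0)"
    "\<And>v. ((\<lambda>t. chart_form W (l t) v) has_vector_derivative crossing_form \<omega> l a b t0 v)
        (at t0 within {a..b})"
proof -
  obtain Z :: "real \<Rightarrow> 'a \<Rightarrow>\<^sub>L 'a" and Z' where Z: "\<And>t. t \<in> {a..b} \<Longrightarrow> lagrangian \<omega> (l t)"
    "\<And>t. t \<in> {a..b} \<Longrightarrow> l t = range (Z t)" "(Z has_vector_derivative Z' t0) (at t0 within {a..b})"
    using assms unfolding lag_C1_def C1_on_def by blast
  show ?thesis by (rule crossing_form_chart[OF assms(2,3) Z]) (assumption | rule that)+
qed

lemma symplectic_path_crossing_form:
  fixes A :: "real \<Rightarrow> 'a \<Rightarrow>\<^sub>L 'a"
  assumes ab: "a < b" and t0: "t0 \<in> {a..b}" and M: "lagrangian \<omega> M"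
    and A: "\<And>t. t \<in> {a..b} \<Longrightarrow> symplectic_map \<omega> (A t)"
    and A': "(A has_vector_derivative A') (at t0 within {a..b})"
  defines "\<Gamma> \<equiv> crossing_form \<omega> (\<lambda>t. A t ` M) a b t0"
  obtains W where "transversal W (A t0 ` M)" "\<forall>\<^sub>F t in at t0 within {a..b}. transversal W (A t ` M)"
    "quadform \<Gamma>"
    "\<And>v. ((\<lambda>t. chart_form W (A t ` M) v) has_vector_derivative \<Gamma> v) (at t0 within {a..b})"
    "\<And>u. u \<in> M \<Longrightarrow> \<Gamma> (A t0 u) = \<omega> (A t0 u) (A' u)"
proof -
  let ?P = "projection M (orthogonal_comp M)"
  have range: "A t ` M = range (A t o\<^sub>L ?P)" for t
    by (rule image_eq_range_blinfun[OF lagrangian_subspace[OF M]])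
  have deriv: "((\<lambda>t. A t o\<^sub>L ?P) has_vector_derivative (A' o\<^sub>L ?P)) (at t0 within {a..b})"
    by (rule has_vector_derivative_blinfun_compose_left[OF A'])
  show ?thesis
  proof (rule crossing_form_chart[where l = "\<lambda>t. A t ` M" and Z = "\<lambda>t. A t o\<^sub>L ?P",
        OF ab t0 lagrangian_image[OF A M] range deriv], fold \<Gamma>_def)
    fix W
    assume val: "\<exists>w. (A t0 o\<^sub>L ?P) w = v \<and> \<Gamma> v = \<omega> v ((A' o\<^sub>L ?P) w)" if "v \<in> A t0 ` M" for v
    have "\<Gamma> (A t0 u) = \<omega> (A t0 u) (A' u)" if u: "u \<in> M" for u
    proof -
      obtain w where w: "A t0 (?P w) = A t0 u" "\<Gamma> (A t0 u) = \<omega> (A t0 u) (A' (?P w))"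
        using val[of "A t0 u"] u by auto
      then have "?P w = u" using symplectic_map_inj_on[OF A[OF t0], of UNIV] by (simp add: inj_eq)
      then show ?thesis using w(2) by simp
    qed
    moreover assume "transversal W (A t0 ` M)"
      "\<forall>\<^sub>F t in at t0 within {a..b}. transversal W (A t ` M)"
      "quadform \<Gamma>"
      "\<And>v. ((\<lambda>t. chart_form W (A t ` M) v) has_vector_derivative \<Gamma> v) (at t0 within {a..b})"
    ultimately show thesis by (intro that)
  qed
qed

lemma lag_C1_symplectic_path:
  fixes A :: "real \<Rightarrow> 'a \<Rightarrow>\<^sub>L 'a"
  assumes M: "lagrangian \<omega> M" and A: "\<And>t. t \<in> {a..b} \<Longrightarrow> symplectic_map \<omega> (A t)"
    and C1: "C1_on {a..b} A"
  shows "lag_C1 \<omega> (\<lambda>t. A t ` M) a b"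
proof -
  let ?P = "projection M (orthogonal_comp M)"
  obtain A' where A': "\<And>t. t \<in> {a..b} \<Longrightarrow> (A has_vector_derivative A' t) (at t within {a..b})"
    "continuous_on {a..b} A'" using C1 unfolding C1_on_def by blast
  have "((\<lambda>t. A t o\<^sub>L ?P) has_vector_derivative (A' t o\<^sub>L ?P)) (at t within {a..b})"
    if "t \<in> {a..b}" for t
    by (rule has_vector_derivative_blinfun_compose_left[OF A'(1)[OF that]])
  moreover have "continuous_on {a..b} (\<lambda>t. A' t o\<^sub>L ?P)" by (intro continuous_intros A'(2))
  ultimately have "C1_on {a..b} (\<lambda>t. A t o\<^sub>L ?P)" by (rule C1_onI)
  moreover have "\<forall>t\<in>{a..b}. lagrangian \<omega> (A t ` M)" using lagrangian_image[OF A M] by simp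
  moreover have "\<forall>t\<in>{a..b}. A t ` M = range (A t o\<^sub>L ?P)"
    by (intro ballI image_eq_range_blinfun[OF lagrangian_subspace[OF M]])
  ultimately show ?thesis unfolding lag_C1_def by (intro conjI exI[of _ "\<lambda>t. A t o\<^sub>L ?P"])
qed

lemma one_sided_crossing_jump:
  assumes t0: "transversal W l0" and L: "lagrangian \<omega> L" and d: "quadform d"
    and near: "\<forall>\<^sub>F t in F. transversal W (l t)" and \<tau>: "filterlim \<tau> (at_right 0) F"
    and lim: "\<And>v. ((\<lambda>t. (chart_form W (l t) v - chart_form W l0 v) / \<tau> t) \<longlongrightarrow> d v) F"
    and nd: "qf_nondegenerate d (l0 \<inter> L)"
  shows "\<forall>\<^sub>F t in F. l t \<inter> L = {0} \<and>
    n_plus (chart_form W (l t)) L = n_plus (chart_form W l0) L + n_plus d (l0 \<inter> L)"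
proof -
  note sub = lagrangian_subspace[OF L] lagrangian_subspace[OF transversal_lagrangian(2)[OF t0]]
  have "l0 \<inter> L \<subseteq> form_radical (chart_form W l0) L"
    unfolding form_radical_chart_form[OF t0 L]
    using subspace_0[OF sub(1)]
      subspace_0[OF lagrangian_subspace[OF transversal_lagrangian(1)[OF t0]]] by force
  moreover have "\<forall>\<^sub>F t in F. dim (L \<inter> W) \<le> dim (form_radical (chart_form W (l t)) L)"
    using near by eventually_elim (simp add: dim_form_radical_chart_form[OF _ L])
  moreover have "dim (form_radical (chart_form W l0) L) = dim (l0 \<inter> L) + dim (L \<inter> W)"
    by (simp add: dim_form_radical_chart_form[OF t0 L] Int_commute)
  ultimately have "\<forall>\<^sub>F t in F. n_plus (chart_form W (l t)) L =
      n_plus (chart_form W l0) L + n_plus d (l0 \<inter> L) \<and>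
      dim (form_radical (chart_form W (l t)) L) = dim (L \<inter> W)"
    by (intro n_plus_regular_perturbation[OF quadform_chart_form d _ sub(1)
      subspace_inter[OF sub(2,1)] _ nd \<tau> lim])
      (simp_all add: quadform_chart_form)
  with near show ?thesis
  proof eventually_elim
    case (elim t)
    then have "dim (l t \<inter> L) = 0"
      using dim_form_radical_chart_form[OF elim(1) L] by (simp add: Int_commute)
    moreover have "0 \<in> l t \<inter> L"
      using subspace_0[OF sub(1)]
        subspace_0[OF lagrangian_subspace[OF transversal_lagrangian(2)[OF elim(1)]]]
      by blast
    ultimately show ?case using elim(2) by auto
  qed
qed

lemma crossing_jump:
  assumes t: "transversal W (l t0)" and L: "lagrangian \<omega> L" and d: "quadform d"
    and near: "\<forall>\<^sub>F t in at t0 within S. transversal W (l t)"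
    and deriv: "\<And>v. ((\<lambda>t. chart_form W (l t) v) has_vector_derivative d v) (at t0 within S)"
    and nd: "qf_nondegenerate d (l t0 \<inter> L)"
  shows "\<forall>\<^sub>F t in at t0 within S. l t \<inter> L = {0} \<and>
     (t0 < t \<longrightarrow> n_plus (chart_form W (l t)) L =
         n_plus (chart_form W (l t0)) L + n_plus d (l t0 \<inter> L)) \<and>
     (t < t0 \<longrightarrow> n_plus (chart_form W (l t)) L =
         n_plus (chart_form W (l t0)) L + n_minus d (l t0 \<inter> L))"
proof -
  let ?R = "at t0 within (S \<inter> {t0<..})" and ?L = "at t0 within (S \<inter> {..<t0})"
  let ?Q = "\<lambda>t v. chart_form W (l t) v - chart_form W (l t0) v"
  have near': "\<forall>\<^sub>F t in at t0 within (S \<inter> A). transversal W (l t)" for A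
    using near by (rule filter_leD[OF at_le, rotated]) auto
  have "((\<lambda>t. ?Q t v / (t - t0)) \<longlongrightarrow> d v) (at t0 within S)" for v
    using deriv[of v] unfolding has_vector_derivative_iff_tendsto
    by (simp add: divide_inverse_commute)
  then have quot: "((\<lambda>t. ?Q t v / (t - t0)) \<longlongrightarrow> d v) (at t0 within (S \<inter> A))" for A v
    by (rule tendsto_within_subset) auto
  have "((\<lambda>t. t - t0) \<longlongrightarrow> 0) (at t0 within A)" "((\<lambda>t. t0 - t) \<longlongrightarrow> 0) (at t0 within A)" for A
    by (auto intro!: tendsto_eq_intros)
  then have \<tau>: "filterlim (\<lambda>t. t - t0) (at_right 0) ?R" "filterlim (\<lambda>t. t0 - t) (at_right 0) ?L"
    by (auto simp: filterlim_at eventually_at_filter)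
  have right: "\<forall>\<^sub>F t in ?R. l t \<inter> L = {0} \<and>
      n_plus (chart_form W (l t)) L = n_plus (chart_form W (l t0)) L + n_plus d (l t0 \<inter> L)"
    by (rule one_sided_crossing_jump[OF t L d near' \<tau>(1) quot nd])
  have "((\<lambda>t. ?Q t v / (t0 - t)) \<longlongrightarrow> - d v) ?L" for v
    using tendsto_minus[OF quot[of v "{..<t0}"]] by (simp flip: divide_minus_right)
  moreover have "qf_nondegenerate (\<lambda>x. - d x) (l t0 \<inter> L)"
    using nd by (simp add: qf_nondegenerate_uminus)
  ultimately have "\<forall>\<^sub>F t in ?L. l t \<inter> L = {0} \<and>
      n_plus (chart_form W (l t)) L = n_plus (chart_form W (l t0)) L + n_minus d (l t0 \<inter> L)"
    unfolding n_minus_eq_n_plus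
    by (rule one_sided_crossing_jump[OF t L quadform_uminus[OF d] near' \<tau>(2)])
  with right show ?thesis
    unfolding eventually_at_filter by eventually_elim auto
qed

lemma positive_motion_leaves_cycle:
  fixes A :: "real \<Rightarrow> 'a \<Rightarrow>\<^sub>L 'a"
  assumes ab: "a < b" and t0: "t0 \<in> {a..b}" and L: "lagrangian \<omega> L" and M: "lagrangian \<omega> M"
    and A: "\<And>t. symplectic_map \<omega> (A t)" "(A has_vector_derivative A') (at t0 within {a..b})"
    and pos: "\<And>u. u \<noteq> 0 \<Longrightarrow> \<omega> (A t0 u) (A' u) > 0"
  shows "\<forall>\<^sub>F t in at t0 within {a..b}. A t ` M \<inter> L = {0}"
proof -
  let ?\<Gamma> = "crossing_form \<omega> (\<lambda>t. A t ` M) a b t0"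
  obtain W where W: "transversal W (A t0 ` M)"
    "\<forall>\<^sub>F t in at t0 within {a..b}. transversal W (A t ` M)"
    and \<Gamma>: "quadform ?\<Gamma>"
    and deriv: "\<And>v. ((\<lambda>t. chart_form W (A t ` M) v) has_vector_derivative ?\<Gamma> v)
      (at t0 within {a..b})"
    and val: "\<And>u. u \<in> M \<Longrightarrow> ?\<Gamma> (A t0 u) = \<omega> (A t0 u) (A' u)"
    by (rule symplectic_path_crossing_form[OF ab t0 M A]) auto
  have "qf_nondegenerate ?\<Gamma> (A t0 ` M \<inter> L)"
  proof (rule anisotropic_imp_nondegenerate[OF \<Gamma>])
    fix v assume v: "v \<in> A t0 ` M \<inter> L" "v \<noteq> 0"
    then obtain u where u: "u \<in> M" "v = A t0 u" by blast
    then have "u \<noteq> 0" using v(2) by (auto simp: blinfun.zero_right)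
    then show "?\<Gamma> v \<noteq> 0" using val[OF u(1)] pos[of u] u(2) by simp
  qed
  from crossing_jump[where l = "\<lambda>t. A t ` M", OF W(1) L \<Gamma> W(2) deriv this]
  show ?thesis by eventually_elim simp
qed

lemma eventually_transversal_cayley:
  assumes \<alpha>: "lagrangian \<omega> \<alpha>" and \<beta>: "lagrangian \<omega> \<beta>"
  shows "\<forall>\<^sub>F s in at_right 0. transversal (cayley s ` \<beta>) \<alpha>"
proof -
  have "\<omega> (cayley 0 u) (cayley_deriv 0 u) > 0" if "u \<noteq> 0" for u
  proof -
    have "0 < rotation_rate * (norm u)\<^sup>2" using rotation_rate_pos that by simp
    also have "\<dots> \<le> \<omega> (cayley 0 u) (cayley_deriv 0 u)" by (rule omega_cayley_deriv) auto
    finally show ?thesis .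
  qed
  then have "\<forall>\<^sub>F s in at 0 within {0..1}. cayley s ` \<beta> \<inter> \<alpha> = {0}"
    by (intro positive_motion_leaves_cycle[OF _ _ \<alpha> \<beta> symplectic_map_cayley
      cayley_has_derivative]) auto
  then show ?thesis
    using \<alpha> lagrangian_image[OF symplectic_map_cayley \<beta>]
    by (simp add: at_within_Icc_at_right transversal_def)
qed

lemma common_transversal:
  assumes "finite F" "F \<noteq> {}" "\<And>\<alpha>. \<alpha> \<in> F \<Longrightarrow> lagrangian \<omega> \<alpha>"
  obtains W where "\<And>\<alpha>. \<alpha> \<in> F \<Longrightarrow> transversal W \<alpha>"
proof -
  obtain \<beta> where "\<beta> \<in> F" using assms(2) by blast
  then have "\<forall>\<^sub>F s in at_right 0. \<forall>\<alpha>\<in>F. transversal (cayley s ` \<beta>) \<alpha>"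
    using assms by (intro eventually_ball_finite) (auto intro: eventually_transversal_cayley)
  then have "\<exists>s. \<forall>\<alpha>\<in>F. transversal (cayley s ` \<beta>) \<alpha>"
    by (rule eventually_happens'[OF trivial_limit_at_right_real])
  then show ?thesis using that by blast
qed

end

section \<open>Gluing local primitives\<close>

lemma ray_subdivision:
  fixes X :: "'x::real_normed_vector set"
  assumes X: "convex X" "bounded X" and p: "p \<in> X" and e: "e > 0"
  obtains N :: nat and P where "\<And>x. P 0 x = p" "\<And>x. P N x = x"
    "\<And>k x. k \<le> N \<Longrightarrow> x \<in> X \<Longrightarrow> P k x \<in> X" "\<And>k x. x \<in> X \<Longrightarrow> dist (P k x) (P (Suc k) x) < e"
    "\<And>k x y. k \<le> N \<Longrightarrow> dist (P k x) (P k y) \<le> dist x y"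
proof -
  obtain D where D: "\<And>x. x \<in> X \<Longrightarrow> dist p x \<le> D"
    using X(2) by (metis bounded_any_center)
  obtain N :: nat where N: "D / e < real N" using reals_Archimedean2 by blast
  have "0 \<le> D / e" using D[OF p] e by simp
  then have N0: "real N > 0" using N by linarith
  define P where "P k x = p + (real k / real N) *\<^sub>R (x - p)" for k x
  show ?thesis
  proof (rule that)
    show "P N x = x" "P 0 x = p" for x using N0 by (auto simp: P_def)
    show "P k x \<in> X" if "k \<le> N" "x \<in> X" for k x
    proof -
      have "P k x = (1 - real k / real N) *\<^sub>R p + (real k / real N) *\<^sub>R x"
        by (simp add: P_def algebra_simps)
      then show ?thesis using that N0 p X(1) by (simp add: convexD_alt)
    qed
    show "dist (P k x) (P (Suc k) x) < e" if "x \<in> X" for k x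
    proof -
      have "P (Suc k) x - P k x = (1 / real N) *\<^sub>R (x - p)"
        by (simp add: P_def add_divide_distrib algebra_simps)
      then have "dist (P (Suc k) x) (P k x) = dist x p / real N" by (simp add: dist_norm)
      also have "\<dots> \<le> D / real N" using D[OF that] by (simp add: divide_right_mono dist_commute)
      also have "\<dots> < e" using N e N0 by (simp add: field_simps)
      finally show ?thesis by (simp add: dist_commute)
    qed
    show "dist (P k x) (P k y) \<le> dist x y" if "k \<le> N" for k x y
    proof -
      have "P k x - P k y = (real k / real N) *\<^sub>R (x - y)" by (simp add: P_def algebra_simps)
      then have "dist (P k x) (P k y) = real k / real N * dist x y" by (simp add: dist_norm)
      also have "\<dots> \<le> 1 * dist x y" using that N0 by (intro mult_right_mono) auto
      finally show ?thesis by simp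
    qed
  qed
qed

text \<open>Summing along rays from a base point gives a primitive; by the cocycle property, moving the
  end point of a ray changes the sum by a telescoping series.\<close>

lemma local_cocycle_is_coboundary:
  fixes \<delta> :: "'x::real_normed_vector \<Rightarrow> 'x \<Rightarrow> 'g::ab_group_add"
  assumes X: "convex X" "bounded X" and e: "e > 0"
    and cocycle: "\<And>x y z. \<lbrakk>x \<in> X; y \<in> X; z \<in> X; dist x y < e; dist y z < e; dist x z < e\<rbrakk> \<Longrightarrow>
      \<delta> x z = \<delta> x y + \<delta> y z"
  obtains f where "\<And>x y. \<lbrakk>x \<in> X; y \<in> X; dist x y < e / 2\<rbrakk> \<Longrightarrow> f y - f x = \<delta> x y"
proof (cases "X = {}")
  case True
  then show ?thesis using that[of "\<lambda>_. 0"] by blast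
next
  case False
  then obtain p where p: "p \<in> X" by blast
  obtain N P where P_ends: "\<And>x. P 0 x = p" "\<And>x. P N x = x"
    and PX: "\<And>k x. k \<le> N \<Longrightarrow> x \<in> X \<Longrightarrow> P k x \<in> X"
    and P_step: "\<And>k x. x \<in> X \<Longrightarrow> dist (P k x) (P (Suc k) x) < e / 2"
    and P_contract: "\<And>k x y. k \<le> N \<Longrightarrow> dist (P k x) (P k y) \<le> dist x y"
    using ray_subdivision[OF X p half_gt_zero[OF e]] by metis
  define f where "f x = (\<Sum>k<N. \<delta> (P k x) (P (Suc k) x))" for x
  show ?thesis
  proof (rule that)
    fix x y assume xy: "x \<in> X" "y \<in> X" "dist x y < e / 2"
    have square: "\<delta> (P k y) (P (Suc k) y) - \<delta> (P k x) (P (Suc k) x)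
        = \<delta> (P (Suc k) x) (P (Suc k) y) - \<delta> (P k x) (P k y)" if k: "k < N" for k
    proof -
      have small: "dist (P k x) (P k y) < e / 2" "dist (P (Suc k) x) (P (Suc k) y) < e / 2"
        "dist (P k x) (P (Suc k) x) < e / 2" "dist (P k y) (P (Suc k) y) < e / 2"
        using P_contract[of k x y] P_contract[of "Suc k" x y] P_step xy k by auto
      then have "dist (P k x) (P (Suc k) y) < e"
        using dist_triangle[of "P k x" "P (Suc k) y" "P k y"] by linarith
      with small have "dist (P k x) (P k y) < e" "dist (P k y) (P (Suc k) y) < e"
        "dist (P k x) (P (Suc k) x) < e" "dist (P (Suc k) x) (P (Suc k) y) < e"
        "dist (P k x) (P (Suc k) y) < e" using e by linarith+
      then have "\<delta> (P k x) (P (Suc k) y) = \<delta> (P k x) (P k y) + \<delta> (P k y) (P (Suc k) y)"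
        "\<delta> (P k x) (P (Suc k) y) = \<delta> (P k x) (P (Suc k) x) + \<delta> (P (Suc k) x) (P (Suc k) y)"
        using PX k xy(1,2) by (intro cocycle; simp)+
      then show ?thesis by (simp add: algebra_simps)
    qed
    have "f y - f x = (\<Sum>k<N. \<delta> (P (Suc k) x) (P (Suc k) y) - \<delta> (P k x) (P k y))"
      unfolding f_def sum_subtractf[symmetric] by (intro sum.cong square) auto
    also have "\<dots> = \<delta> (P N x) (P N y) - \<delta> (P 0 x) (P 0 y)"
      by (rule sum_lessThan_telescope)
    also have "\<delta> (P 0 x) (P 0 y) = 0"
      using cocycle[OF p p p] e by (simp add: P_ends)
    finally show "f y - f x = \<delta> x y" by (simp add: P_ends)
  qed
qed

lemma lebesgue_number_balls:
  fixes X :: "'x::metric_space set"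
  assumes X: "compact X" and r: "\<And>p. p \<in> X \<Longrightarrow> r p > 0"
  obtains e c where "e > 0" "\<And>x. x \<in> X \<Longrightarrow> c x \<in> X" "\<And>x. x \<in> X \<Longrightarrow> ball x e \<subseteq> ball (c x) (r (c x))"
proof -
  obtain e where e: "e > 0" "\<forall>x\<in>X. \<exists>B\<in>(\<lambda>p. ball p (r p)) ` X. ball x e \<subseteq> B"
  proof (rule Heine_Borel_lemma[OF X, of "(\<lambda>p. ball p (r p)) ` X"])
    show "X \<subseteq> \<Union> ((\<lambda>p. ball p (r p)) ` X)" using r by force
  qed auto
  then have "\<forall>x\<in>X. \<exists>p\<in>X. ball x e \<subseteq> ball p (r p)" by blast
  with e(1) show ?thesis using that by metis
qed

lemma connected_increments_eq:
  fixes g h :: "'x::topological_space \<Rightarrow> 'g::ab_group_add"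
  assumes X: "connected X" "x \<in> X" "y \<in> X"
    and locally: "\<And>z. z \<in> X \<Longrightarrow> \<forall>\<^sub>F w in at z within X. g w - h w = g z - h z"
  shows "g y - g x = h y - h x"
proof -
  have "g x - h x = g y - h y"
  proof (rule connected_local_const[where f = "\<lambda>z. g z - h z", OF X], intro ballI)
    fix z assume "z \<in> X"
    from locally[OF this] show "\<forall>\<^sub>F w in at z within X. g z - h z = g w - h w"
      by eventually_elim simp
  qed
  then show ?thesis by (simp add: algebra_simps)
qed

lemma glue_local_primitives:
  fixes g :: "'x::real_normed_vector \<Rightarrow> 'x \<Rightarrow> 'g::ab_group_add"
  assumes X: "compact X" "convex X" and r: "\<And>p. p \<in> X \<Longrightarrow> r p > 0"
    and local_const: "\<And>p q x. \<lbrakk>p \<in> X; q \<in> X; x \<in> X \<inter> ball p (r p) \<inter> ball q (r q)\<rbrakk> \<Longrightarrow>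
      \<forall>\<^sub>F y in at x within X. g p y - g q y = g p x - g q x"
  obtains f where "\<And>p x y. \<lbrakk>p \<in> X; x \<in> X \<inter> ball p (r p); y \<in> X \<inter> ball p (r p)\<rbrakk> \<Longrightarrow>
      f y - f x = g p y - g p x"
proof -
  have const: "g p y - g p x = g q y - g q x"
    if pq: "p \<in> X" "q \<in> X" and xy: "{x, y} \<subseteq> X \<inter> ball p (r p) \<inter> ball q (r q)" for p q x y
  proof (rule connected_increments_eq)
    show "connected (X \<inter> ball p (r p) \<inter> ball q (r q))"
      by (intro convex_connected convex_Int X(2) convex_ball)
    show "\<forall>\<^sub>F w in at z within X \<inter> ball p (r p) \<inter> ball q (r q). g p w - g q w = g p z - g q z"
      if z: "z \<in> X \<inter> ball p (r p) \<inter> ball q (r q)" for z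
      by (rule filter_leD[OF at_le local_const[OF pq z]]) auto
  qed (use xy in auto)
  obtain e c where e: "e > 0"
    and c: "\<And>x. x \<in> X \<Longrightarrow> c x \<in> X" "\<And>x. x \<in> X \<Longrightarrow> ball x e \<subseteq> ball (c x) (r (c x))"
    by (rule lebesgue_number_balls[OF X(1) r]) (assumption, rule that)
  have near: "{y, z} \<subseteq> ball (c x) (r (c x))" if "x \<in> X" "dist x y < e" "dist x z < e" for x y z
    using c(2)[OF that(1)] that(2,3) by auto
  define \<delta> where "\<delta> x y = g (c x) y - g (c x) x" for x y
  obtain f where f: "\<And>x y. \<lbrakk>x \<in> X; y \<in> X; dist x y < e / 2\<rbrakk> \<Longrightarrow> f y - f x = \<delta> x y"
  proof (rule local_cocycle_is_coboundary[OF X(2) compact_imp_bounded[OF X(1)] e, of \<delta>])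
    fix x y z assume xyz: "x \<in> X" "y \<in> X" "z \<in> X" "dist x y < e" "dist y z < e" "dist x z < e"
    have "\<delta> y z = g (c x) z - g (c x) y"
      unfolding \<delta>_def using near[of x y z] near[of y y z] xyz c(1) e by (intro const) auto
    then show "\<delta> x z = \<delta> x y + \<delta> y z" by (simp add: \<delta>_def)
  qed (rule that)
  show ?thesis
  proof (rule that)
    fix p x y assume p: "p \<in> X" and xy: "x \<in> X \<inter> ball p (r p)" "y \<in> X \<inter> ball p (r p)"
    have "connected (X \<inter> ball p (r p))" by (intro convex_connected convex_Int X(2) convex_ball)
    then show "f y - f x = g p y - g p x"
    proof (rule connected_increments_eq[OF _ xy])
      fix z assume z: "z \<in> X \<inter> ball p (r p)"
      have "f w - g p w = f z - g p z" if w: "w \<in> X \<inter> ball p (r p)" "dist z w < e / 2" for w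
      proof -
        have "f w - f z = g (c z) w - g (c z) z" using f[of z w] w z by (simp add: \<delta>_def)
        also have "\<dots> = g p w - g p z" using near[of z z w] w z p c(1) e by (intro const) auto
        finally show ?thesis by (simp add: algebra_simps)
      qed
      then show "\<forall>\<^sub>F w in at z within X \<inter> ball p (r p). f w - g p w = f z - g p z"
        unfolding eventually_at using e by (intro exI[of _ "e / 2"]) (auto simp: dist_commute)
    qed
  qed
qed

section \<open>Index functions\<close>

context symplectic_space
begin

definition chart_index :: "'a set \<Rightarrow> 'a set \<Rightarrow> 'a set \<Rightarrow> int" where
  "chart_index W l L = int (n_plus (chart_form W l) L)"

definition index_function :: "'a set \<Rightarrow> 'b::metric_space set \<Rightarrow> ('b \<Rightarrow> 'a set) \<Rightarrow> ('b \<Rightarrow> int) \<Rightarrow> bool"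
  where
  "index_function L X H f \<longleftrightarrow> (\<forall>p\<in>X. \<forall>W. transversal W (H p) \<longrightarrow>
     (\<forall>\<^sub>F q in at p within X. f q - f p = chart_index W (H q) L - chart_index W (H p) L))"

lemma index_functionD:
  "index_function L X H f \<Longrightarrow> p \<in> X \<Longrightarrow> transversal W (H p) \<Longrightarrow>
    \<forall>\<^sub>F q in at p within X. f q - f p = chart_index W (H q) L - chart_index W (H p) L"
  by (simp add: index_function_def)

lemma n_plus_moving_locally_constant:
  fixes H :: "'b::metric_space \<Rightarrow> 'a set" and A :: "'b \<Rightarrow> 'a \<Rightarrow>\<^sub>L 'a"
  assumes H: "subspaces_continuous_on X H" "\<And>q. q \<in> X \<Longrightarrow> lagrangian \<omega> (H q)"
    and A: "continuous_on X A" "\<And>q. q \<in> X \<Longrightarrow> symplectic_map \<omega> (A q)" and p: "p \<in> X"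
    and t: "transversal W (H p)" "transversal W (A p ` M)" "transversal (A p ` M) (H p)"
    and M: "lagrangian \<omega> M"
  shows "\<forall>\<^sub>F q in at p within X. n_plus (chart_form W (H q)) (A q ` M) =
      n_plus (chart_form W (H p)) (A p ` M)"
proof -
  let ?F = "at p within X" and ?r = "\<lambda>q x. chart_form W (H q) (A q x)"
  note sM = lagrangian_subspace[OF M]
  have pull: "n_plus (chart_form W (H q)) (A q ` M) = n_plus (?r q) M" if "q \<in> X" for q
    by (rule n_plus_image[OF sM linear_blinfun_apply symplectic_map_inj_on[OF A(2)[OF that]]])
      (simp add: quadform_zero[OF quadform_chart_form])
  have qr: "quadform (?r q)" for q
    by (rule quadform_comp_linear[OF quadform_chart_form linear_blinfun_apply])
  have "dim (form_radical (chart_form W (H p)) (A p ` M)) = 0"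
    using dim_form_radical_chart_form[OF t(1) transversal_lagrangian(2)[OF t(2)]] t(2,3)
    by (simp add: transversal_def Int_commute)
  then have "form_radical (chart_form W (H p)) (A p ` M) \<subseteq> {0}" by simp
  then have "x = 0" if "x \<in> form_radical (?r p) M" for x
    using form_radical_comp_blinfun[OF that] symplectic_map_bij[OF A(2)[OF p]]
    by (auto simp: bij_blinfun_iff)
  then have "dim (form_radical (?r p) M) = 0" by auto
  moreover have "(A \<longlongrightarrow> A p) ?F" using A(1) p by (simp add: continuous_on_def)
  then have "((\<lambda>q. ?r q x) \<longlongrightarrow> ?r p x) ?F" for x
    by (intro tendsto_chart_form transversal_gap_continuous(2)[OF H p t(1)] tendsto_intros)
  ultimately have "\<forall>\<^sub>F q in ?F. n_plus (?r q) M = n_plus (?r p) M"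
    by (intro n_plus_locally_constant[OF qr _ sM]) (simp_all add: qr del: dim_eq_0)
  moreover have "\<forall>\<^sub>F q in ?F. q \<in> X" by (simp add: eventually_at_filter)
  ultimately show ?thesis by eventually_elim (simp add: pull p)
qed

text \<open>Changing from the moving chart \<open>A q ` M\<close> to a fixed chart \<open>W\<close> adds a term that does not
  involve \<open>H\<close> and one that does not involve \<open>L\<close>; the latter is locally constant.\<close>

lemma chart_index_change_locally_constant:
  fixes H :: "'b::metric_space \<Rightarrow> 'a set" and A :: "'b \<Rightarrow> 'a \<Rightarrow>\<^sub>L 'a"
  assumes H: "subspaces_continuous_on X H" "\<And>q. q \<in> X \<Longrightarrow> lagrangian \<omega> (H q)"
    and A: "continuous_on X A" "\<And>q. q \<in> X \<Longrightarrow> symplectic_map \<omega> (A q)" and p: "p \<in> X"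
    and t: "transversal W L" "transversal W (H p)" "transversal W (A p ` M)"
      "transversal (A p ` M) (H p)"
    and near: "\<forall>\<^sub>F q in at p within X. transversal (A q ` M) (H q)" and M: "lagrangian \<omega> M"
  defines
    "D \<equiv> \<lambda>q. chart_index (A q ` M) (H q) L - chart_index W (H q) L - chart_index W L (A q ` M)"
  shows "\<forall>\<^sub>F q in at p within X. D q = D p"
proof -
  have D: "D q = - int (n_plus (chart_form W (H q)) (A q ` M))"
    if "transversal W (H q)" "transversal (A q ` M) (H q)" for q
    using chart_change[OF t(1) that] by (simp add: D_def chart_index_def)
  have "\<forall>\<^sub>F q in at p within X. transversal W (H q)"
    by (rule transversal_gap_continuous(1)[OF H p t(2)])
  moreover have "\<forall>\<^sub>F q in at p within X. n_plus (chart_form W (H q)) (A q ` M) =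
      n_plus (chart_form W (H p)) (A p ` M)"
    by (rule n_plus_moving_locally_constant[OF H A p t(2-4) M])
  ultimately show ?thesis using near by eventually_elim (simp add: D t)
qed

lemma chart_index_diff_locally_constant:
  fixes H :: "'b::metric_space \<Rightarrow> 'a set"
  assumes H: "subspaces_continuous_on X H" "\<And>q. q \<in> X \<Longrightarrow> lagrangian \<omega> (H q)"
    and L: "lagrangian \<omega> L" and p: "p \<in> X" and t: "transversal W1 (H p)" "transversal W2 (H p)"
  shows "\<forall>\<^sub>F q in at p within X. chart_index W1 (H q) L - chart_index W2 (H q) L =
     chart_index W1 (H p) L - chart_index W2 (H p) L"
proof -
  obtain W where W: "\<And>\<alpha>. \<alpha> \<in> {L, H p, W1, W2} \<Longrightarrow> transversal W \<alpha>"
    by (rule common_transversal[of "{L, H p, W1, W2}"])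
      (use L H(2)[OF p] transversal_lagrangian(1)[OF t(1)]
          transversal_lagrangian(1)[OF t(2)] in auto)
  have change: "\<forall>\<^sub>F q in at p within X.
      chart_index V (H q) L - chart_index W (H q) L - chart_index W L V
      = chart_index V (H p) L - chart_index W (H p) L - chart_index W L V"
    if "V \<in> {W1, W2}" for V
    using chart_index_change_locally_constant[where A = "\<lambda>_. id_blinfun"
          and M = V and W = W and L = L, OF H continuous_on_const _ p]
      W that t transversal_gap_continuous(1)[OF H p] transversal_lagrangian(1)
    by (auto simp: symplectic_mapI)
  have "W1 \<in> {W1, W2}" "W2 \<in> {W1, W2}" by auto
  from this[THEN change] show ?thesis by eventually_elim linarith
qed

theorem exists_index_function:
  fixes H :: "'b::euclidean_space \<Rightarrow> 'a set"
  assumes H: "subspaces_continuous_on X H" "\<And>p. p \<in> X \<Longrightarrow> lagrangian \<omega> (H p)"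
    and L: "lagrangian \<omega> L" and X: "compact X" "convex X"
  obtains f where "index_function L X H f"
proof -
  have "\<forall>p\<in>X. \<exists>W. transversal W (H p)" using exists_transversal H(2) by metis
  then obtain W where W: "\<And>p. p \<in> X \<Longrightarrow> transversal (W p) (H p)" by metis
  have "\<exists>d>0. \<forall>q\<in>X. dist q p < d \<longrightarrow> transversal (W p) (H q)" if p: "p \<in> X" for p
    using transversal_gap_continuous(1)[OF H p W[OF p]] W[OF p] unfolding eventually_at by metis
  then obtain r where r: "\<And>p. p \<in> X \<Longrightarrow> r p > 0"
    "\<And>p q. p \<in> X \<Longrightarrow> q \<in> X \<Longrightarrow> dist q p < r p \<Longrightarrow> transversal (W p) (H q)" by metis
  define g where "g p x = chart_index (W p) (H x) L" for p x
  obtain f where f: "\<And>p x y. p \<in> X \<Longrightarrow> x \<in> X \<inter> ball p (r p) \<Longrightarrow> y \<in> X \<inter> ball p (r p) \<Longrightarrow>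
      f y - f x = g p y - g p x"
  proof (rule glue_local_primitives[where g = g and r = r, OF X r(1)])
    show "\<forall>\<^sub>F y in at x within X. g p y - g q y = g p x - g q x"
      if "p \<in> X" "q \<in> X" "x \<in> X \<inter> ball p (r p) \<inter> ball q (r q)" for p q x
      unfolding g_def using that r(2)
      by (intro chart_index_diff_locally_constant[OF H L]) (auto simp: dist_commute)
  qed auto
  have "index_function L X H f" unfolding index_function_def
  proof (intro ballI allI impI)
    fix p V assume p: "p \<in> X" and V: "transversal V (H p)"
    have "\<forall>\<^sub>F q in at p within X. q \<in> X \<inter> ball p (r p)"
      using r(1)[OF p] by (auto simp: eventually_at dist_commute intro!: exI[of _ "r p"])
    moreover have "\<forall>\<^sub>F q in at p within X. chart_index V (H q) L - chart_index (W p) (H q) L =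
        chart_index V (H p) L - chart_index (W p) (H p) L"
      by (rule chart_index_diff_locally_constant[OF H L p V W[OF p]])
    ultimately show "\<forall>\<^sub>F q in at p within X. f q - f p =
        chart_index V (H q) L - chart_index V (H p) L"
    proof eventually_elim
      case (elim q)
      then show ?case using f[OF p _ elim(1), of p] p r(1)[OF p] by (simp add: g_def)
    qed
  qed
  then show ?thesis by (rule that)
qed

lemma index_function_compose:
  fixes \<gamma> :: "'c::metric_space \<Rightarrow> 'b::metric_space"
  assumes f: "index_function L X H f" and \<gamma>: "continuous_on S \<gamma>" "\<gamma> ` S \<subseteq> X"
  shows "index_function L S (H \<circ> \<gamma>) (f \<circ> \<gamma>)"
  unfolding index_function_def comp_def
proof (intro ballI allI impI)
  fix p W assume p: "p \<in> S" and W: "transversal W (H (\<gamma> p))"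
  have "\<forall>\<^sub>F q in nhds (\<gamma> p). q \<in> X \<longrightarrow>
      f q - f (\<gamma> p) = chart_index W (H q) L - chart_index W (H (\<gamma> p)) L"
  proof -
    have "\<gamma> p \<in> X" using \<gamma>(2) p by blast
    from index_functionD[OF f this W] show ?thesis
      unfolding eventually_at_filter by eventually_elim auto
  qed
  moreover have "(\<gamma> \<longlongrightarrow> \<gamma> p) (at p within S)" using \<gamma>(1) p by (simp add: continuous_on_def)
  ultimately have "\<forall>\<^sub>F q in at p within S. \<gamma> q \<in> X \<longrightarrow>
      f (\<gamma> q) - f (\<gamma> p) = chart_index W (H (\<gamma> q)) L - chart_index W (H (\<gamma> p)) L"
    by (rule eventually_compose_filterlim)
  moreover have "\<forall>\<^sub>F q in at p within S. \<gamma> q \<in> X"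
    using \<gamma>(2) unfolding eventually_at_filter by (intro always_eventually) auto
  ultimately show "\<forall>\<^sub>F q in at p within S.
      f (\<gamma> q) - f (\<gamma> p) = chart_index W (H (\<gamma> q)) L - chart_index W (H (\<gamma> p)) L"
    by eventually_elim blast
qed

lemma index_function_cong:
  "index_function L X H f \<Longrightarrow> (\<And>p. p \<in> X \<Longrightarrow> H' p = H p) \<Longrightarrow> index_function L X H' f"
  unfolding index_function_def eventually_at_filter by (auto elim!: eventually_mono)

lemma index_function_increment_unique:
  assumes f: "index_function L X H f" and g: "index_function L X H g"
    and H: "\<And>p. p \<in> X \<Longrightarrow> lagrangian \<omega> (H p)" and X: "connected X" "p \<in> X" "q \<in> X"
  shows "f q - f p = g q - g p"
proof (rule connected_increments_eq[OF X])
  fix z assume z: "z \<in> X"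
  obtain W where W: "transversal W (H z)" using exists_transversal[OF H[OF z]] by blast
  from index_functionD[OF f z W] index_functionD[OF g z W]
  show "\<forall>\<^sub>F w in at z within X. f w - g w = f z - g z" by eventually_elim simp
qed

lemma index_function_constant_path:
  assumes f: "index_function L X H f" and l: "lagrangian \<omega> l" "\<And>p. p \<in> X \<Longrightarrow> H p = l"
    and X: "connected X" "p \<in> X" "q \<in> X"
  shows "f q = f p"
proof -
  have "index_function L X (\<lambda>_. l) (\<lambda>_. 0)" by (simp add: index_function_def)
  from index_function_increment_unique[OF f index_function_cong[OF this l(2)] _ X] show ?thesis
    using l by simp
qed

theorem index_function_homotopic:
  assumes L: "lagrangian \<omega> L" and homotopic: "lag_homotopic \<omega> l m a b" and ab: "a \<le> b"
    and f: "index_function L {a..b} l f"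
  obtains g where "index_function L {a..b} m g" "g b - g a = f b - f a"
proof -
  obtain H :: "real \<times> real \<Rightarrow> 'a set" where
    lag: "\<forall>s\<in>{0..1}. \<forall>t\<in>{a..b}. lagrangian \<omega> (H (s, t))"
    and cont: "subspaces_continuous_on ({0..1} \<times> {a..b}) H"
    and sides: "\<forall>t\<in>{a..b}. H (0, t) = l t \<and> H (1, t) = m t"
    and ends: "\<forall>s\<in>{0..1}. H (s, a) = l a \<and> H (s, b) = l b"
    using homotopic unfolding lag_homotopic_def by blast
  obtain F where F: "index_function L ({0..1} \<times> {a..b}) H F"
    by (rule exists_index_function[OF cont _ L])
      (use lag in \<open>auto intro: compact_Times convex_Times\<close>)
  have lag_lm: "lagrangian \<omega> (l t)" "lagrangian \<omega> (m t)" if "t \<in> {a..b}" for t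
    using lag sides that by (metis atLeastAtMost_iff order_refl zero_le_one)+
  have horizontal: "index_function L {a..b} (\<lambda>t. H (s, t)) (\<lambda>t. F (s, t))" if "s \<in> {0..1}" for s
    using index_function_compose[OF F, of "{a..b}" "Pair s"] that
    by (simp add: comp_def image_subset_iff continuous_intros)
  have vertical: "F (1, t) = F (0, t)" if t: "t \<in> {a, b}" for t
  proof -
    have "index_function L {0..1} (\<lambda>s. H (s, t)) (\<lambda>s. F (s, t))"
      using index_function_compose[OF F, of "{0..1}" "\<lambda>s. (s, t)"] t ab
      by (auto simp: comp_def image_subset_iff continuous_intros)
    moreover have "t \<in> {a..b}" using t ab by auto
    then have "lagrangian \<omega> (l t)" by (rule lag_lm(1))
    moreover have "H (s, t) = l t" if "s \<in> {0..1}" for s using t ends that by auto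
    ultimately show ?thesis by (rule index_function_constant_path) auto
  qed
  have "F (0, b) - F (0, a) = f b - f a"
    using horizontal[of 0] f sides lag_lm(1) ab
    by (intro index_function_increment_unique) (auto intro: index_function_cong)
  moreover have "index_function L {a..b} m (\<lambda>t. F (1, t))"
    using horizontal[of 1] sides by (auto intro: index_function_cong)
  ultimately show ?thesis using vertical that[of "\<lambda>t. F (1, t)"] by simp
qed

end

section \<open>The crossing formula\<close>

definition jump_sum ::
  "(real \<Rightarrow> bool) \<Rightarrow> (real \<Rightarrow> 'g) \<Rightarrow> (real \<Rightarrow> 'g) \<Rightarrow> real \<Rightarrow> real \<Rightarrow> 'g::ab_group_add"
  where
  "jump_sum C p m x y = p x + (\<Sum>t\<in>{t\<in>{x<..<y}. C t}. p t - m t) - m y"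

lemma jump_sum_join:
  assumes xyz: "x < y" "y < z" and no_jump: "\<not> C y \<Longrightarrow> p y = 0 \<and> m y = 0"
    and fin: "finite {t\<in>{x<..<y}. C t}" "finite {t\<in>{y<..<z}. C t}"
  shows "finite {t\<in>{x<..<z}. C t}" "jump_sum C p m x z = jump_sum C p m x y + jump_sum C p m y z"
proof -
  have split: "{t\<in>{x<..<z}. C t} = {t\<in>{x<..<y}. C t} \<union> ({t\<in>{y}. C t} \<union> {t\<in>{y<..<z}. C t})"
    using xyz by auto
  then show "finite {t\<in>{x<..<z}. C t}" using fin by simp
  have "(\<Sum>t\<in>{t\<in>{y}. C t}. p t - m t) = p y - m y"
    using no_jump by (cases "C y") (simp_all add: Collect_conv_if)
  moreover have "(\<Sum>t\<in>{t\<in>{x<..<z}. C t}. p t - m t) = (\<Sum>t\<in>{t\<in>{x<..<y}. C t}. p t - m t) +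
      ((\<Sum>t\<in>{t\<in>{y}. C t}. p t - m t) + (\<Sum>t\<in>{t\<in>{y<..<z}. C t}. p t - m t))"
    unfolding split using fin by (subst sum.union_disjoint, simp, simp, force)+ simp
  ultimately show "jump_sum C p m x z = jump_sum C p m x y + jump_sum C p m y z"
    by (simp add: jump_sum_def)
qed

lemma jump_sum_single:
  assumes uv: "u \<le> x" "x \<le> v" "u < v"
    and no_jump: "\<And>t. t \<in> {u..v} \<Longrightarrow> \<not> C t \<Longrightarrow> p t = 0 \<and> m t = 0"
    and near: "\<And>s. s \<in> {u..v} \<Longrightarrow> s \<noteq> x \<Longrightarrow>
        \<not> C s \<and> (x < s \<longrightarrow> f s = f x + p x) \<and> (s < x \<longrightarrow> f s = f x + m x)"
  shows "finite {t\<in>{u<..<v}. C t}" "jump_sum C p m u v = f v - f u"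
proof -
  have "t = x" if "t \<in> {u<..<v}" "C t" for t using near[of t] that by (cases "t = x") auto
  then have C: "{t\<in>{u<..<v}. C t} = (if u < x \<and> x < v \<and> C x then {x} else {})" by auto
  then show "finite {t\<in>{u<..<v}. C t}" by simp
  consider "u = x" | "v = x" | "u < x" "x < v" using uv by linarith
  then show "jump_sum C p m u v = f v - f u"
  proof cases
    case 1
    then show ?thesis unfolding jump_sum_def C using near[of v] no_jump[of v] uv by simp
  next
    case 2
    then show ?thesis unfolding jump_sum_def C using near[of u] no_jump[of u] uv by simp
  next
    case 3
    then show ?thesis
      unfolding jump_sum_def C
      using near[of u] near[of v] no_jump[of u] no_jump[of v] no_jump[of x] by simp
  qed
qed

lemma jump_sum_eq_increment:
  assumes ab: "a < b"
    and jumps: "\<And>t. t \<in> {a..b} \<Longrightarrow> \<forall>\<^sub>F s in at t within {a..b}.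
        \<not> C s \<and> (t < s \<longrightarrow> f s = f t + p t) \<and> (s < t \<longrightarrow> f s = f t + m t)"
    and no_jump: "\<And>t. t \<in> {a..b} \<Longrightarrow> \<not> C t \<Longrightarrow> p t = 0 \<and> m t = 0"
  shows "jump_sum C p m a b = f b - f a"
proof -
  let ?P = "\<lambda>x y. a \<le> x \<longrightarrow> x < y \<longrightarrow> y \<le> b \<longrightarrow>
      finite {t\<in>{x<..<y}. C t} \<and> jump_sum C p m x y = f y - f x"
  from less_imp_le[OF ab] have "?P a b"
  proof (rule Bolzano[where P = ?P])
    fix x y z assume trans: "?P x y" "?P y z" "x \<le> y" "y \<le> z"
    show "?P x z"
    proof (cases "x = y \<or> y = z")
      case True
      then show ?thesis using trans(1,2) by blast
    next
      case False
      then have "x < y" "y < z" using trans(3,4) by auto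
      then show ?thesis using trans(1,2) jump_sum_join[of x y z C p m] no_jump[of y] by simp
    qed
  next
    fix x assume "a \<le> x" "x \<le> b"
    then have x: "x \<in> {a..b}" by simp
    obtain d where d: "d > 0" "\<And>s. \<lbrakk>s \<in> {a..b}; s \<noteq> x; dist s x < d\<rbrakk> \<Longrightarrow>
        \<not> C s \<and> (x < s \<longrightarrow> f s = f x + p x) \<and> (s < x \<longrightarrow> f s = f x + m x)"
      using jumps[OF x] unfolding eventually_at by blast
    have "?P u v" if uv: "u \<le> x \<and> x \<le> v \<and> v - u < d" for u v
    proof (intro impI)
      assume bounds: "a \<le> u" "u < v" "v \<le> b"
      have "\<not> C s \<and> (x < s \<longrightarrow> f s = f x + p x) \<and> (s < x \<longrightarrow> f s = f x + m x)"
        if "s \<in> {u..v}" "s \<noteq> x" for s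
        using that uv bounds by (intro d(2)) (auto simp: dist_real_def)
      then show "finite {t\<in>{u<..<v}. C t} \<and> jump_sum C p m u v = f v - f u"
        using jump_sum_single[of u x v C p m f] no_jump uv bounds by simp
    qed
    then show "\<exists>d>0. \<forall>u v. u \<le> x \<and> x \<le> v \<and> v - u < d \<longrightarrow> ?P u v" using d(1) by blast
  qed
  then show ?thesis using ab by simp
qed

context symplectic_space
begin

lemma index_function_jump:
  assumes L: "lagrangian \<omega> L" and ab: "a < b" and l: "lag_C1 \<omega> l a b"
    and regular: "regular_crossings \<omega> L l a b" and f: "index_function L {a..b} l f"
    and t: "t \<in> {a..b}"
  defines "\<Gamma> \<equiv> crossing_form \<omega> l a b t"
  shows "quadform \<Gamma>"
    and "\<forall>\<^sub>F s in at t within {a..b}. \<not> is_crossing L l s \<and>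
      (t < s \<longrightarrow> f s = f t + int (n_plus \<Gamma> (l t \<inter> L))) \<and>
      (s < t \<longrightarrow> f s = f t + int (n_minus \<Gamma> (l t \<inter> L)))"
proof -
  obtain W where W: "transversal W (l t)" "\<forall>\<^sub>F s in at t within {a..b}. transversal W (l s)"
    and \<Gamma>: "quadform \<Gamma>"
    and deriv: "\<And>v. ((\<lambda>s. chart_form W (l s) v) has_vector_derivative \<Gamma> v) (at t within {a..b})"
    by (rule lag_C1_crossing_form[OF l ab t, folded \<Gamma>_def]) (rule that)
  show "quadform \<Gamma>" by (rule \<Gamma>)
  have "qf_nondegenerate \<Gamma> (l t \<inter> L)"
  proof (cases "is_crossing L l t")
    case True
    then show ?thesis using regular t by (simp add: regular_crossings_def \<Gamma>_def)
  qed (auto simp: is_crossing_def qf_nondegenerate_def)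
  then have "\<forall>\<^sub>F s in at t within {a..b}. l s \<inter> L = {0} \<and>
     (t < s \<longrightarrow> n_plus (chart_form W (l s)) L = n_plus (chart_form W (l t)) L + n_plus \<Gamma> (l t \<inter> L)) \<and>
     (s < t \<longrightarrow> n_plus (chart_form W (l s)) L = n_plus (chart_form W (l t)) L + n_minus \<Gamma> (l t \<inter> L))"
    by (rule crossing_jump[OF W(1) L \<Gamma> W(2) deriv])
  with index_functionD[OF f t W(1)]
  show "\<forall>\<^sub>F s in at t within {a..b}. \<not> is_crossing L l s \<and>
      (t < s \<longrightarrow> f s = f t + int (n_plus \<Gamma> (l t \<inter> L))) \<and>
      (s < t \<longrightarrow> f s = f t + int (n_minus \<Gamma> (l t \<inter> L)))"
  proof eventually_elim
    case (elim s)
    note increment = elim(1)[unfolded chart_index_def] and jump = elim(2)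
    show ?case
    proof (intro conjI impI)
      show "\<not> is_crossing L l s" using jump by (simp add: is_crossing_def)
      show "f s = f t + int (n_plus \<Gamma> (l t \<inter> L))" if "t < s" using jump that increment by linarith
      show "f s = f t + int (n_minus \<Gamma> (l t \<inter> L))" if "s < t" using jump that increment by linarith
    qed
  qed
qed

theorem crossing_sum_eq_index:
  assumes L: "lagrangian \<omega> L" and ab: "a < b" and l: "lag_C1 \<omega> l a b"
    and regular: "regular_crossings \<omega> L l a b" and f: "index_function L {a..b} l f"
  shows "crossing_sum \<omega> L l a b = f b - f a"
proof -
  let ?\<Gamma> = "crossing_form \<omega> l a b"
  let ?p = "\<lambda>t. int (n_plus (?\<Gamma> t) (l t \<inter> L))" and ?m = "\<lambda>t. int (n_minus (?\<Gamma> t) (l t \<inter> L))"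
  note jump = index_function_jump[OF L ab l regular f]
  have no_jump: "?p t = 0 \<and> ?m t = 0" if t: "t \<in> {a..b}" "\<not> is_crossing L l t" for t
  proof -
    have "n_plus q {0} = 0" if "q 0 = 0" for q :: "'a \<Rightarrow> real"
      using that by (intro n_plus_eq_0) simp_all
    then show ?thesis
      using t(2) quadform_zero[OF jump(1)[OF t(1)]] by (simp add: is_crossing_def n_minus_eq_n_plus)
  qed
  have "jump_sum (is_crossing L l) ?p ?m a b = f b - f a"
    by (rule jump_sum_eq_increment[OF ab jump(2) no_jump])
  then show ?thesis by (simp add: crossing_sum_def jump_sum_def qf_signature_def)
qed

theorem iota_CLM_eq_index:
  assumes L: "lagrangian \<omega> L" and ab: "a < b" and f: "index_function L {a..b} l f"
    and m: "lag_C1 \<omega> m a b" "regular_crossings \<omega> L m a b" "lag_homotopic \<omega> l m a b"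
  shows "iota_CLM \<omega> L l a b = f b - f a"
  unfolding iota_CLM_def
proof (rule the_equality)
  have sum_eq: "crossing_sum \<omega> L m' a b = f b - f a"
    if m': "lag_C1 \<omega> m' a b" "regular_crossings \<omega> L m' a b" "lag_homotopic \<omega> l m' a b" for m'
  proof -
    obtain g where g: "index_function L {a..b} m' g" "g b - g a = f b - f a"
      using index_function_homotopic[OF L m'(3) less_imp_le[OF ab] f] by blast
    then show ?thesis using crossing_sum_eq_index[OF L ab m'(1,2) g(1)] by simp
  qed
  show "\<exists>m. lag_C1 \<omega> m a b \<and> regular_crossings \<omega> L m a b \<and> lag_homotopic \<omega> l m a b \<and>
      f b - f a = crossing_sum \<omega> L m a b"
    using sum_eq[OF m] m by metis
  fix k assume "\<exists>m. lag_C1 \<omega> m a b \<and> regular_crossings \<omega> L m a b \<and> lag_homotopic \<omega> l m a b \<and>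
      k = crossing_sum \<omega> L m a b"
  then show "k = f b - f a" using sum_eq by auto
qed

lemma plus_curve_crossing_sum_nonneg:
  assumes plus: "plus_curve \<omega> L l a b" and ab: "a < b" and L: "lagrangian \<omega> L"
  shows "regular_crossings \<omega> L l a b" and "0 \<le> crossing_sum \<omega> L l a b"
proof -
  let ?\<Gamma> = "crossing_form \<omega> l a b"
  have l: "lag_C1 \<omega> l a b" using plus by (simp add: plus_curve_def)
  have \<Gamma>: "quadform (?\<Gamma> t)" if "t \<in> {a..b}" for t
    by (rule lag_C1_crossing_form[OF l ab that])
  have pos: "?\<Gamma> t v > 0" if "t \<in> {a..b}" "v \<in> l t \<inter> L" "v \<noteq> 0" for t v
    using plus that unfolding plus_curve_def is_crossing_def by blast
  show "regular_crossings \<omega> L l a b"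
    unfolding regular_crossings_def
    using pos by (intro ballI impI anisotropic_imp_nondegenerate \<Gamma>) (auto simp: less_le)
  have "n_minus (?\<Gamma> t) (l t \<inter> L) = 0" if t: "t \<in> {a..b}" for t
    unfolding n_minus_eq_n_plus
  proof (rule n_plus_eq_0)
    show "subspace (l t \<inter> L)"
      using l t L unfolding lag_C1_def by (blast intro: subspace_inter lagrangian_subspace)
    show "- ?\<Gamma> t v \<le> 0" if "v \<in> l t \<inter> L" for v
      using pos[OF t that] quadform_zero[OF \<Gamma>[OF t]] by (cases "v = 0") auto
  qed
  then show "0 \<le> crossing_sum \<omega> L l a b"
    using ab by (auto simp: crossing_sum_def qf_signature_def intro!: add_nonneg_nonneg sum_nonneg)
qed

end

section \<open>Regular representatives\<close>

definition smooth_abs :: "real \<Rightarrow> real \<Rightarrow> real" where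
  "smooth_abs \<delta> x = sqrt (x\<^sup>2 + \<delta>\<^sup>2)"

lemma smooth_abs_bounds:
  assumes "\<delta> > 0"
  shows "\<bar>x\<bar> \<le> smooth_abs \<delta> x" "\<delta> \<le> smooth_abs \<delta> x" "smooth_abs \<delta> x \<le> \<bar>x\<bar> + \<delta>"
  using assms sqrt_sum_squares_le_sum_abs[of x \<delta>] by (auto simp: smooth_abs_def real_le_rsqrt)

lemma smooth_abs_has_derivative:
  assumes "\<delta> > 0"
  shows "(smooth_abs \<delta> has_real_derivative x / smooth_abs \<delta> x) (at x)"
proof -
  have "x\<^sup>2 + \<delta>\<^sup>2 > 0" using assms by (simp add: add_nonneg_pos)
  then show ?thesis
    unfolding smooth_abs_def by (auto intro!: derivative_eq_intros simp: field_simps)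
qed

definition tent :: "real \<Rightarrow> real \<Rightarrow> real \<Rightarrow> real \<Rightarrow> real" where
  "tent \<delta> c r x = c * (smooth_abs \<delta> r - smooth_abs \<delta> x)"

definition tent_deriv :: "real \<Rightarrow> real \<Rightarrow> real \<Rightarrow> real" where
  "tent_deriv \<delta> c x = - c * (x / smooth_abs \<delta> x)"

lemma tent_ends: "tent \<delta> c r (- r) = 0" "tent \<delta> c r r = 0"
  by (simp_all add: tent_def smooth_abs_def)

lemma tent_range:
  assumes c: "c > 0" and \<delta>: "\<delta> > 0" and x: "\<bar>x\<bar> \<le> r"
  shows "tent \<delta> c r x \<in> {0..c * r}"
proof -
  have "smooth_abs \<delta> x \<le> smooth_abs \<delta> r"
    using x by (simp add: smooth_abs_def abs_le_square_iff[symmetric])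
  moreover have "smooth_abs \<delta> r - smooth_abs \<delta> x \<le> r"
    using smooth_abs_bounds(3)[OF \<delta>, of r] smooth_abs_bounds(2)[OF \<delta>, of x] x by linarith
  ultimately show ?thesis using c by (simp add: tent_def)
qed

lemma tent_has_derivative:
  assumes "\<delta> > 0"
  shows "(tent \<delta> c r has_real_derivative tent_deriv \<delta> c x) (at x)"
proof -
  have "(tent \<delta> c r has_real_derivative c * (0 - x / smooth_abs \<delta> x)) (at x)"
    unfolding tent_def[abs_def]
    by (intro DERIV_cmult DERIV_diff DERIV_const smooth_abs_has_derivative[OF assms])
  then show ?thesis by (simp add: tent_deriv_def)
qed

lemma continuous_on_tent_deriv: "\<delta> > 0 \<Longrightarrow> continuous_on S (tent_deriv \<delta> c)"
  unfolding tent_deriv_def[abs_def] smooth_abs_def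
  by (intro continuous_intros) (auto simp: add_nonneg_eq_0_iff)

lemma tent_deriv_steep:
  assumes c: "c > 0" and \<delta>: "\<delta> > 0" and x: "\<delta> \<le> \<bar>x\<bar>"
  shows "c / 2 \<le> \<bar>tent_deriv \<delta> c x\<bar>"
proof -
  have pos: "smooth_abs \<delta> x > 0" using smooth_abs_bounds(2)[OF \<delta>, of x] \<delta> by linarith
  have "smooth_abs \<delta> x \<le> 2 * \<bar>x\<bar>" using smooth_abs_bounds(3)[OF \<delta>, of x] x by simp
  then have "1 / 2 \<le> \<bar>x\<bar> / smooth_abs \<delta> x" using pos by (simp add: field_simps)
  then have "c * (1 / 2) \<le> c * (\<bar>x\<bar> / smooth_abs \<delta> x)" using c by (intro mult_left_mono) auto
  then show ?thesis using c pos by (simp add: tent_deriv_def abs_mult)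
qed

lemma tent_near_top:
  assumes c: "c > 0" and \<delta>: "\<delta> > 0" and r: "r > 0" and x: "\<bar>x\<bar> \<le> \<delta>"
  shows "\<bar>tent \<delta> c r x - c * r\<bar> \<le> 3 * c * \<delta>"
proof -
  note s = smooth_abs_bounds[OF \<delta>]
  have "\<bar>smooth_abs \<delta> r - smooth_abs \<delta> x - r\<bar> \<le> 3 * \<delta>"
    using s(1,3)[of r] s(2,3)[of x] x r \<delta> by linarith
  then have "c * \<bar>smooth_abs \<delta> r - smooth_abs \<delta> x - r\<bar> \<le> c * (3 * \<delta>)"
    using c by (intro mult_left_mono) auto
  moreover have "tent \<delta> c r x - c * r = c * (smooth_abs \<delta> r - smooth_abs \<delta> x - r)"
    by (simp add: tent_def algebra_simps)
  ultimately show ?thesis using c by (simp add: abs_mult mult_ac)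
qed

context symplectic_space
begin

lemma lag_homotopic_symplectic:
  fixes A :: "real \<times> real \<Rightarrow> 'a \<Rightarrow>\<^sub>L 'a"
  assumes M: "lagrangian \<omega> M" and A: "continuous_on ({0..1} \<times> {a..b}) A"
    and symp: "\<And>s t. t \<in> {a..b} \<Longrightarrow> symplectic_map \<omega> (A (s, t))"
    and ends: "\<And>s. A (s, a) = A (0, a)" "\<And>s. A (s, b) = A (0, b)"
  shows "lag_homotopic \<omega> (\<lambda>t. A (0, t) ` M) (\<lambda>t. A (1, t) ` M) a b"
  unfolding lag_homotopic_def
proof (intro exI[of _ "\<lambda>p. A p ` M"] conjI ballI)
  show "subspaces_continuous_on ({0..1} \<times> {a..b}) (\<lambda>p. A p ` M)"
    using symp by (intro subspaces_continuous_on_image A lagrangian_subspace M)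
      (auto intro: symplectic_map_bij)
  show "lagrangian \<omega> (A (s, t) ` M)" if "t \<in> {a..b}" for s t
    by (rule lagrangian_image[OF symp[OF that] M])
  show "A (s, a) ` M = A (0, a) ` M" "A (s, b) ` M = A (0, b) ` M" for s
    using ends[of s] by simp_all
qed simp_all

lemma symplectic_velocity_bound:
  fixes \<psi> \<psi>' :: "real \<Rightarrow> 'a \<Rightarrow>\<^sub>L 'a"
  assumes S: "compact S" and cont: "continuous_on S \<psi>" "continuous_on S \<psi>'"
    and bij: "\<And>t. t \<in> S \<Longrightarrow> bij (blinfun_apply (\<psi> t))"
  obtains K where "K > 0" "\<And>t u. t \<in> S \<Longrightarrow> \<bar>\<omega> (\<psi> t u) (\<psi>' t u)\<bar> \<le> K * (norm (\<psi> t u))\<^sup>2"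
proof -
  obtain D where D: "D > 0" "\<And>x y. norm (\<omega> x y) \<le> norm x * norm y * D"
    using bounded_bilinear.pos_bounded[OF bounded_bilinear_omega] by blast
  have "continuous_on S (\<lambda>t. blinfun_inv (\<psi> t))"
    using cont(1) bij unfolding continuous_on_def by (auto intro: tendsto_blinfun_inv)
  then have "continuous_on S (\<lambda>t. \<psi>' t o\<^sub>L blinfun_inv (\<psi> t))" by (intro continuous_intros cont)
  from compact_imp_bounded[OF compact_continuous_image[OF this S]]
  obtain B where B: "B > 0" "\<And>t. t \<in> S \<Longrightarrow> norm (\<psi>' t o\<^sub>L blinfun_inv (\<psi> t)) \<le> B"
    unfolding bounded_pos by auto
  show ?thesis
  proof (rule that)
    show "B * D > 0" using B D by simp
    fix t u assume t: "t \<in> S"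
    have "norm (\<psi>' t u) \<le> norm (\<psi>' t o\<^sub>L blinfun_inv (\<psi> t)) * norm (\<psi> t u)"
      using norm_blinfun[of "\<psi>' t o\<^sub>L blinfun_inv (\<psi> t)" "\<psi> t u"]
      by (simp add: blinfun_inv_left[OF bij[OF t]])
    also have "\<dots> \<le> B * norm (\<psi> t u)" using B(2)[OF t] by (intro mult_right_mono) auto
    finally have "norm (\<psi> t u) * norm (\<psi>' t u) * D \<le> norm (\<psi> t u) * (B * norm (\<psi> t u)) * D"
      using D(1) by (intro mult_right_mono mult_left_mono) auto
    then show "\<bar>\<omega> (\<psi> t u) (\<psi>' t u)\<bar> \<le> B * D * (norm (\<psi> t u))\<^sup>2"
      using D(2)[of "\<psi> t u" "\<psi>' t u"] by (simp add: power2_eq_square mult_ac)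
  qed
qed

lemma exists_rotation_off_cycle:
  assumes N: "N > 0" and L: "lagrangian \<omega> L" and M: "lagrangian \<omega> M"
  obtains h where "1/2 \<le> h" "h \<le> 1" "rotation N h ` M \<inter> L = {0}"
proof -
  have "\<omega> (rotation N (1/2) u) (rotation_deriv N (1/2) u) > 0" if "u \<noteq> 0" for u
  proof -
    have "0 < real N * rotation_rate * (norm u)\<^sup>2" using N rotation_rate_pos that by simp
    also have "\<dots> \<le> \<omega> (rotation N (1/2) u) (rotation_deriv N (1/2) u)"
      by (rule omega_rotation_deriv) auto
    finally show ?thesis .
  qed
  then have "\<forall>\<^sub>F s in at (1/2) within {1/2..1}. rotation N s ` M \<inter> L = {0}"
    by (intro positive_motion_leaves_cycle[OF _ _ L M symplectic_map_rotation
      rotation_has_derivative]) auto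
  moreover have "\<forall>\<^sub>F s in at (1/2) within {1/2..1::real}. s \<in> {1/2..1}"
    by (simp add: eventually_at_filter)
  ultimately have "\<forall>\<^sub>F s in at (1/2) within {1/2..1}. s \<in> {1/2..1} \<and> rotation N s ` M \<inter> L = {0}"
    by eventually_elim simp
  moreover have "at (1/2) within {1/2..1::real} \<noteq> bot" by (simp add: at_within_Icc_at_right)
  ultimately obtain h where "h \<in> {1/2..1}" "rotation N h ` M \<inter> L = {0}"
    using eventually_happens' by blast
  then show ?thesis by (intro that[of h]) auto
qed

lemma rotation_off_cycle_nearby:
  fixes \<psi> :: "real \<Rightarrow> 'a \<Rightarrow>\<^sub>L 'a"
  assumes L: "lagrangian \<omega> L" and M: "lagrangian \<omega> M" and t0: "t0 \<in> S"
    and cont: "continuous_on S \<psi>" and symp: "\<And>t. t \<in> S \<Longrightarrow> symplectic_map \<omega> (\<psi> t)"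
    and off: "(rotation N h o\<^sub>L \<psi> t0) ` M \<inter> L = {0}"
  obtains \<eta> where "\<eta> > 0"
    "\<And>s t. t \<in> S \<Longrightarrow> \<bar>s - h\<bar> + \<bar>t - t0\<bar> < \<eta> \<Longrightarrow> (rotation N s o\<^sub>L \<psi> t) ` M \<inter> L = {0}"
proof -
  let ?X = "(UNIV :: real set) \<times> S"
  let ?A = "\<lambda>p. rotation N (fst p) o\<^sub>L \<psi> (snd p)"
  have symp': "symplectic_map \<omega> (?A p)" if "p \<in> ?X" for p
    using that by (auto simp: symplectic_map_compose symplectic_map_rotation symp)
  have "continuous_on ?X ?A"
    by (intro continuous_intros continuous_on_compose2[OF continuous_on_rotation[of UNIV]]
        continuous_on_compose2[OF cont]) auto
  then have "subspaces_continuous_on ?X (\<lambda>p. ?A p ` M)"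
    by (intro subspaces_continuous_on_image symplectic_map_bij[OF symp'] lagrangian_subspace M)
  moreover have "transversal L (?A (h, t0) ` M)"
    using off L lagrangian_image[OF symp' M, of "(h, t0)"] t0
    by (auto simp: transversal_def Int_commute)
  ultimately have "\<forall>\<^sub>F p in at (h, t0) within ?X. transversal L (?A p ` M)"
    using transversal_gap_continuous(1)[of ?X "\<lambda>p. ?A p ` M"] lagrangian_image[OF symp' M] t0
    by simp
  then obtain \<eta> where \<eta>: "\<eta> > 0"
    "\<And>p. p \<in> ?X \<Longrightarrow> p \<noteq> (h, t0) \<Longrightarrow> dist p (h, t0) < \<eta> \<Longrightarrow> transversal L (?A p ` M)"
    unfolding eventually_at by blast
  show ?thesis
  proof (rule that[OF \<eta>(1)])
    fix s t assume t: "t \<in> S" and small: "\<bar>s - h\<bar> + \<bar>t - t0\<bar> < \<eta>"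
    have "dist (s, t) (h, t0) \<le> \<bar>s - h\<bar> + \<bar>t - t0\<bar>"
      unfolding dist_Pair_Pair dist_real_def
      using sqrt_sum_squares_le_sum_abs[of "\<bar>s - h\<bar>" "\<bar>t - t0\<bar>"] by simp
    then show "(rotation N s o\<^sub>L \<psi> t) ` M \<inter> L = {0}"
      using \<eta>(2)[of "(s, t)"] t small off
      by (cases "(s, t) = (h, t0)") (auto simp: transversal_def Int_commute)
  qed
qed

lemma exists_crossing_free_window:
  fixes \<psi> :: "real \<Rightarrow> 'a \<Rightarrow>\<^sub>L 'a"
  assumes N: "N > 0" and L: "lagrangian \<omega> L" and M: "lagrangian \<omega> M" and t0: "t0 \<in> S"
    and \<psi>: "continuous_on S \<psi>" and symp: "\<And>t. t \<in> S \<Longrightarrow> symplectic_map \<omega> (\<psi> t)"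
  obtains h \<eta> where "1/2 \<le> h" "h \<le> 1" "\<eta> > 0"
    "\<And>s t. t \<in> S \<Longrightarrow> \<bar>s - h\<bar> + \<bar>t - t0\<bar> < \<eta> \<Longrightarrow> (rotation N s o\<^sub>L \<psi> t) ` M \<inter> L = {0}"
proof -
  obtain h where h: "1/2 \<le> h" "h \<le> 1" "rotation N h ` (\<psi> t0 ` M) \<inter> L = {0}"
    using exists_rotation_off_cycle[OF N L lagrangian_image[OF symp[OF t0] M]] by blast
  then have off: "(rotation N h o\<^sub>L \<psi> t0) ` M \<inter> L = {0}" by (simp add: image_image)
  show ?thesis
    by (rule rotation_off_cycle_nearby[OF L M t0 \<psi> symp off]) (assumption, rule that[OF h(1,2)])
qed

definition rotated_path :: "nat \<Rightarrow> (real \<Rightarrow> real) \<Rightarrow> (real \<Rightarrow> 'a \<Rightarrow>\<^sub>L 'a) \<Rightarrow> real \<Rightarrow> 'a \<Rightarrow>\<^sub>L 'a" where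
  "rotated_path N \<phi> \<psi> t = rotation N (\<phi> t) o\<^sub>L \<psi> t"

lemma symplectic_map_rotated_path:
  "symplectic_map \<omega> (\<psi> t) \<Longrightarrow> symplectic_map \<omega> (rotated_path N \<phi> \<psi> t)"
  unfolding rotated_path_def by (intro symplectic_map_compose symplectic_map_rotation)

lemma rotated_path_has_derivative:
  assumes \<phi>: "(\<phi> has_vector_derivative \<phi>') (at t within S)"
    and \<psi>: "(\<psi> has_vector_derivative \<psi>') (at t within S)"
  shows "(rotated_path N \<phi> \<psi> has_vector_derivative
    (rotation N (\<phi> t) o\<^sub>L \<psi>') + ((\<phi>' *\<^sub>R rotation_deriv N (\<phi> t)) o\<^sub>L \<psi> t)) (at t within S)"
proof -
  have "((\<lambda>t. rotation N (\<phi> t)) has_vector_derivative \<phi>' *\<^sub>R rotation_deriv N (\<phi> t))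
      (at t within S)"
    using vector_diff_chain_within[OF \<phi> rotation_has_derivative] by (simp add: o_def)
  from has_vector_derivative_blinfun_compose[OF this \<psi>]
  show ?thesis by (simp add: rotated_path_def[abs_def])
qed

lemma rotated_path_homotopic:
  assumes M: "lagrangian \<omega> M"
    and \<psi>: "continuous_on {a..b} \<psi>" "\<And>t. t \<in> {a..b} \<Longrightarrow> symplectic_map \<omega> (\<psi> t)"
    and \<phi>: "continuous_on {a..b} \<phi>" "\<phi> a = 0" "\<phi> b = 0"
  shows "lag_homotopic \<omega> (\<lambda>t. \<psi> t ` M) (\<lambda>t. rotated_path N \<phi> \<psi> t ` M) a b"
proof -
  let ?A = "\<lambda>p. rotation N (fst p * \<phi> (snd p)) o\<^sub>L \<psi> (snd p)"
  have "continuous_on ({0..1} \<times> {a..b}) ?A"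
    by (intro continuous_intros continuous_on_compose2[OF continuous_on_rotation[of UNIV]]
        continuous_on_compose2[OF \<psi>(1)] continuous_on_compose2[OF \<phi>(1)]) auto
  then have "lag_homotopic \<omega> (\<lambda>t. ?A (0, t) ` M) (\<lambda>t. ?A (1, t) ` M) a b"
    using \<phi>(2,3) by (intro lag_homotopic_symplectic M)
      (simp_all add: symplectic_map_compose symplectic_map_rotation \<psi>(2))
  then show ?thesis by (simp add: rotation_at_0 rotated_path_def)
qed

lemma rotated_path_regular:
  fixes \<psi> \<psi>' :: "real \<Rightarrow> 'a \<Rightarrow>\<^sub>L 'a"
  assumes ab: "a < b" and M: "lagrangian \<omega> M"
    and \<psi>: "\<And>t. t \<in> {a..b} \<Longrightarrow> symplectic_map \<omega> (\<psi> t)"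
      "\<And>t. t \<in> {a..b} \<Longrightarrow> (\<psi> has_vector_derivative \<psi>' t) (at t within {a..b})"
    and \<phi>: "\<And>t. (\<phi> has_vector_derivative \<phi>' t) (at t within {a..b})"
    and fast: "\<And>t u. t \<in> {a..b} \<Longrightarrow> is_crossing L (\<lambda>t. rotated_path N \<phi> \<psi> t ` M) t \<Longrightarrow> \<psi> t u \<noteq> 0 \<Longrightarrow>
      \<bar>\<omega> (\<psi> t u) (\<psi>' t u)\<bar> < \<bar>\<phi>' t\<bar> * \<omega> (rotation N (\<phi> t) (\<psi> t u)) (rotation_deriv N (\<phi> t) (\<psi> t u))"
  shows "regular_crossings \<omega> L (\<lambda>t. rotated_path N \<phi> \<psi> t ` M) a b"
  unfolding regular_crossings_def
proof (intro ballI impI)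
  let ?A = "rotated_path N \<phi> \<psi>" and ?l = "\<lambda>t. rotated_path N \<phi> \<psi> t ` M"
  fix t assume t: "t \<in> {a..b}" and crossing: "is_crossing L ?l t"
  let ?\<Gamma> = "crossing_form \<omega> ?l a b t"
  let ?A' = "(rotation N (\<phi> t) o\<^sub>L \<psi>' t) + ((\<phi>' t *\<^sub>R rotation_deriv N (\<phi> t)) o\<^sub>L \<psi> t)"
  have \<Gamma>: "quadform ?\<Gamma>" and val: "\<And>u. u \<in> M \<Longrightarrow> ?\<Gamma> (?A t u) = \<omega> (?A t u) (?A' u)"
    by (rule symplectic_path_crossing_form[OF ab t M symplectic_map_rotated_path[OF \<psi>(1)]
          rotated_path_has_derivative[OF \<phi> \<psi>(2)[OF t]]]; blast)+
  show "qf_nondegenerate ?\<Gamma> (?l t \<inter> L)"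
  proof (rule anisotropic_imp_nondegenerate[OF \<Gamma>])
    fix v assume v: "v \<in> ?l t \<inter> L" "v \<noteq> 0"
    then obtain u where u: "u \<in> M" "v = ?A t u" by blast
    then have "\<psi> t u \<noteq> 0" using v(2) by (auto simp: rotated_path_def blinfun.zero_right)
    note fast[OF t crossing this]
    moreover have "?\<Gamma> v = \<omega> (\<psi> t u) (\<psi>' t u)
        + \<phi>' t * \<omega> (rotation N (\<phi> t) (\<psi> t u)) (rotation_deriv N (\<phi> t) (\<psi> t u))"
      using val[OF u(1)]
      by (simp add: u(2) rotated_path_def blinfun.add_left blinfun.scaleR_left omega_simps
          symplectic_map_omega[OF symplectic_map_rotation])
    moreover have "x + p * y \<noteq> 0" if "\<bar>x\<bar> < \<bar>p\<bar> * y" for x p y :: real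
    proof
      assume "x + p * y = 0"
      then have "\<bar>x\<bar> = \<bar>p\<bar> * \<bar>y\<bar>" by (simp add: eq_neg_iff_add_eq_0[symmetric] abs_mult)
      moreover have "\<bar>p\<bar> * y \<le> \<bar>p\<bar> * \<bar>y\<bar>" by (intro mult_left_mono) auto
      ultimately show False using that by linarith
    qed
    ultimately show "?\<Gamma> v \<noteq> 0" by simp
  qed
qed

text \<open>The rotation is wound up and then down again, fast except near the turning point, which is
  placed off the Maslov cycle.\<close>

lemma exists_winding_function:
  fixes \<psi> :: "real \<Rightarrow> 'a \<Rightarrow>\<^sub>L 'a"
  assumes ab: "a < b" and L: "lagrangian \<omega> L" and M: "lagrangian \<omega> M"
    and symp: "\<And>t. t \<in> {a..b} \<Longrightarrow> symplectic_map \<omega> (\<psi> t)" and \<psi>: "continuous_on {a..b} \<psi>"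
    and K: "K > 0"
  obtains N \<phi> \<phi>' where "\<phi> a = 0" "\<phi> b = 0" "\<And>t. t \<in> {a..b} \<Longrightarrow> \<phi> t \<in> {0..1}"
    "\<And>t S. (\<phi> has_vector_derivative \<phi>' t) (at t within S)" "\<And>S. continuous_on S \<phi>'"
    "\<And>t. t \<in> {a..b} \<Longrightarrow> is_crossing L (\<lambda>t. rotated_path N \<phi> \<psi> t ` M) t \<Longrightarrow>
        K < \<bar>\<phi>' t\<bar> * (real N * rotation_rate)"
proof -
  define r mid where "r = (b - a) / 2" and "mid = (a + b) / 2"
  have r: "r > 0" and mid: "mid \<in> {a..b}" and ends: "a - mid = - r" "b - mid = r"
    using ab by (auto simp: r_def mid_def field_simps)
  obtain N :: nat where "4 * r * K / rotation_rate < real N" using reals_Archimedean2 by blast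
  then have N: "K < 1 / (4 * r) * (real N * rotation_rate)"
    using r rotation_rate_pos by (simp add: field_simps)
  then have "N > 0" using K by (cases N) auto
  then obtain h \<eta> where h: "1/2 \<le> h" "h \<le> 1" and \<eta>: "\<eta> > 0"
    "\<And>s t. t \<in> {a..b} \<Longrightarrow> \<bar>s - h\<bar> + \<bar>t - mid\<bar> < \<eta> \<Longrightarrow> (rotation N s o\<^sub>L \<psi> t) ` M \<inter> L = {0}"
    by (rule exists_crossing_free_window[OF _ L M mid \<psi> symp]) (assumption, rule that)
  define c where "c = h / r"
  have c: "c > 0" "c * r = h" "1 / (4 * r) \<le> c / 2" using h r by (auto simp: c_def field_simps)
  define \<delta> where "\<delta> = \<eta> / (2 * (3 * c + 1))"
  have "(3 * c + 1) * \<delta> = \<eta> / 2" using c(1) by (simp add: \<delta>_def field_simps)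
  then have "3 * c * \<delta> + \<delta> = \<eta> / 2" by (simp add: distrib_right)
  moreover have "\<delta> > 0" using \<eta>(1) c(1) by (simp add: \<delta>_def)
  ultimately have \<delta>: "\<delta> > 0" "3 * c * \<delta> + \<delta> < \<eta>" using \<eta>(1) by simp_all
  let ?\<phi> = "\<lambda>t. tent \<delta> c r (t - mid)" and ?\<phi>' = "\<lambda>t. tent_deriv \<delta> c (t - mid)"
  show ?thesis
  proof (rule that)
    show "?\<phi> a = 0" "?\<phi> b = 0" by (simp_all add: ends tent_ends)
    show "?\<phi> t \<in> {0..1}" if "t \<in> {a..b}" for t
      using tent_range[OF c(1) \<delta>(1), of "t - mid" r] that h(2) ends by (simp add: c(2) abs_le_iff)
    show "(?\<phi> has_vector_derivative ?\<phi>' t) (at t within S)" for t S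
      unfolding has_real_derivative_iff_has_vector_derivative[symmetric]
      using DERIV_chain2[OF tent_has_derivative[OF \<delta>(1)] DERIV_diff[OF DERIV_ident DERIV_const],
        of c r mid t S]
      by simp
    show "continuous_on S ?\<phi>'" for S
      by (intro continuous_on_compose2[OF continuous_on_tent_deriv[OF \<delta>(1), of UNIV]]
        continuous_intros) auto
    fix t assume t: "t \<in> {a..b}" and crossing: "is_crossing L (\<lambda>t. rotated_path N ?\<phi> \<psi> t ` M) t"
    have "\<not> \<bar>t - mid\<bar> \<le> \<delta>"
      using tent_near_top[OF c(1) \<delta>(1) r, of "t - mid"] \<delta>(2) \<eta>(2)[OF t, of "?\<phi> t"] crossing
      by (auto simp: is_crossing_def rotated_path_def c(2))
    then have "1 / (4 * r) \<le> \<bar>?\<phi>' t\<bar>"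
      using tent_deriv_steep[OF c(1) \<delta>(1), of "t - mid"] c(3) by simp
    then have "1 / (4 * r) * (real N * rotation_rate) \<le> \<bar>?\<phi>' t\<bar> * (real N * rotation_rate)"
      using rotation_rate_pos by (intro mult_right_mono) auto
    with N show "K < \<bar>?\<phi>' t\<bar> * (real N * rotation_rate)" by (rule less_le_trans)
  qed
qed

theorem exists_regular_representative:
  fixes \<psi> :: "real \<Rightarrow> 'a \<Rightarrow>\<^sub>L 'a"
  assumes ab: "a < b" and L: "lagrangian \<omega> L" and M: "lagrangian \<omega> M"
    and symp: "\<And>t. t \<in> {a..b} \<Longrightarrow> symplectic_map \<omega> (\<psi> t)" and C1: "C1_on {a..b} \<psi>"
  obtains m where "lag_C1 \<omega> m a b" "regular_crossings \<omega> L m a b"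
    "lag_homotopic \<omega> (\<lambda>t. \<psi> t ` M) m a b"
proof -
  obtain \<psi>' where \<psi>': "\<And>t. t \<in> {a..b} \<Longrightarrow> (\<psi> has_vector_derivative \<psi>' t) (at t within {a..b})"
    and cont_\<psi>': "continuous_on {a..b} \<psi>'" using C1 unfolding C1_on_def by blast
  have cont_\<psi>: "continuous_on {a..b} \<psi>" by (rule continuous_on_vector_derivative[OF \<psi>'])
  obtain K where K: "K > 0" "\<And>t u. t \<in> {a..b} \<Longrightarrow> \<bar>\<omega> (\<psi> t u) (\<psi>' t u)\<bar> \<le> K * (norm (\<psi> t u))\<^sup>2"
    by (rule symplectic_velocity_bound[OF compact_Icc cont_\<psi> cont_\<psi>' symplectic_map_bij[OF symp]])
      blast+
  obtain N \<phi> \<phi>' where \<phi>_ends: "\<phi> a = 0" "\<phi> b = 0" and \<phi>_range: "\<And>t. t \<in> {a..b} \<Longrightarrow> \<phi> t \<in> {0..1}"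
    and \<phi>': "\<And>t S. (\<phi> has_vector_derivative \<phi>' t) (at t within S)" "\<And>S. continuous_on S \<phi>'"
    and fast: "\<And>t. t \<in> {a..b} \<Longrightarrow> is_crossing L (\<lambda>t. rotated_path N \<phi> \<psi> t ` M) t \<Longrightarrow>
      K < \<bar>\<phi>' t\<bar> * (real N * rotation_rate)"
    by (rule exists_winding_function[OF ab L M symp cont_\<psi> K(1)]) (assumption, rule that)
  have cont_\<phi>: "continuous_on S \<phi>" for S by (rule continuous_on_vector_derivative[OF \<phi>'(1)])
  let ?A = "rotated_path N \<phi> \<psi>"
  have "continuous_on {a..b} (\<lambda>t.
      (rotation N (\<phi> t) o\<^sub>L \<psi>' t) + ((\<phi>' t *\<^sub>R rotation_deriv N (\<phi> t)) o\<^sub>L \<psi> t))"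
    by (intro continuous_intros \<phi>'(2) cont_\<psi>' cont_\<psi>
      continuous_on_compose2[OF continuous_on_rotation[of UNIV] cont_\<phi>]
        continuous_on_compose2[OF continuous_on_rotation_deriv[of UNIV] cont_\<phi>]) auto
  with rotated_path_has_derivative[OF \<phi>'(1) \<psi>'] have "C1_on {a..b} ?A" by (rule C1_onI)
  then have "lag_C1 \<omega> (\<lambda>t. ?A t ` M) a b"
    by (intro lag_C1_symplectic_path M symplectic_map_rotated_path symp)
  moreover have "regular_crossings \<omega> L (\<lambda>t. ?A t ` M) a b"
  proof (rule rotated_path_regular[OF ab M symp \<psi>' \<phi>'(1)])
    fix t u assume t: "t \<in> {a..b}" and crossing: "is_crossing L (\<lambda>t. ?A t ` M) t" and u: "\<psi> t u \<noteq> 0"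
    let ?rate = "\<omega> (rotation N (\<phi> t) (\<psi> t u)) (rotation_deriv N (\<phi> t) (\<psi> t u))"
    have "\<bar>\<omega> (\<psi> t u) (\<psi>' t u)\<bar> \<le> K * (norm (\<psi> t u))\<^sup>2" by (rule K(2)[OF t])
    also have "\<dots> < \<bar>\<phi>' t\<bar> * (real N * rotation_rate) * (norm (\<psi> t u))\<^sup>2"
      using fast[OF t crossing] u by (intro mult_strict_right_mono) auto
    also have "\<dots> = \<bar>\<phi>' t\<bar> * (real N * rotation_rate * (norm (\<psi> t u))\<^sup>2)" by (simp add: mult.assoc)
    also have "\<dots> \<le> \<bar>\<phi>' t\<bar> * ?rate"
      using \<phi>_range[OF t] by (intro mult_left_mono omega_rotation_deriv) auto
    finally show "\<bar>\<omega> (\<psi> t u) (\<psi>' t u)\<bar> < \<bar>\<phi>' t\<bar> * ?rate" .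
  qed
  moreover have "lag_homotopic \<omega> (\<lambda>t. \<psi> t ` M) (\<lambda>t. ?A t ` M) a b"
    by (rule rotated_path_homotopic[OF M cont_\<psi> symp cont_\<phi> \<phi>_ends])
  ultimately show ?thesis by (rule that)
qed

section \<open>Comparison of two paths\<close>

lemma index_difference:
  fixes \<psi> :: "'b::metric_space \<Rightarrow> 'a \<Rightarrow>\<^sub>L 'a"
  assumes \<psi>: "continuous_on X \<psi>" "\<And>t. t \<in> X \<Longrightarrow> symplectic_map \<omega> (\<psi> t)"
    and X: "connected X" "p \<in> X" "q \<in> X" and L: "lagrangian \<omega> L"
    and t1: "transversal W L1" and t2: "transversal W L2"
    and f1: "index_function L X (\<lambda>t. \<psi> t ` L1) f1" and f2: "index_function L X (\<lambda>t. \<psi> t ` L2) f2"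
  defines "D \<equiv> \<lambda>t. chart_index (\<psi> t ` W) (\<psi> t ` L2) L - chart_index (\<psi> t ` W) (\<psi> t ` L1) L"
  shows "(f2 q - f2 p) - (f1 q - f1 p) = D q - D p"
proof -
  let ?I = "\<lambda>t M. chart_index (\<psi> t ` W) (\<psi> t ` M) L"
  note lag = transversal_lagrangian(1)[OF t1] transversal_lagrangian(2)[OF t1]
    transversal_lagrangian(2)[OF t2]
  have "(f2 q - f1 q) - (f2 p - f1 p) = D q - D p"
  proof (rule connected_increments_eq[OF X])
    fix t assume t: "t \<in> X"
    obtain V where V: "\<And>\<alpha>. \<alpha> \<in> {L, \<psi> t ` L1, \<psi> t ` L2, \<psi> t ` W} \<Longrightarrow> transversal V \<alpha>"
      by (rule common_transversal[of "{L, \<psi> t ` L1, \<psi> t ` L2, \<psi> t ` W}"])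
        (use L lagrangian_image[OF \<psi>(2)[OF t]] lag in auto)
    have near: "\<forall>\<^sub>F s in at t within X.
        ?I s M - f s - chart_index V L (\<psi> s ` W) = ?I t M - f t - chart_index V L (\<psi> t ` W)"
      if M: "transversal W M" "transversal V (\<psi> t ` M)"
        and f: "index_function L X (\<lambda>t. \<psi> t ` M) f" for M f
    proof -
      note lM = transversal_lagrangian(2)[OF M(1)]
      have cont: "subspaces_continuous_on X (\<lambda>t. \<psi> t ` M)"
        by (intro subspaces_continuous_on_image \<psi>(1) symplectic_map_bij[OF \<psi>(2)]
          lagrangian_subspace lM)
      have "\<forall>\<^sub>F s in at t within X. s \<in> X" by (simp add: eventually_at_filter)
      then have "\<forall>\<^sub>F s in at t within X. transversal (\<psi> s ` W) (\<psi> s ` M)"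
        by eventually_elim (rule transversal_image[OF \<psi>(2) M(1)])
      from chart_index_change_locally_constant[OF cont lagrangian_image[OF \<psi>(2) lM] \<psi> t V M(2) V
          transversal_image[OF \<psi>(2)[OF t] M(1)] this lag(1)]
      have "\<forall>\<^sub>F s in at t within X.
          ?I s M - chart_index V (\<psi> s ` M) L - chart_index V L (\<psi> s ` W) =
          ?I t M - chart_index V (\<psi> t ` M) L - chart_index V L (\<psi> t ` W)"
        by simp
      with index_functionD[OF f t M(2)] show ?thesis by eventually_elim linarith
    qed
    have "transversal V (\<psi> t ` L1)" "transversal V (\<psi> t ` L2)" using V by auto
    from near[OF t1 this(1) f1] near[OF t2 this(2) f2]
    show "\<forall>\<^sub>F s in at t within X. f2 s - f1 s - D s = f2 t - f1 t - D t"
      unfolding D_def by eventually_elim linarith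
  qed
  then show ?thesis by simp
qed

theorem index_increment_le:
  fixes \<psi> :: "'b::metric_space \<Rightarrow> 'a \<Rightarrow>\<^sub>L 'a"
  assumes \<psi>: "continuous_on X \<psi>" "\<And>t. t \<in> X \<Longrightarrow> symplectic_map \<omega> (\<psi> t)" "\<psi> p = id_blinfun"
    and X: "connected X" "p \<in> X" "q \<in> X"
    and lag: "lagrangian \<omega> L1" "lagrangian \<omega> L2" "lagrangian \<omega> L3"
    and max: "triple_index \<omega> L1 L2 L3 = dim L1 - dim (L1 \<inter> L2)"
    and f1: "index_function L3 X (\<lambda>t. \<psi> t ` L1) f1" and f2: "index_function L3 X (\<lambda>t. \<psi> t ` L2) f2"
  shows "f2 q - f2 p \<le> f1 q - f1 p"
proof -
  obtain W where W: "\<And>\<alpha>. \<alpha> \<in> {L1, L2} \<Longrightarrow> transversal W \<alpha>"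
    by (rule common_transversal[of "{L1, L2}"]) (use lag in auto)
  then have W: "transversal W L1" "transversal W L2" by auto
  note A = \<psi>(2)[OF X(3)]
  define D where "D t = chart_index (\<psi> t ` W) (\<psi> t ` L2) L3 - chart_index (\<psi> t ` W) (\<psi> t ` L1) L3"
    for t
  have "D p = int (n_plus (chart_form W L2) L1)"
    using n_plus_chart_form_maximal[OF W lag(3) max] by (simp add: D_def chart_index_def \<psi>(3))
  moreover have "D q \<le> int (n_plus (chart_form W L2) L1)"
    using n_plus_chart_form_le[OF transversal_image[OF A W(1)] transversal_image[OF A W(2)]
        lagrangian_subspace[OF lag(3)]]
      n_plus_chart_form_image[OF A W(2) lagrangian_subspace[OF lag(1)]]
    by (simp add: D_def chart_index_def)
  moreover have "(f2 q - f2 p) - (f1 q - f1 p) = D q - D p"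
    unfolding D_def by (rule index_difference[OF \<psi>(1,2) X lag(3) W f1 f2])
  ultimately show ?thesis by linarith
qed

lemma exists_index_function_symplectic_path:
  fixes \<psi> :: "'b::euclidean_space \<Rightarrow> 'a \<Rightarrow>\<^sub>L 'a"
  assumes \<psi>: "continuous_on X \<psi>" "\<And>t. t \<in> X \<Longrightarrow> symplectic_map \<omega> (\<psi> t)"
    and X: "compact X" "convex X" and lag: "lagrangian \<omega> L" "lagrangian \<omega> M"
  obtains f where "index_function L X (\<lambda>t. \<psi> t ` M) f"
proof (rule exists_index_function[OF _ _ lag(1) X])
  show "subspaces_continuous_on X (\<lambda>t. \<psi> t ` M)"
    by (intro subspaces_continuous_on_image \<psi>(1) symplectic_map_bij[OF \<psi>(2)] lagrangian_subspace
      lag(2))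
  show "lagrangian \<omega> (\<psi> t ` M)" if "t \<in> X" for t by (rule lagrangian_image[OF \<psi>(2)[OF that] lag(2)])
qed (rule that)

lemma iota_CLM_symplectic_path:
  fixes \<psi> :: "real \<Rightarrow> 'a \<Rightarrow>\<^sub>L 'a"
  assumes ab: "a < b" and \<psi>: "C1_on {a..b} \<psi>" "\<And>t. t \<in> {a..b} \<Longrightarrow> symplectic_map \<omega> (\<psi> t)"
    and lag: "lagrangian \<omega> L" "lagrangian \<omega> M"
  obtains f where "index_function L {a..b} (\<lambda>t. \<psi> t ` M) f"
    "iota_CLM \<omega> L (\<lambda>t. \<psi> t ` M) a b = f b - f a"
proof -
  obtain f where f: "index_function L {a..b} (\<lambda>t. \<psi> t ` M) f"
    by (rule exists_index_function_symplectic_path[OF C1_on_imp_continuous_on[OF \<psi>(1)] \<psi>(2)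
          compact_Icc convex_closed_interval lag])
  obtain m where "lag_C1 \<omega> m a b" "regular_crossings \<omega> L m a b"
    "lag_homotopic \<omega> (\<lambda>t. \<psi> t ` M) m a b"
    by (rule exists_regular_representative[OF ab lag \<psi>(2,1)])
  from iota_CLM_eq_index[OF lag(1) ab f this] show ?thesis by (rule that[OF f])
qed

theorem iota_CLM_le:
  fixes \<psi> :: "real \<Rightarrow> 'a \<Rightarrow>\<^sub>L 'a"
  assumes ab: "a < b" and \<psi>: "C1_on {a..b} \<psi>" "\<And>t. t \<in> {a..b} \<Longrightarrow> symplectic_map \<omega> (\<psi> t)"
    and start: "\<psi> a = id_blinfun"
    and lag: "lagrangian \<omega> L1" "lagrangian \<omega> L2" "lagrangian \<omega> L3"
    and max: "triple_index \<omega> L1 L2 L3 = dim L1 - dim (L1 \<inter> L2)"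
  shows "iota_CLM \<omega> L3 (\<lambda>t. \<psi> t ` L2) a b \<le> iota_CLM \<omega> L3 (\<lambda>t. \<psi> t ` L1) a b"
proof -
  obtain f1 where f1: "index_function L3 {a..b} (\<lambda>t. \<psi> t ` L1) f1"
    "iota_CLM \<omega> L3 (\<lambda>t. \<psi> t ` L1) a b = f1 b - f1 a"
    by (rule iota_CLM_symplectic_path[OF ab \<psi> lag(3,1)])
  obtain f2 where f2: "index_function L3 {a..b} (\<lambda>t. \<psi> t ` L2) f2"
    "iota_CLM \<omega> L3 (\<lambda>t. \<psi> t ` L2) a b = f2 b - f2 a"
    by (rule iota_CLM_symplectic_path[OF ab \<psi> lag(3,2)])
  have "f2 b - f2 a \<le> f1 b - f1 a"
    using ab
    by (intro index_increment_le[OF C1_on_imp_continuous_on[OF \<psi>(1)] \<psi>(2) start connected_Icc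
          _ _ lag max f1(1) f2(1)]) auto
  then show ?thesis unfolding f1(2) f2(2) .
qed

theorem iota_CLM_plus_curve_nonneg:
  fixes \<psi> :: "real \<Rightarrow> 'a \<Rightarrow>\<^sub>L 'a"
  assumes ab: "a < b" and \<psi>: "C1_on {a..b} \<psi>" "\<And>t. t \<in> {a..b} \<Longrightarrow> symplectic_map \<omega> (\<psi> t)"
    and lag: "lagrangian \<omega> L" "lagrangian \<omega> M" and plus: "plus_curve \<omega> L (\<lambda>t. \<psi> t ` M) a b"
  shows "0 \<le> iota_CLM \<omega> L (\<lambda>t. \<psi> t ` M) a b"
proof -
  obtain f where f: "index_function L {a..b} (\<lambda>t. \<psi> t ` M) f"
    "iota_CLM \<omega> L (\<lambda>t. \<psi> t ` M) a b = f b - f a"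
    by (rule iota_CLM_symplectic_path[OF ab \<psi> lag])
  have "lag_C1 \<omega> (\<lambda>t. \<psi> t ` M) a b" using plus by (simp add: plus_curve_def)
  from crossing_sum_eq_index[OF lag(1) ab this
    plus_curve_crossing_sum_nonneg(1)[OF plus ab lag(1)] f(1)]
  show ?thesis using plus_curve_crossing_sum_nonneg(2)[OF plus ab lag(1)] f(2) by simp
qed

end

theorem theorem4p1:
  fixes \<omega> :: "'a::euclidean_space \<Rightarrow> 'a \<Rightarrow> real"
    and n :: nat and T :: real
    and L1 L2 L3 :: "'a set"
    and \<psi> :: "real \<Rightarrow> ('a \<Rightarrow>\<^sub>L 'a)"
  assumes symp: "symplectic_form \<omega>"
    and dimV: "DIM('a) = 2 * n"
    and T: "0 < T"
    and lag1: "lagrangian \<omega> L1" and lag2: "lagrangian \<omega> L2" and lag3: "lagrangian \<omega> L3"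
    and psi_symp: "\<forall>t\<in>{0..T}. symplectic_map \<omega> (\<psi> t)"
    and psi_C1: "C1_on {0..T} \<psi>"
    and psi0: "\<psi> 0 = id_blinfun"
    and h1: "plus_curve \<omega> L3 (\<lambda>t. blinfun_apply (\<psi> t) ` L2) 0 T"
    and h2: "triple_index \<omega> L1 L2 L3 = n - dim (L1 \<inter> L2)"
    and h3: "iota_CLM \<omega> L3 (\<lambda>t. blinfun_apply (\<psi> t) ` L1) 0 T = 0"
  shows "iota_CLM \<omega> L3 (\<lambda>t. blinfun_apply (\<psi> t) ` L2) 0 T = 0"
proof (rule antisym)
  interpret symplectic_space \<omega> by unfold_locales (rule symp)
  note \<psi> = psi_C1 bspec[OF psi_symp]
  have "dim L1 = n" using dim_lagrangian[OF lag1] dimV by simp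
  with h2 have max: "triple_index \<omega> L1 L2 L3 = dim L1 - dim (L1 \<inter> L2)" by simp
  have "iota_CLM \<omega> L3 (\<lambda>t. \<psi> t ` L2) 0 T \<le> iota_CLM \<omega> L3 (\<lambda>t. \<psi> t ` L1) 0 T"
    by (rule iota_CLM_le[OF T \<psi> psi0 lag1 lag2 lag3 max])
  also have "\<dots> = 0" by (rule h3)
  finally show "iota_CLM \<omega> L3 (\<lambda>t. \<psi> t ` L2) 0 T \<le> 0" .
  show "0 \<le> iota_CLM \<omega> L3 (\<lambda>t. \<psi> t ` L2) 0 T"
    by (rule iota_CLM_plus_curve_nonneg[OF T \<psi> lag3 lag2 h1])
qed

end
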